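(* There exist absolute constants $\varrho_1>\varrho_2>0$ such that, along any sequence $n,d\to\infty$: (i) if $d^2\ge \varrho_1\, n\log n$ for all $n$ in the sequence, then $\mathbb P(\mathsf{PR}_n)\to 1$; (ii) if $d^2\le \varrho_2\, n\log n$ for all $n$ in the sequence, then $\mathbb P(\mathsf{PR}_n)\to 0$. Moreover, one may take any $\varrho_1>8$ and any $\varrho_2<2/\pi$.
   Context: Gaussian model: $u_1,\dots,u_n,v_1,\dots,v_n\in\mathbb R^d$ are i.i.d. $\mathcal N(0,I_d/d)$. For $W\in\mathbb R^{d\times d}$, the top-1 retrieval event is $\mathsf{PR}_n(W)=\bigcap_{i=1}^n\{u_i^\top W v_i>u_j^\top W v_i \text{ for all } j\neq i\}$, and $\mathsf{PR}_n$ is the event that there exists some $W\in\mathbb R^{d\times d}$ (allowed to depend on the whole realization of the $u_i,v_i$) such that $\mathsf{PR}_n(W)$ holds. *)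

theory Defs
  imports "HOL-Probability.Probability"
begin

text \<open>Sample space: a realization is a function x on the index set
  UNIV \<times> {..<n} \<times> {..<d}; u_i has coordinates x (False,i,k), v_i has
  coordinates x (True,i,k), for i < n and k < d.  All coordinates are i.i.d.
  N(0, 1/d), i.e. each vector is N(0, I_d/d).\<close>

definition gauss_model :: "nat \<Rightarrow> nat \<Rightarrow> (bool \<times> nat \<times> nat \<Rightarrow> real) measure" where
  "gauss_model n d =
     PiM (UNIV \<times> {..<n} \<times> {..<d})
         (\<lambda>_. density lborel (normal_density 0 (1 / sqrt (real d))))"

definition uvec :: "(bool \<times> nat \<times> nat \<Rightarrow> real) \<Rightarrow> nat \<Rightarrow> nat \<Rightarrow> real" where
  "uvec x i k = x (False, i, k)"

definition vvec :: "(bool \<times> nat \<times> nat \<Rightarrow> real) \<Rightarrow> nat \<Rightarrow> nat \<Rightarrow> real" where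
  "vvec x i k = x (True, i, k)"

definition bilin :: "nat \<Rightarrow> (nat \<Rightarrow> real) \<Rightarrow> (nat \<Rightarrow> nat \<Rightarrow> real) \<Rightarrow> (nat \<Rightarrow> real) \<Rightarrow> real" where
  "bilin d a W b = (\<Sum>p<d. \<Sum>q<d. a p * W p q * b q)"

definition PR_W :: "nat \<Rightarrow> nat \<Rightarrow> (nat \<Rightarrow> nat \<Rightarrow> real) \<Rightarrow> (bool \<times> nat \<times> nat \<Rightarrow> real) \<Rightarrow> bool" where
  "PR_W n d W x \<longleftrightarrow>
     (\<forall>i<n. \<forall>j<n. j \<noteq> i \<longrightarrow>
        bilin d (uvec x i) W (vvec x i) > bilin d (uvec x j) W (vvec x i))"

definition PR :: "nat \<Rightarrow> nat \<Rightarrow> (bool \<times> nat \<times> nat \<Rightarrow> real) \<Rightarrow> bool" where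
  "PR n d x \<longleftrightarrow> (\<exists>W. PR_W n d W x)"

definition PR_prob :: "nat \<Rightarrow> nat \<Rightarrow> real" where
  "PR_prob n d = measure (gauss_model n d) {x \<in> space (gauss_model n d). PR n d x}"

end

theory Submission
  imports Defs "HOL-Real_Asymp.Real_Asymp"
begin

text \<open>
  For large $d$ the matrix $W = \sum_k u_k v_k^T$ retrieves: up to small errors,
  $(u_i - u_j)^T W v_i$ is $1$ plus the noise
  $\sum_{k \neq i,j} \langle u_i - u_j, u_k\rangle \langle v_k, v_i\rangle$, a sum of independent
  terms whose total variance is about $2n/d^2$, so it is below $-1$ with probability roughly
  $e^{-d^2/(4n)}$. This beats the $n^2$ pairs when $d^2 > 8 n \log n$.

  Conversely, retrieval says that $u_i^T W v_i$ is the maximum over $j$ of $u_j^T W v_i$. Uniformly in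
  $x$, $\max_j \langle u_j, x\rangle \gtrsim \sqrt{\log n / d}\,|x|$, because the failure probability
  $\exp(-n^{1/2 + c})$ for a single $x$ beats a net of $e^{O(d \log n)}$ points. Hence
  $\langle W, \sum_i u_i v_i^T\rangle \gtrsim \sqrt{\log n / d} \sum_i |W v_i|$. If $w_p$ are the rows
  of $W$, Cauchy-Schwarz gives $\|W\|_F |W v| \geq \sum_p |w_p| |\langle w_p, v\rangle|$, which reduces
  the lower bound $\sum_i |W v_i| \gtrsim n \sqrt{2/(\pi d)} \|W\|_F$ to a bound uniform over directions
  in $d$ (not $d^2$) dimensions. Finally $\|\sum_i u_i v_i^T\|_F \approx \sqrt n$ by a second moment
  computation, and the three estimates force $d^2 \gtrsim (2/\pi) n \log n$.
\<close>

section \<open>The model as independent pairs\<close>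

text \<open>In the converse W may depend on the sample, so every estimate must hold for all W at
  once. For d near sqrt (n log n) a net of matrices has about e^(d^2 log n) points, more than the
  e^(-cn) from n independent vectors can pay for; a net of directions has only e^(n^(1/2 + o(1))).
  This fixes both constants there. For one fixed x the maximum of <u_j, x> is about sqrt (2 log n /
  d) |x|, but height t sqrt (log n / d) |x| is missed with probability exp (- n^(1 - t^2/2 + o(1))),
  and this beats the net as soon as t < 1. The row-wise Cauchy-Schwarz step bounds the mean of |W v|
  below by sqrt (2 / (pi d)) |W|_F, which is attained by W of rank one, so a bound uniform in W
  cannot do better at this point. In the other direction W is explicit. The noise of one comparison
  is studied conditionally on the vectors with indices i and j, because only then are its summands
  independent; the union bound over ordered pairs is the source of 2 log n and hence of 8 = 4 *
  2.\<close>

definition gvec :: "nat \<Rightarrow> (nat \<Rightarrow> real) measure" where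
  "gvec d = PiM {..<d} (\<lambda>_. density lborel (normal_density 0 (1 / sqrt (real d))))"

definition gpairs :: "nat \<Rightarrow> nat \<Rightarrow> (nat \<Rightarrow> (nat \<Rightarrow> real) \<times> (nat \<Rightarrow> real)) measure" where
  "gpairs n d = PiM {..<n} (\<lambda>_. gvec d \<Otimes>\<^sub>M gvec d)"

definition dot :: "nat \<Rightarrow> (nat \<Rightarrow> real) \<Rightarrow> (nat \<Rightarrow> real) \<Rightarrow> real" where
  "dot d a b = (\<Sum>p<d. a p * b p)"

text \<open>The restriction makes the result extensional, as the space of \<open>gauss_model\<close>
  demands; \<open>True\<close> selects v, as in \<open>vvec\<close>.\<close>

definition unpair :: "nat \<Rightarrow> nat \<Rightarrow> (nat \<Rightarrow> (nat \<Rightarrow> real) \<times> (nat \<Rightarrow> real)) \<Rightarrow> bool \<times> nat \<times> nat \<Rightarrow> real" where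
  "unpair n d z = (\<lambda>(b, i, k)\<in>UNIV \<times> {..<n} \<times> {..<d}. (if b then snd else fst) (z i) k)"

lemma prob_space_coord: "0 < d \<Longrightarrow> prob_space (density lborel (normal_density 0 (1 / sqrt (real d))))"
  by (rule prob_space_normal_density) simp

lemma sets_gvec [measurable_cong]: "sets (gvec d) = sets (PiM {..<d} (\<lambda>_. borel))"
  unfolding gvec_def by (rule sets_PiM_cong) simp_all

lemma prob_space_gvec: "0 < d \<Longrightarrow> prob_space (gvec d)"
  unfolding gvec_def by (intro prob_space_PiM prob_space_coord)

lemma prob_space_gvec_pair: "0 < d \<Longrightarrow> prob_space (gvec d \<Otimes>\<^sub>M gvec d)"
  by (intro prob_space_pair prob_space_gvec)

lemma prob_space_gpairs: "0 < d \<Longrightarrow> prob_space (gpairs n d)"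
  unfolding gpairs_def by (intro prob_space_PiM prob_space_gvec_pair)

lemma product_sigma_finite_coord:
  "0 < d \<Longrightarrow> product_sigma_finite (\<lambda>_. density lborel (normal_density 0 (1 / sqrt (real d))))"
  by (simp add: product_sigma_finite_def prob_space_coord prob_space_imp_sigma_finite)

lemma product_sigma_finite_pairs:
  "0 < d \<Longrightarrow> product_sigma_finite (\<lambda>_. gvec d \<Otimes>\<^sub>M gvec d)"
  by (simp add: product_sigma_finite_def prob_space_gvec_pair prob_space_imp_sigma_finite)

lemma measurable_gvec_coord: "k < d \<Longrightarrow> (\<lambda>x. x k) \<in> borel_measurable (gvec d)"
  unfolding gvec_def by measurable

lemma measurable_gpairs_component:
  "i < n \<Longrightarrow> (\<lambda>z. z i) \<in> gpairs n d \<rightarrow>\<^sub>M gvec d \<Otimes>\<^sub>M gvec d"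
  unfolding gpairs_def by measurable

lemma measurable_gpairs_fst_snd:
  assumes "i < n"
  shows "(\<lambda>z. fst (z i)) \<in> gpairs n d \<rightarrow>\<^sub>M gvec d" "(\<lambda>z. snd (z i)) \<in> gpairs n d \<rightarrow>\<^sub>M gvec d"
  using measurable_gpairs_component[OF assms, of d] by measurable

lemma measurable_dot [measurable]:
  assumes [measurable]: "f \<in> M \<rightarrow>\<^sub>M gvec d" "g \<in> M \<rightarrow>\<^sub>M gvec d"
  shows "(\<lambda>x. dot d (f x) (g x)) \<in> borel_measurable M"
proof -
  have "(\<lambda>x. f x p) \<in> borel_measurable M" "(\<lambda>x. g x p) \<in> borel_measurable M" if "p < d" for p
    using measurable_compose[OF assms(1) measurable_gvec_coord[OF that]]
      measurable_compose[OF assms(2) measurable_gvec_coord[OF that]] by simp_all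
  then show ?thesis unfolding dot_def by (intro borel_measurable_sum borel_measurable_times) auto
qed

text \<open>Not an instance of \<open>measurable_dot\<close>: a fixed vector c need not be
  extensional on {..<d}, so it may lie outside the space of \<open>gvec d\<close>, and then the
  constant map is not measurable into it.\<close>

lemma measurable_dot_left [measurable]:
  assumes [measurable]: "g \<in> M \<rightarrow>\<^sub>M gvec d"
  shows "(\<lambda>x. dot d c (g x)) \<in> borel_measurable M"
proof -
  have "(\<lambda>x. g x p) \<in> borel_measurable M" if "p < d" for p
    using measurable_compose[OF assms(1) measurable_gvec_coord[OF that]] by simp_all
  then show ?thesis unfolding dot_def by (intro borel_measurable_sum borel_measurable_times) auto
qed

lemma dot_commute: "dot d a b = dot d b a"
  by (simp add: dot_def mult.commute)

lemma dot_self_nonneg [simp]: "0 \<le> dot d a a"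
  unfolding dot_def by (intro sum_nonneg) auto

lemma measurable_unpair [measurable]: "unpair n d \<in> gpairs n d \<rightarrow>\<^sub>M gauss_model n d"
  unfolding unpair_def gauss_model_def
proof (rule measurable_restrict)
  fix q :: "bool \<times> nat \<times> nat" assume "q \<in> UNIV \<times> {..<n} \<times> {..<d}"
  then obtain b i k where q: "q = (b, i, k)" "i < n" "k < d" by auto
  have "(\<lambda>z. z i) \<in> gpairs n d \<rightarrow>\<^sub>M gvec d \<Otimes>\<^sub>M gvec d" using q by (simp add: measurable_gpairs_component)
  then have "(\<lambda>z. fst (z i)) \<in> gpairs n d \<rightarrow>\<^sub>M gvec d" "(\<lambda>z. snd (z i)) \<in> gpairs n d \<rightarrow>\<^sub>M gvec d"
    by measurable
  from this[THEN measurable_compose, OF measurable_gvec_coord[OF q(3)]]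
  show "(\<lambda>z. case q of (b, i, k) \<Rightarrow> (if b then snd else fst) (z i) k)
      \<in> gpairs n d \<rightarrow>\<^sub>M density lborel (\<lambda>x. ennreal (normal_density 0 (1 / sqrt (real d)) x))"
    by (cases b) (simp_all add: q)
qed

text \<open>Retrieval compares pairs (u_i, v_i). After regrouping the coordinates these are n i.i.d.
  factors, which permits conditioning on two pairs and induction on n. A finite product measure is
  determined by its values on boxes, and the preimage of a box is again a product of boxes.\<close>

lemma gauss_model_eq_distr:
  assumes "0 < d"
  shows "gauss_model n d = distr (gpairs n d) (gauss_model n d) (unpair n d)"
proof -
  let ?N = "density lborel (\<lambda>x. ennreal (normal_density 0 (1 / sqrt (real d)) x))"
  let ?I = "UNIV \<times> {..<n} \<times> {..<d} :: (bool \<times> nat \<times> nat) set"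
  interpret N: product_sigma_finite "\<lambda>_::bool \<times> nat \<times> nat. ?N"
    using assms by (rule product_sigma_finite_coord)
  interpret N1: product_sigma_finite "\<lambda>_::nat. ?N"
    using assms by (rule product_sigma_finite_coord)
  interpret P: product_sigma_finite "\<lambda>_::nat. gvec d \<Otimes>\<^sub>M gvec d"
    using assms by (rule product_sigma_finite_pairs)
  interpret V: prob_space "gvec d" using assms by (rule prob_space_gvec)
  have "distr (gpairs n d) (gauss_model n d) (unpair n d) = PiM ?I (\<lambda>_. ?N)"
  proof (rule N.PiM_eqI)
    show "finite ?I" by simp
    show "sets (distr (gpairs n d) (gauss_model n d) (unpair n d)) = sets (Pi\<^sub>M ?I (\<lambda>_. ?N))"
      by (simp add: gauss_model_def)
    fix A :: "bool \<times> nat \<times> nat \<Rightarrow> real set" assume A: "\<And>i. i \<in> ?I \<Longrightarrow> A i \<in> sets ?N"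
    let ?E = "\<lambda>b i. PiE {..<d} (\<lambda>k. A (b, i, k))"
    have E: "?E b i \<in> sets (gvec d)" if "i < n" for b i
      unfolding gvec_def using A that by (intro sets_PiM_I_finite) auto
    have spE: "x \<in> space (gvec d) \<longleftrightarrow> x \<in> extensional {..<d}" for x
      by (simp add: gvec_def space_PiM PiE_def)
    have eq: "unpair n d -` Pi\<^sub>E ?I A \<inter> space (gpairs n d) = PiE {..<n} (\<lambda>i. ?E False i \<times> ?E True i)"
      (is "?L = ?R")
    proof (intro set_eqI iffI)
      fix z assume z: "z \<in> ?L"
      then have 1: "(if b then snd else fst) (z i) k \<in> A (b, i, k)" if "i < n" "k < d" for b i k
        using that by (auto simp: unpair_def PiE_iff Ball_def dest!: spec[of _ b])
      have 2: "z \<in> extensional {..<n}" "z i \<in> space (gvec d \<Otimes>\<^sub>M gvec d)" if "i < n" for i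
        using z that by (auto simp: gpairs_def space_PiM PiE_iff)
      have 3: "z \<in> extensional {..<n}" using z by (auto simp: gpairs_def space_PiM PiE_iff)
      show "z \<in> ?R"
        using 1[of _ _ True] 1[of _ _ False] 2 3
        by (auto simp: PiE_iff space_pair_measure spE mem_Times_iff)
    next
      fix z assume z: "z \<in> ?R"
      then have "z i \<in> space (gvec d \<Otimes>\<^sub>M gvec d)" if "i < n" for i
        using that by (auto simp: PiE_iff space_pair_measure spE mem_Times_iff)
      then have "z \<in> space (gpairs n d)" using z
        by (auto simp: gpairs_def space_PiM PiE_iff)
      moreover have "unpair n d z \<in> Pi\<^sub>E ?I A"
        using z by (auto simp: unpair_def PiE_iff mem_Times_iff)
      ultimately show "z \<in> ?L" by simp
    qed
    have box: "Pi\<^sub>E ?I A \<in> sets (gauss_model n d)"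
      unfolding gauss_model_def using A by (intro sets_PiM_I_finite) auto
    have "emeasure (distr (gpairs n d) (gauss_model n d) (unpair n d)) (Pi\<^sub>E ?I A)
        = emeasure (gpairs n d) ?R"
      by (subst emeasure_distr[OF measurable_unpair box]) (simp add: eq)
    also have "\<dots> = (\<Prod>i<n. emeasure (gvec d \<Otimes>\<^sub>M gvec d) (?E False i \<times> ?E True i))"
      unfolding gpairs_def by (rule P.emeasure_PiM) (auto intro!: pair_measureI E)
    also have "\<dots> = (\<Prod>i<n. emeasure (gvec d) (?E False i) * emeasure (gvec d) (?E True i))"
      by (intro prod.cong refl V.emeasure_pair_measure_Times E) auto
    also have "\<dots> = (\<Prod>i<n. (\<Prod>k<d. emeasure ?N (A (False, i, k))) * (\<Prod>k<d. emeasure ?N (A (True, i, k))))"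
      unfolding gvec_def using A
      by (intro prod.cong refl arg_cong2[where f="(*)"] N1.emeasure_PiM) auto
    also have "\<dots> = (\<Prod>b\<in>(UNIV::bool set). \<Prod>i<n. \<Prod>k<d. emeasure ?N (A (b, i, k)))"
      by (simp add: UNIV_bool prod.distrib mult.commute)
    also have "\<dots> = (\<Prod>i\<in>?I. emeasure ?N (A i))"
      by (simp add: prod.cartesian_product split_def)
    finally show "emeasure (distr (gpairs n d) (gauss_model n d) (unpair n d)) (Pi\<^sub>E ?I A) = (\<Prod>i\<in>?I. emeasure ?N (A i))" .
  qed
  then show ?thesis by (simp add: gauss_model_def)
qed

section \<open>Measurability of the retrieval event and its transfer to pairs\<close>

lemma bilin_cong:
  "(\<And>p. p < d \<Longrightarrow> a p = a' p) \<Longrightarrow> (\<And>q. q < d \<Longrightarrow> b q = b' q) \<Longrightarrow>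
   (\<And>p q. p < d \<Longrightarrow> q < d \<Longrightarrow> W p q = W' p q) \<Longrightarrow> bilin d a W b = bilin d a' W' b'"
  unfolding bilin_def by (intro sum.cong refl) auto

text \<open>Retrieval is an open condition on W and invariant under positive scaling, so integer matrices
  suffice; the event is thus a countable union of measurable sets.\<close>

lemma PR_iff_int_list:
  "PR n d x \<longleftrightarrow> (\<exists>L :: int list. PR_W n d (\<lambda>p q. real_of_int (L ! (p * d + q))) x)"
proof
  assume "PR n d x"
  then obtain W where W: "PR_W n d W x" by (auto simp: PR_def)
  define F where "F N p q = real_of_int \<lfloor>real N * W p q\<rfloor>" for N :: nat and p q
  have flr: "(\<lambda>N. real_of_int \<lfloor>real N * w\<rfloor> / real N) \<longlonglongrightarrow> w" for w :: real
  proof (rule LIM_zero_cancel, rule Lim_transform_bound)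
    show "\<forall>\<^sub>F N in sequentially. norm (real_of_int \<lfloor>real N * w\<rfloor> / real N - w) \<le> norm (inverse (real N))"
    proof (rule eventually_mono[OF eventually_gt_at_top[of 0]])
      fix N :: nat assume N: "N > 0"
      have "real_of_int \<lfloor>real N * w\<rfloor> / real N - w = (real_of_int \<lfloor>real N * w\<rfloor> - real N * w) / real N"
        using N by (simp add: field_simps)
      moreover have "\<bar>real_of_int \<lfloor>real N * w\<rfloor> - real N * w\<bar> \<le> 1" by linarith
      ultimately show "norm (real_of_int \<lfloor>real N * w\<rfloor> / real N - w) \<le> norm (inverse (real N))"
        by (simp add: abs_divide inverse_eq_divide divide_right_mono)
    qed
    show "(\<lambda>N. inverse (real N)) \<longlonglongrightarrow> 0" by (rule lim_inverse_n)
  qed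
  have lim: "(\<lambda>N. bilin d a (F N) b / real N) \<longlonglongrightarrow> bilin d a W b" for a b
  proof -
    have "bilin d a (F N) b / real N = (\<Sum>p<d. \<Sum>q<d. a p * (F N p q / real N) * b q)" for N
      by (simp add: bilin_def sum_divide_distrib)
    then show ?thesis
      by (simp only: bilin_def[of _ _ W] F_def) (intro tendsto_intros flr)
  qed
  have "\<forall>\<^sub>F N in sequentially. j \<noteq> i \<longrightarrow>
        bilin d (uvec x i) (F N) (vvec x i) > bilin d (uvec x j) (F N) (vvec x i)"
    if "i < n" "j < n" for i j
  proof (cases "j = i")
    case False
    then have "0 < bilin d (uvec x i) W (vvec x i) - bilin d (uvec x j) W (vvec x i)"
      using W that by (auto simp: PR_W_def)
    moreover have "(\<lambda>N. bilin d (uvec x i) (F N) (vvec x i) / real N - bilin d (uvec x j) (F N) (vvec x i) / real N)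
        \<longlonglongrightarrow> bilin d (uvec x i) W (vvec x i) - bilin d (uvec x j) W (vvec x i)"
      by (intro tendsto_diff lim)
    ultimately have "\<forall>\<^sub>F N in sequentially. 0 <
        bilin d (uvec x i) (F N) (vvec x i) / real N - bilin d (uvec x j) (F N) (vvec x i) / real N"
      by (rule order_tendstoD(1)[rotated])
    then show ?thesis using eventually_gt_at_top[of 0]
      by eventually_elim (simp add: field_simps)
  qed simp
  then have "\<forall>\<^sub>F N in sequentially. \<forall>i\<in>{..<n}. \<forall>j\<in>{..<n}. j \<noteq> i \<longrightarrow>
        bilin d (uvec x i) (F N) (vvec x i) > bilin d (uvec x j) (F N) (vvec x i)"
    by (intro eventually_ball_finite ballI) auto
  then obtain N where N: "PR_W n d (F N) x"
    by (auto simp: PR_W_def eventually_sequentially)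
  \<comment> \<open>Row-major flattening of the d * d relevant entries: integer lists form a
    countable type, integer-valued functions do not.\<close>
  define L where "L = map (\<lambda>m. \<lfloor>real N * W (m div d) (m mod d)\<rfloor>) [0..<d * d]"
  have L: "real_of_int (L ! (p * d + q)) = F N p q" if "p < d" "q < d" for p q
  proof -
    have "p * d + q < Suc p * d" using that by simp
    also have "\<dots> \<le> d * d" using that by (intro mult_right_mono) auto
    finally show ?thesis using that by (simp add: L_def F_def)
  qed
  have "bilin d a (\<lambda>p q. real_of_int (L ! (p * d + q))) b = bilin d a (F N) b" for a b
    by (intro bilin_cong L) auto
  then have "PR_W n d (\<lambda>p q. real_of_int (L ! (p * d + q))) x"
    using N by (simp add: PR_W_def)
  then show "\<exists>L :: int list. PR_W n d (\<lambda>p q. real_of_int (L ! (p * d + q))) x" ..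
qed (auto simp: PR_def)

lemma pred_PR_W: "Measurable.pred (gauss_model n d) (PR_W n d W)"
proof -
  have [measurable]: "(\<lambda>x. x (b, i, k)) \<in> borel_measurable (gauss_model n d)" if "i < n" "k < d" for b i k
    using that unfolding gauss_model_def by measurable (use that in auto)
  have [measurable]: "(\<lambda>x. bilin d (uvec x j) W (vvec x i)) \<in> borel_measurable (gauss_model n d)"
    if "i < n" "j < n" for i j
    unfolding bilin_def uvec_def vvec_def using that
    by (intro borel_measurable_sum borel_measurable_times) auto
  have "Measurable.pred (gauss_model n d) (\<lambda>x. \<forall>i\<in>{..<n}. \<forall>j\<in>{..<n}. j \<noteq> i \<longrightarrow>
        bilin d (uvec x i) W (vvec x i) > bilin d (uvec x j) W (vvec x i))"
    by (intro pred_intros_finite) auto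
  then show ?thesis unfolding PR_W_def[abs_def] by (simp add: Ball_def)
qed

lemma sets_PR: "{x \<in> space (gauss_model n d). PR n d x} \<in> sets (gauss_model n d)"
  unfolding PR_iff_int_list by (intro sets.sets_Collect_countable_Ex predE pred_PR_W)

lemma bilin_unpair:
  "i < n \<Longrightarrow> j < n \<Longrightarrow> bilin d (uvec (unpair n d z) j) W (vvec (unpair n d z) i)
     = bilin d (fst (z j)) W (snd (z i))"
  by (intro bilin_cong) (auto simp: unpair_def uvec_def vvec_def)

definition retrieves :: "nat \<Rightarrow> nat \<Rightarrow> (nat \<Rightarrow> nat \<Rightarrow> real) \<Rightarrow> (nat \<Rightarrow> (nat \<Rightarrow> real) \<times> (nat \<Rightarrow> real)) \<Rightarrow> bool" where
  "retrieves n d W z \<longleftrightarrow> (\<forall>i<n. \<forall>j<n. j \<noteq> i \<longrightarrow>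
     bilin d (fst (z j)) W (snd (z i)) < bilin d (fst (z i)) W (snd (z i)))"

lemma PR_unpair: "PR n d (unpair n d z) \<longleftrightarrow> (\<exists>W. retrieves n d W z)"
  by (simp add: PR_def PR_W_def retrieves_def bilin_unpair)

lemma sets_retrieves: "{z \<in> space (gpairs n d). \<exists>W. retrieves n d W z} \<in> sets (gpairs n d)"
proof -
  have "unpair n d -` {x \<in> space (gauss_model n d). PR n d x} \<inter> space (gpairs n d)
     = {z \<in> space (gpairs n d). \<exists>W. retrieves n d W z}"
    using measurable_space[OF measurable_unpair] by (auto simp: PR_unpair)
  then show ?thesis using measurable_sets[OF measurable_unpair sets_PR[of n d]] by simp
qed

lemma PR_prob_eq:
  assumes "0 < d"
  shows "PR_prob n d = measure (gpairs n d) {z \<in> space (gpairs n d). \<exists>W. retrieves n d W z}"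
proof -
  have "PR_prob n d = measure (distr (gpairs n d) (gauss_model n d) (unpair n d)) {x \<in> space (gauss_model n d). PR n d x}"
    unfolding PR_prob_def by (subst gauss_model_eq_distr[OF assms]) simp
  also have "\<dots> = measure (gpairs n d) (unpair n d -` {x \<in> space (gauss_model n d). PR n d x} \<inter> space (gpairs n d))"
    by (intro measure_distr measurable_unpair sets_PR)
  also have "unpair n d -` {x \<in> space (gauss_model n d). PR n d x} \<inter> space (gpairs n d)
     = {z \<in> space (gpairs n d). \<exists>W. retrieves n d W z}"
    using measurable_space[OF measurable_unpair] by (auto simp: PR_unpair)
  finally show ?thesis .
qed

section \<open>Linear functionals of a Gaussian vector\<close>

abbreviation stdN :: "real measure" where
  "stdN \<equiv> density lborel (\<lambda>x. ennreal (std_normal_density x))"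

lemma prob_space_stdN: "prob_space stdN"
  by (rule prob_space_normal_density) simp

text \<open>A sum of independent normals is normal, here of variance |c|^2 / d. Stating the law as
  an image of the standard normal covers c = 0, where there is no density. The summation law for
  normals demands positive deviations, so vanishing coefficients are discarded first.\<close>

lemma distr_dot_gvec:
  assumes d: "0 < d"
  shows "distr (gvec d) borel (dot d c) = distr stdN borel (\<lambda>y. sqrt (dot d c c / real d) * y)"
proof -
  let ?\<sigma> = "1 / sqrt (real d)"
  let ?N = "density lborel (\<lambda>x. ennreal (normal_density 0 ?\<sigma> x))"
  let ?I = "{k. k < d \<and> c k \<noteq> 0}"
  let ?s = "sqrt (dot d c c / real d)"
  interpret V: prob_space "gvec d" using d by (rule prob_space_gvec)
  interpret S: prob_space stdN by (rule prob_space_stdN)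
  show ?thesis
  proof (cases "?I = {}")
    case True
    then have c0: "dot d c x = 0" for x unfolding dot_def by (intro sum.neutral) auto
    have "distr (gvec d) borel (dot d c) = distr (gvec d) borel (\<lambda>_. 0)"
      by (intro distr_cong) (auto simp: c0)
    moreover have "distr stdN borel (\<lambda>y. ?s * y) = distr stdN borel (\<lambda>_. 0)"
      by (intro distr_cong) (auto simp: c0)
    ultimately show ?thesis by (simp add: V.distr_const S.distr_const)
  next
    case False
    have fin: "finite ?I" by simp
    have comp: "distr (gvec d) borel (\<lambda>x. x k) = ?N" if "k < d" for k
    proof -
      have "distr (gvec d) ?N (\<lambda>x. x k) = ?N"
        unfolding gvec_def using d that by (intro distr_PiM_component prob_space_coord) auto
      moreover have "distr (gvec d) ?N (\<lambda>x. x k) = distr (gvec d) borel (\<lambda>x. x k)"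
        by (intro distr_cong) auto
      ultimately show ?thesis by simp
    qed
    have ind0: "V.indep_vars (\<lambda>_. borel) (\<lambda>k x. x k) {..<d}"
    proof (subst V.indep_vars_iff_distr_eq_PiM')
      show "{..<d} \<noteq> {}" using d by auto
      show "(\<lambda>x. x i) \<in> borel_measurable (gvec d)" if "i \<in> {..<d}" for i
        using that by (simp add: measurable_gvec_coord)
      have "distr (gvec d) (Pi\<^sub>M {..<d} (\<lambda>i. borel)) (\<lambda>x. \<lambda>i\<in>{..<d}. x i) = distr (gvec d) (gvec d) (\<lambda>x. x)"
        by (intro distr_cong)
          (simp_all only: sets_gvec, auto simp: gvec_def space_PiM PiE_def extensional_restrict)
      also have "\<dots> = PiM {..<d} (\<lambda>_. ?N)" by (simp add: gvec_def)
      also have "\<dots> = (Pi\<^sub>M {..<d} (\<lambda>i. distr (gvec d) borel (\<lambda>x. x i)))"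
        by (intro PiM_cong) (auto simp: comp)
      finally show "distr (gvec d) (Pi\<^sub>M {..<d} (\<lambda>i. borel)) (\<lambda>x. \<lambda>i\<in>{..<d}. x i)
          = (Pi\<^sub>M {..<d} (\<lambda>i. distr (gvec d) borel (\<lambda>x. x i)))" .
    qed
    have ind: "V.indep_vars (\<lambda>_. borel) (\<lambda>k x. c k * x k) ?I"
      by (rule V.indep_vars_compose2[OF V.indep_vars_subset[OF ind0], where Y="\<lambda>k y. c k * y"]) auto
    have dist: "distributed (gvec d) lborel (\<lambda>x. c k * x k) (normal_density 0 (\<bar>c k\<bar> * ?\<sigma>))"
      if "k \<in> ?I" for k
    proof -
      have "distr (gvec d) lborel (\<lambda>x. x k) = distr (gvec d) borel (\<lambda>x. x k)"
        by (intro distr_cong) auto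
      then have "distributed (gvec d) lborel (\<lambda>x. x k) (normal_density 0 ?\<sigma>)"
        using that comp by (simp add: distributed_def measurable_gvec_coord)
      from V.normal_density_affine[OF this, of "c k" 0] show ?thesis using d that by simp
    qed
    have "distributed (gvec d) lborel (\<lambda>x. \<Sum>k\<in>?I. c k * x k)
        (normal_density (\<Sum>k\<in>?I. 0) (sqrt (\<Sum>k\<in>?I. (\<bar>c k\<bar> * ?\<sigma>)\<^sup>2)))"
      using d by (intro V.sum_indep_normal fin False ind dist) auto
    moreover have "(\<Sum>k\<in>?I. c k * x k) = dot d c x" for x
      unfolding dot_def by (intro sum.mono_neutral_left) auto
    moreover have "(\<Sum>k\<in>?I. (\<bar>c k\<bar> * ?\<sigma>)\<^sup>2) = dot d c c / real d"
    proof -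
      have "(\<Sum>k\<in>?I. (\<bar>c k\<bar> * ?\<sigma>)\<^sup>2) = (\<Sum>k\<in>?I. c k * c k / real d)"
        by (intro sum.cong) (auto simp: power_mult_distrib power_divide power2_eq_square)
      also have "\<dots> = (\<Sum>k<d. c k * c k / real d)"
        by (intro sum.mono_neutral_left) auto
      finally show ?thesis by (simp add: dot_def sum_divide_distrib)
    qed
    ultimately have 1: "distributed (gvec d) lborel (dot d c) (normal_density 0 ?s)" by simp
    obtain k where k: "k < d" "c k \<noteq> 0" using False by auto
    have "0 < dot d c c" unfolding dot_def
      using k by (intro sum_pos2[of _ k]) (auto simp: zero_less_mult_iff linorder_neq_iff)
    then have s: "dot d c c \<noteq> 0" by simp
    have "distributed stdN lborel (\<lambda>x. x) (normal_density 0 1)"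
      by (auto simp: distributed_def intro!: measure_eqI simp: emeasure_distr)
    from S.normal_density_affine[OF this, of ?s 0] s d
    have 2: "distributed stdN lborel (\<lambda>x. ?s * x) (normal_density 0 ?s)"
      by (simp add: abs_of_nonneg)
    have "distr (gvec d) lborel (dot d c) = distr stdN lborel (\<lambda>x. ?s * x)"
      using 1 2 by (simp add: distributed_def)
    moreover have "distr (gvec d) lborel (dot d c) = distr (gvec d) borel (dot d c)"
      "distr stdN lborel (\<lambda>x. ?s * x) = distr stdN borel (\<lambda>x. ?s * x)"
      by (intro distr_cong; simp)+
    ultimately show ?thesis by simp
  qed
qed

lemma nn_integral_dot_gvec:
  assumes "0 < d" and [measurable]: "f \<in> borel_measurable borel"
  shows "(\<integral>\<^sup>+x. f (dot d c x) \<partial>gvec d) = (\<integral>\<^sup>+y. f (sqrt (dot d c c / real d) * y) \<partial>stdN)"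
proof -
  have "(\<integral>\<^sup>+x. f (dot d c x) \<partial>gvec d) = (\<integral>\<^sup>+y. f y \<partial>distr (gvec d) borel (dot d c))"
    by (subst nn_integral_distr) auto
  also have "\<dots> = (\<integral>\<^sup>+y. f (sqrt (dot d c c / real d) * y) \<partial>stdN)"
    unfolding distr_dot_gvec[OF assms(1)] by (subst nn_integral_distr) auto
  finally show ?thesis .
qed

section \<open>Gaussian integrals\<close>

lemma nn_integral_stdN:
  assumes [measurable]: "f \<in> borel_measurable borel"
  shows "(\<integral>\<^sup>+y. f y \<partial>stdN) = (\<integral>\<^sup>+y. ennreal (std_normal_density y) * f y \<partial>lborel)"
  by (subst nn_integral_density) auto

lemma nn_integral_stdN_exp_lin:
  "(\<integral>\<^sup>+y. ennreal (exp (a * y)) \<partial>stdN) = ennreal (exp (a\<^sup>2 / 2))"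
proof -
  have "(\<integral>\<^sup>+y. ennreal (exp (a * y)) \<partial>stdN) = (\<integral>\<^sup>+y. ennreal (exp (a\<^sup>2 / 2)) * ennreal (normal_density a 1 y) \<partial>lborel)"
  proof (subst nn_integral_stdN, simp, intro nn_integral_cong)
    fix y
    have "std_normal_density y * exp (a * y) = exp (a\<^sup>2 / 2) * normal_density a 1 y"
      by (simp add: normal_density_def exp_add[symmetric] power2_eq_square field_simps)
    then show "ennreal (std_normal_density y) * ennreal (exp (a * y)) = ennreal (exp (a\<^sup>2 / 2)) * ennreal (normal_density a 1 y)"
      by (simp add: ennreal_mult'[symmetric])
  qed
  also have "\<dots> = ennreal (exp (a\<^sup>2 / 2))"
    by (simp add: nn_integral_cmult nn_integral_eq_integral)
  finally show ?thesis .
qed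

lemma nn_integral_stdN_exp_square:
  assumes "t < 1 / 2"
  shows "(\<integral>\<^sup>+y. ennreal (exp (t * y\<^sup>2)) \<partial>stdN) = ennreal (1 / sqrt (1 - 2 * t))"
proof -
  \<comment> \<open>Absorbing exp (t y^2) into the standard density changes the variance to 1 / (1 -
    2 t).\<close>
  define s where "s = 1 / sqrt (1 - 2 * t)"
  have s: "0 < s" and s2: "s\<^sup>2 = 1 / (1 - 2 * t)" using assms by (simp_all add: s_def power_divide)
  have "(\<integral>\<^sup>+y. ennreal (exp (t * y\<^sup>2)) \<partial>stdN) = (\<integral>\<^sup>+y. ennreal s * ennreal (normal_density 0 s y) \<partial>lborel)"
  proof (subst nn_integral_stdN, simp, intro nn_integral_cong)
    fix y
    have 1: "sqrt (2 * pi * s\<^sup>2) = s * sqrt (2 * pi)" using s by (simp add: real_sqrt_mult)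
    have 2: "- y\<^sup>2 / (2 * s\<^sup>2) = t * y\<^sup>2 - y\<^sup>2 / 2" using assms by (simp add: s2 field_simps)
    have "normal_density 0 s y = 1 / (s * sqrt (2 * pi)) * exp (t * y\<^sup>2 - y\<^sup>2 / 2)"
      by (simp only: normal_density_def diff_zero 1 2)
    moreover have "exp (t * y\<^sup>2 - y\<^sup>2 / 2) = exp (t * y\<^sup>2) * exp (- y\<^sup>2 / 2)"
      by (simp add: exp_add[symmetric])
    ultimately have "std_normal_density y * exp (t * y\<^sup>2) = s * normal_density 0 s y"
      using s by (simp add: std_normal_density_def)
    then show "ennreal (std_normal_density y) * ennreal (exp (t * y\<^sup>2)) = ennreal s * ennreal (normal_density 0 s y)"
      using s by (simp add: ennreal_mult'[symmetric])
  qed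
  also have "\<dots> = ennreal s"
    using s by (simp add: nn_integral_cmult nn_integral_eq_integral)
  finally show ?thesis by (simp add: s_def)
qed

lemma integrable_stdN_power: "integrable stdN (\<lambda>y. y ^ k)" "integrable stdN (\<lambda>y. \<bar>y\<bar> ^ k)"
  using integrable_std_normal_moment[of k] integrable_std_normal_moment_abs[of k]
  by (simp_all add: integrable_density)

lemma integral_stdN:
  "(\<integral>y. y \<partial>stdN) = 0" "(\<integral>y. y\<^sup>2 \<partial>stdN) = 1" "(\<integral>y. y ^ 4 \<partial>stdN) = 3"
  "(\<integral>y. \<bar>y\<bar> \<partial>stdN) = sqrt (2 / pi)"
  using integral_std_normal_moment_odd[of 0] integral_std_normal_moment_even[of 1]
    integral_std_normal_moment_even[of 2] integral_std_normal_moment_abs_odd[of 0]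
  by (simp_all add: integral_density fact_numeral)

lemma exp_minus_le_quadratic: "0 \<le> x \<Longrightarrow> exp (- x) \<le> 1 - x + x\<^sup>2 / 2" for x :: real
proof -
  assume x: "0 \<le> x"
  let ?f = "\<lambda>x::real. 1 - x + x\<^sup>2 / 2 - exp (- x)"
  have "?f 0 \<le> ?f x"
  proof (rule DERIV_nonneg_imp_nondecreasing[OF x])
    fix y :: real assume "0 \<le> y"
    have "(?f has_real_derivative (- 1 + y + exp (- y))) (at y)"
      by (auto intro!: derivative_eq_intros)
    moreover have "- 1 + y + exp (- y) \<ge> 0" using exp_ge_add_one_self[of "- y"] by simp
    ultimately show "\<exists>D. (?f has_real_derivative D) (at y) \<and> 0 \<le> D" by blast
  qed
  then show ?thesis by simp
qed

text \<open>Replacing exp (- x) by 1 - x + x^2/2 for x >= 0 reduces the claim to the first two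
  moments of |y|. The term linear in l keeps the exact mean sqrt (2/pi), which becomes the 2/pi of
  the theorem.\<close>

lemma nn_integral_stdN_exp_abs:
  assumes "0 \<le> l"
  shows "(\<integral>\<^sup>+y. ennreal (exp (- l * \<bar>y\<bar>)) \<partial>stdN) \<le> ennreal (exp (l\<^sup>2 / 2 - l * sqrt (2 / pi)))"
proof -
  interpret prob_space stdN by (rule prob_space_stdN)
  have i: "integrable stdN (\<lambda>y. 1 - l * \<bar>y\<bar> + l\<^sup>2 / 2 * y\<^sup>2)"
    using integrable_stdN_power(2)[of 1] integrable_stdN_power(1)[of 2] by auto
  have le: "exp (- l * \<bar>y\<bar>) \<le> 1 - l * \<bar>y\<bar> + l\<^sup>2 / 2 * y\<^sup>2" for y
    using exp_minus_le_quadratic[of "l * \<bar>y\<bar>"] assms by (simp add: power_mult_distrib)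
  have "(\<integral>\<^sup>+y. ennreal (exp (- l * \<bar>y\<bar>)) \<partial>stdN) \<le> (\<integral>\<^sup>+y. ennreal (1 - l * \<bar>y\<bar> + l\<^sup>2 / 2 * y\<^sup>2) \<partial>stdN)"
    by (intro nn_integral_mono ennreal_leI le)
  also have "\<dots> = ennreal (\<integral>y. 1 - l * \<bar>y\<bar> + l\<^sup>2 / 2 * y\<^sup>2 \<partial>stdN)"
    by (intro nn_integral_eq_integral i AE_I2 order_trans[OF _ le]) auto
  also have "(\<integral>y. 1 - l * \<bar>y\<bar> + l\<^sup>2 / 2 * y\<^sup>2 \<partial>stdN) = 1 - l * sqrt (2 / pi) + l\<^sup>2 / 2"
    using integrable_stdN_power(2)[of 1] integrable_stdN_power(1)[of 2]
    by (simp add: integral_stdN prob_space[simplified])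
  also have "\<dots> \<le> exp (l\<^sup>2 / 2 - l * sqrt (2 / pi))"
    using exp_ge_add_one_self[of "l\<^sup>2 / 2 - l * sqrt (2 / pi)"] by linarith
  finally show ?thesis by (simp add: ennreal_leI)
qed

text \<open>The density on [t, t + 1] is at least its value at t + 1. For t of order sqrt (ln n) the
  shift from t to t + 1 costs only a factor n^(o(1)).\<close>

lemma emeasure_stdN_tail:
  assumes "0 \<le> t"
  shows "ennreal (exp (- (t + 1)\<^sup>2 / 2) / sqrt (2 * pi)) \<le> emeasure stdN {t..}"
proof -
  let ?p = "exp (- (t + 1)\<^sup>2 / 2) / sqrt (2 * pi)"
  have "ennreal ?p = (\<integral>\<^sup>+y. ennreal ?p * indicator {t..t+1} y \<partial>lborel)"
    by (subst nn_integral_cmult_indicator) auto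
  also have "\<dots> \<le> (\<integral>\<^sup>+y. ennreal (std_normal_density y) * indicator {t..} y \<partial>lborel)"
  proof (intro nn_integral_mono)
    fix y
    have "?p \<le> std_normal_density y" if "t \<le> y" "y \<le> t + 1"
      using that assms by (auto simp: std_normal_density_def intro!: divide_right_mono power_mono)
    then show "ennreal ?p * indicator {t..t+1} y \<le> ennreal (std_normal_density y) * indicator {t..} y"
      by (auto split: split_indicator intro!: ennreal_leI)
  qed
  also have "\<dots> = emeasure stdN {t..}" by (subst emeasure_density) auto
  finally show ?thesis .
qed

section \<open>Exponential and polynomial moments of a Gaussian vector\<close>

lemma nn_integral_gvec_exp_lin:
  assumes "0 < d"
  shows "(\<integral>\<^sup>+x. ennreal (exp (a * dot d c x)) \<partial>gvec d) = ennreal (exp (a\<^sup>2 * dot d c c / (2 * real d)))"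
proof -
  have "(\<integral>\<^sup>+x. ennreal (exp (a * dot d c x)) \<partial>gvec d) =
      (\<integral>\<^sup>+y. ennreal (exp ((a * sqrt (dot d c c / real d)) * y)) \<partial>stdN)"
    by (subst nn_integral_dot_gvec[OF assms, where f="\<lambda>y. ennreal (exp (a * y))"]) (auto simp: mult.assoc)
  then show ?thesis
    unfolding nn_integral_stdN_exp_lin by (simp add: power_mult_distrib)
qed

lemma nn_integral_gvec_exp_square:
  assumes "0 < d" "t * dot d c c / real d < 1 / 2"
  shows "(\<integral>\<^sup>+x. ennreal (exp (t * (dot d c x)\<^sup>2)) \<partial>gvec d) = ennreal (1 / sqrt (1 - 2 * (t * dot d c c / real d)))"
proof -
  have "(\<integral>\<^sup>+x. ennreal (exp (t * (dot d c x)\<^sup>2)) \<partial>gvec d) =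
      (\<integral>\<^sup>+y. ennreal (exp ((t * dot d c c / real d) * y\<^sup>2)) \<partial>stdN)"
    by (subst nn_integral_dot_gvec[OF assms(1), where f="\<lambda>y. ennreal (exp (t * y\<^sup>2))"])
      (auto simp: power_mult_distrib mult.assoc)
  then show ?thesis
    unfolding nn_integral_stdN_exp_square[OF assms(2)] .
qed

lemma nn_integral_gvec_exp_norm:
  assumes "0 < d" "t / real d < 1 / 2"
  shows "(\<integral>\<^sup>+x. ennreal (exp (t * dot d x x)) \<partial>gvec d) = ennreal ((1 / sqrt (1 - 2 * (t / real d))) ^ d)"
proof -
  let ?N = "density lborel (\<lambda>x. ennreal (normal_density 0 (1 / sqrt (real d)) x))"
  interpret N: product_sigma_finite "\<lambda>_::nat. ?N"
    using assms(1) by (rule product_sigma_finite_coord)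
  \<comment> \<open>The first unit vector turns the formula for linear functionals into the integral
    over one coordinate, of which the claim is the d-th power.\<close>
  let ?e = "\<lambda>k. if k = 0 then 1 else (0::real)"
  have dot_e: "dot d ?e x = x 0" for x
    using assms(1) by (simp add: dot_def if_distrib[of "\<lambda>c. c * _"] cong: if_cong)
  have "distr (gvec d) ?N (\<lambda>x. x 0) = ?N"
    unfolding gvec_def using assms(1) by (intro distr_PiM_component prob_space_coord) auto
  then have "(\<integral>\<^sup>+y. ennreal (exp (t * y\<^sup>2)) \<partial>?N) = (\<integral>\<^sup>+y. ennreal (exp (t * y\<^sup>2)) \<partial>distr (gvec d) ?N (\<lambda>x. x 0))"
    by simp
  also have "\<dots> = (\<integral>\<^sup>+x. ennreal (exp (t * (dot d ?e x)\<^sup>2)) \<partial>gvec d)"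
    unfolding dot_e using assms(1) by (intro nn_integral_distr) (auto simp: gvec_def)
  also have "\<dots> = ennreal (1 / sqrt (1 - 2 * (t / real d)))"
    using assms by (subst nn_integral_gvec_exp_square) (auto simp: dot_e)
  finally have 1: "(\<integral>\<^sup>+y. ennreal (exp (t * y\<^sup>2)) \<partial>?N) = ennreal (1 / sqrt (1 - 2 * (t / real d)))" .
  have "(\<integral>\<^sup>+x. ennreal (exp (t * dot d x x)) \<partial>gvec d) = (\<integral>\<^sup>+x. (\<Prod>k<d. ennreal (exp (t * (x k)\<^sup>2))) \<partial>gvec d)"
    by (intro nn_integral_cong)
      (simp add: dot_def sum_distrib_left exp_sum power2_eq_square prod_ennreal)
  also have "\<dots> = (\<Prod>k<d. \<integral>\<^sup>+y. ennreal (exp (t * y\<^sup>2)) \<partial>?N)"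
    unfolding gvec_def by (intro N.product_nn_integral_prod) auto
  also have "\<dots> = ennreal ((1 / sqrt (1 - 2 * (t / real d))) ^ d)"
    unfolding 1 prod_constant card_lessThan using assms(2) by (intro ennreal_power) (simp add: mult.commute)
  finally show ?thesis .
qed

lemma gvec_linear_moments:
  assumes "0 < d"
  shows "integrable (gvec d) (\<lambda>x. dot d c x ^ k)" "(\<integral>x. dot d c x \<partial>gvec d) = 0"
    "(\<integral>x. (dot d c x)\<^sup>2 \<partial>gvec d) = dot d c c / real d"
    "(\<integral>x. dot d c x ^ 4 \<partial>gvec d) = 3 * (dot d c c / real d)\<^sup>2"
    "(\<integral>x. \<bar>dot d c x\<bar> \<partial>gvec d) = sqrt (2 / pi) * sqrt (dot d c c / real d)"
    "integrable (gvec d) (\<lambda>x. \<bar>dot d c x\<bar>)"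
proof -
  let ?s = "sqrt (dot d c c / real d)"
  have I: "integrable (gvec d) (\<lambda>x. f (dot d c x)) = integrable stdN (\<lambda>y. f (?s * y))"
    and E: "(\<integral>x. f (dot d c x) \<partial>gvec d) = (\<integral>y. f (?s * y) \<partial>stdN)"
    if [measurable]: "f \<in> borel_measurable borel" for f :: "real \<Rightarrow> real"
    using integrable_distr_eq[of "dot d c" "gvec d" borel f] integral_distr[of "dot d c" "gvec d" borel f]
      integrable_distr_eq[of "\<lambda>y. ?s * y" stdN borel f] integral_distr[of "\<lambda>y. ?s * y" stdN borel f]
    unfolding distr_dot_gvec[OF assms] by simp_all
  have s4: "?s ^ 4 = (dot d c c / real d)\<^sup>2"
    using power_mult[of ?s 2 2] by simp
  show "integrable (gvec d) (\<lambda>x. dot d c x ^ k)"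
    by (subst I[where f="\<lambda>y. y ^ k"]) (auto simp: power_mult_distrib integrable_stdN_power)
  show "(\<integral>x. dot d c x \<partial>gvec d) = 0"
    by (subst E) (auto simp: integral_stdN)
  show "(\<integral>x. (dot d c x)\<^sup>2 \<partial>gvec d) = dot d c c / real d"
    by (subst E[where f="\<lambda>y. y\<^sup>2"]) (auto simp: integral_stdN power_mult_distrib)
  show "(\<integral>x. dot d c x ^ 4 \<partial>gvec d) = 3 * (dot d c c / real d)\<^sup>2"
    by (subst E[where f="\<lambda>y. y ^ 4"]) (auto simp: integral_stdN power_mult_distrib s4)
  show "(\<integral>x. \<bar>dot d c x\<bar> \<partial>gvec d) = sqrt (2 / pi) * sqrt (dot d c c / real d)"
    by (subst E[where f="\<lambda>y. \<bar>y\<bar>"]) (auto simp: integral_stdN abs_mult)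
  show "integrable (gvec d) (\<lambda>x. \<bar>dot d c x\<bar>)"
    using integrable_stdN_power(2)[of 1] by (subst I[where f="\<lambda>y. \<bar>y\<bar>"]) (auto simp: abs_mult)
qed

section \<open>Chernoff bounds\<close>

text \<open>Markov's inequality for exp X. The Chernoff parameter is part of X, so it may have
  either sign.\<close>

lemma (in prob_space) chernoff:
  fixes X :: "'a \<Rightarrow> real"
  assumes [measurable]: "X \<in> borel_measurable M"
    and C: "(\<integral>\<^sup>+x. ennreal (exp (X x)) \<partial>M) \<le> ennreal C" "0 \<le> C"
  shows "prob {x \<in> space M. a \<le> X x} \<le> exp (- a) * C"
proof -
  have "emeasure M {x \<in> space M. a \<le> X x} = (\<integral>\<^sup>+x. indicator {x \<in> space M. a \<le> X x} x \<partial>M)"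
    by (subst nn_integral_indicator) auto
  also have "\<dots> \<le> (\<integral>\<^sup>+x. ennreal (exp (- a)) * ennreal (exp (X x)) \<partial>M)"
    by (intro nn_integral_mono) (auto split: split_indicator simp: ennreal_mult'[symmetric] exp_add[symmetric] simp flip: ennreal_1 intro!: ennreal_leI)
  also have "\<dots> = ennreal (exp (- a)) * (\<integral>\<^sup>+x. ennreal (exp (X x)) \<partial>M)"
    by (rule nn_integral_cmult) simp
  also have "\<dots> \<le> ennreal (exp (- a)) * ennreal C"
    using C by (intro mult_left_mono) auto
  also have "\<dots> = ennreal (exp (- a) * C)"
    using C by (simp add: ennreal_mult')
  finally show ?thesis
    using C by (simp add: emeasure_eq_measure)
qed

text \<open>The first-order term x/2 is exact, and has to be: in the bound on the noise it
  determines the constant 8, while x^2 contributes a vanishing error.\<close>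

lemma inverse_sqrt_le_exp:
  fixes x :: real
  assumes "\<bar>x\<bar> \<le> 1 / 2"
  shows "1 / sqrt (1 - x) \<le> exp (x / 2 + x\<^sup>2)"
proof -
  have "\<bar>ln (1 + - x) - (- x)\<bar> \<le> 2 * (- x)\<^sup>2"
    using assms by (intro abs_ln_one_plus_x_minus_x_bound) auto
  then have "- ln (1 - x) / 2 \<le> x / 2 + x\<^sup>2" by simp
  then have "exp (- ln (1 - x) / 2) \<le> exp (x / 2 + x\<^sup>2)" by (simp only: exp_le_cancel_iff)
  moreover have "exp (- ln (1 - x) / 2) = 1 / sqrt (1 - x)"
    using assms by (simp add: exp_minus ln_sqrt[symmetric] inverse_eq_divide)
  ultimately show ?thesis by (simp only:)
qed

lemma nn_integral_gpairs_pair: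
  assumes "0 < d" "i < n" "j < n" "i \<noteq> j"
    and [measurable]: "case_prod F \<in> borel_measurable ((gvec d \<Otimes>\<^sub>M gvec d) \<Otimes>\<^sub>M (gvec d \<Otimes>\<^sub>M gvec d))"
  shows "(\<integral>\<^sup>+z. F (z i) (z j) \<partial>gpairs n d)
    = (\<integral>\<^sup>+p. \<integral>\<^sup>+q. F p q \<partial>(gvec d \<Otimes>\<^sub>M gvec d) \<partial>(gvec d \<Otimes>\<^sub>M gvec d))"
proof -
  let ?P = "gvec d \<Otimes>\<^sub>M gvec d"
  let ?R = "{..<n} - {i}"
  interpret P: product_sigma_finite "\<lambda>_::nat. ?P"
    using assms(1) by (rule product_sigma_finite_pairs)
  interpret P1: prob_space ?P using assms(1) by (rule prob_space_gvec_pair)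
  have n: "{..<n} = insert i ?R" using assms by auto
  note [measurable] = measurable_gpairs_component[OF assms(2), of d] measurable_gpairs_component[OF assms(3), of d]
  have m: "(\<lambda>z. F (z i) (z j)) \<in> borel_measurable (gpairs n d)"
    by measurable
  have "(\<integral>\<^sup>+z. F (z i) (z j) \<partial>gpairs n d) = (\<integral>\<^sup>+p. \<integral>\<^sup>+x. F ((x(i := p)) i) ((x(i := p)) j) \<partial>PiM ?R (\<lambda>_. ?P) \<partial>?P)"
    unfolding gpairs_def
    by (rule P.product_nn_integral_insert_rev[of ?R i, folded n])
      (use m in \<open>simp_all only: gpairs_def finite_Diff finite_lessThan Diff_iff, simp_all\<close>)
  also have "\<dots> = (\<integral>\<^sup>+p. \<integral>\<^sup>+q. F p q \<partial>?P \<partial>?P)"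
  proof (intro nn_integral_cong)
    fix p assume p: "p \<in> space ?P"
    have "distr (PiM ?R (\<lambda>_. ?P)) ?P (\<lambda>x. x j) = ?P"
      using assms by (intro distr_PiM_component prob_space_gvec_pair) auto
    then have "(\<integral>\<^sup>+q. F p q \<partial>?P) = (\<integral>\<^sup>+q. F p q \<partial>distr (PiM ?R (\<lambda>_. ?P)) ?P (\<lambda>x. x j))" by simp
    also have "\<dots> = (\<integral>\<^sup>+x. F p (x j) \<partial>PiM ?R (\<lambda>_. ?P))"
      using assms p by (intro nn_integral_distr) auto
    finally show "(\<integral>\<^sup>+x. F ((x(i := p)) i) ((x(i := p)) j) \<partial>PiM ?R (\<lambda>_. ?P)) = (\<integral>\<^sup>+q. F p q \<partial>?P)"
      using assms by simp
  qed
  finally show ?thesis .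
qed

lemma nn_integral_gpairs_component:
  assumes "0 < d" "i < n" and [measurable]: "f \<in> borel_measurable (gvec d \<Otimes>\<^sub>M gvec d)"
  shows "(\<integral>\<^sup>+z. f (z i) \<partial>gpairs n d) = (\<integral>\<^sup>+p. f p \<partial>(gvec d \<Otimes>\<^sub>M gvec d))"
proof -
  have "distr (gpairs n d) (gvec d \<Otimes>\<^sub>M gvec d) (\<lambda>x. x i) = gvec d \<Otimes>\<^sub>M gvec d"
    unfolding gpairs_def using assms by (intro distr_PiM_component prob_space_gvec_pair) auto
  then have "(\<integral>\<^sup>+p. f p \<partial>(gvec d \<Otimes>\<^sub>M gvec d)) = (\<integral>\<^sup>+p. f p \<partial>distr (gpairs n d) (gvec d \<Otimes>\<^sub>M gvec d) (\<lambda>x. x i))"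
    by simp
  also have "\<dots> = (\<integral>\<^sup>+z. f (z i) \<partial>gpairs n d)"
    using assms by (intro nn_integral_distr measurable_gpairs_component) auto
  finally show ?thesis by simp
qed

lemma nn_integral_gvec_pair_proj:
  assumes "0 < d" "pr = fst \<or> pr = snd" and [measurable]: "f \<in> borel_measurable (gvec d)"
  shows "(\<integral>\<^sup>+p. f (pr p) \<partial>(gvec d \<Otimes>\<^sub>M gvec d)) = (\<integral>\<^sup>+x. f x \<partial>gvec d)"
proof -
  interpret V: prob_space "gvec d" using assms(1) by (rule prob_space_gvec)
  show ?thesis using assms(2)
    by (elim disjE; hypsubst; subst V.nn_integral_fst[symmetric]) (auto simp: V.emeasure_space_1)
qed

lemma gvec_exp_norm_le:
  assumes "0 < d" "\<bar>s\<bar> \<le> 1 / 4"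
  shows "(\<integral>\<^sup>+x. ennreal (exp (s * real d * dot d x x)) \<partial>gvec d) \<le> ennreal (exp (real d * (s + 4 * s\<^sup>2)))"
proof -
  have "(\<integral>\<^sup>+x. ennreal (exp (s * real d * dot d x x)) \<partial>gvec d) = ennreal ((1 / sqrt (1 - 2 * s)) ^ d)"
    using assms by (subst nn_integral_gvec_exp_norm) auto
  also have "\<dots> \<le> ennreal (exp (2 * s / 2 + (2 * s)\<^sup>2) ^ d)"
    using assms by (intro ennreal_leI power_mono inverse_sqrt_le_exp) auto
  also have "exp (2 * s / 2 + (2 * s)\<^sup>2) ^ d = exp (real d * (s + 4 * s\<^sup>2))"
    by (subst exp_of_nat_mult[symmetric]) (simp add: power_mult_distrib)
  finally show ?thesis .
qed

text \<open>Given x, \<open>dot d x y\<close> is normal with variance |x|^2 / d, so integrating over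
  y leaves exp (c^2/2 * d * |x|^2), which \<open>gvec_exp_norm_le\<close> handles with s =
  c^2/2.\<close>

lemma gvec_exp_dot_le:
  assumes "0 < d" "\<bar>c\<bar> \<le> 1 / 2"
  shows "(\<integral>\<^sup>+x. \<integral>\<^sup>+y. ennreal (exp (c * real d * dot d x y)) \<partial>gvec d \<partial>gvec d)
    \<le> ennreal (exp (real d * (c\<^sup>2 / 2 + c ^ 4)))"
proof -
  have "c\<^sup>2 \<le> (1 / 2)\<^sup>2" using assms(2) by (simp add: abs_le_square_iff[symmetric])
  then have c2: "\<bar>c\<^sup>2 / 2\<bar> \<le> 1 / 4" by (simp add: power2_eq_square)
  have "(\<integral>\<^sup>+x. \<integral>\<^sup>+y. ennreal (exp (c * real d * dot d x y)) \<partial>gvec d \<partial>gvec d)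
      = (\<integral>\<^sup>+x. ennreal (exp (c\<^sup>2 / 2 * real d * dot d x x)) \<partial>gvec d)"
    using assms(1) by (intro nn_integral_cong) (simp add: nn_integral_gvec_exp_lin power2_eq_square)
  also have "\<dots> \<le> ennreal (exp (real d * (c\<^sup>2 / 2 + 4 * (c\<^sup>2 / 2)\<^sup>2)))"
    using assms(1) c2 by (rule gvec_exp_norm_le)
  finally show ?thesis by (simp add: power_divide power_mult[symmetric])
qed

lemma chernoff_norm:
  assumes "0 < d" "i < n" "0 < \<delta>" "\<delta> \<le> 1"
    and pr: "pr = fst \<or> pr = snd"
  shows "measure (gpairs n d) {z \<in> space (gpairs n d). 1 + \<delta> \<le> dot d (pr (z i)) (pr (z i))} \<le> exp (- (real d * \<delta>\<^sup>2 / 16))"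
    "measure (gpairs n d) {z \<in> space (gpairs n d). dot d (pr (z i)) (pr (z i)) \<le> 1 - \<delta>} \<le> exp (- (real d * \<delta>\<^sup>2 / 16))"
proof -
  interpret prob_space "gpairs n d" using assms(1) by (rule prob_space_gpairs)
  have [measurable]: "(\<lambda>z. pr (z i)) \<in> gpairs n d \<rightarrow>\<^sub>M gvec d"
    using pr measurable_gpairs_fst_snd[OF assms(2), of d] by auto
  have [measurable]: "pr \<in> gvec d \<Otimes>\<^sub>M gvec d \<rightarrow>\<^sub>M gvec d" using pr by auto
  have I: "(\<integral>\<^sup>+z. ennreal (exp (s * real d * dot d (pr (z i)) (pr (z i)))) \<partial>gpairs n d)
     \<le> ennreal (exp (real d * (s + 4 * s\<^sup>2)))" if "\<bar>s\<bar> \<le> 1 / 4" for s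
  proof -
    have "(\<integral>\<^sup>+z. ennreal (exp (s * real d * dot d (pr (z i)) (pr (z i)))) \<partial>gpairs n d)
       = (\<integral>\<^sup>+p. ennreal (exp (s * real d * dot d (pr p) (pr p))) \<partial>(gvec d \<Otimes>\<^sub>M gvec d))"
      using assms(1,2) by (rule nn_integral_gpairs_component) measurable
    also have "\<dots> = (\<integral>\<^sup>+x. ennreal (exp (s * real d * dot d x x)) \<partial>gvec d)"
      using assms(1) pr by (rule nn_integral_gvec_pair_proj) measurable
    finally show ?thesis using gvec_exp_norm_le[OF assms(1) that] by simp
  qed
  \<comment> \<open>\<delta> / 8 minimises -s \<delta> + 4 s^2, the exponent per dimension; the
    lower tail uses -\<delta> / 8.\<close>
  have "prob {z \<in> space (gpairs n d). \<delta> / 8 * real d * (1 + \<delta>) \<le> \<delta> / 8 * real d * dot d (pr (z i)) (pr (z i))}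
      \<le> exp (- (\<delta> / 8 * real d * (1 + \<delta>))) * exp (real d * (\<delta> / 8 + 4 * (\<delta> / 8)\<^sup>2))"
    using assms by (intro chernoff I) auto
  also have "\<dots> = exp (- (real d * \<delta>\<^sup>2 / 16))"
    by (simp add: exp_add[symmetric] power2_eq_square algebra_simps)
  finally show "prob {z \<in> space (gpairs n d). 1 + \<delta> \<le> dot d (pr (z i)) (pr (z i))} \<le> exp (- (real d * \<delta>\<^sup>2 / 16))"
    using assms(1,3) by (simp add: mult_le_cancel_left mult_less_0_iff)
  have "prob {z \<in> space (gpairs n d). (- \<delta> / 8) * real d * (1 - \<delta>) \<le> (- \<delta> / 8) * real d * dot d (pr (z i)) (pr (z i))}
      \<le> exp (- ((- \<delta> / 8) * real d * (1 - \<delta>))) * exp (real d * ((- \<delta> / 8) + 4 * (- \<delta> / 8)\<^sup>2))"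
    using assms by (intro chernoff I) auto
  also have "\<dots> = exp (- (real d * \<delta>\<^sup>2 / 16))"
    by (simp add: exp_add[symmetric] power2_eq_square field_simps)
  finally show "prob {z \<in> space (gpairs n d). dot d (pr (z i)) (pr (z i)) \<le> 1 - \<delta>} \<le> exp (- (real d * \<delta>\<^sup>2 / 16))"
    using assms(1,3) by (simp add: mult_le_cancel_left mult_less_0_iff)
qed

lemma chernoff_dot:
  assumes "0 < d" "i < n" "j < n" "i \<noteq> j" "0 < \<delta>" "\<delta> \<le> 1"
    and pr: "pr = fst \<or> pr = snd" and \<epsilon>: "\<epsilon> = 1 \<or> \<epsilon> = - 1"
  shows "measure (gpairs n d) {z \<in> space (gpairs n d). \<delta> \<le> \<epsilon> * dot d (pr (z i)) (pr (z j))} \<le> exp (- (real d * \<delta>\<^sup>2 / 16))"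
proof -
  interpret prob_space "gpairs n d" using assms(1) by (rule prob_space_gpairs)
  interpret P: prob_space "gvec d \<Otimes>\<^sub>M gvec d" using assms(1) by (rule prob_space_gvec_pair)
  interpret V: prob_space "gvec d" using assms(1) by (rule prob_space_gvec)
  have [measurable]: "(\<lambda>z. pr (z i)) \<in> gpairs n d \<rightarrow>\<^sub>M gvec d" "(\<lambda>z. pr (z j)) \<in> gpairs n d \<rightarrow>\<^sub>M gvec d"
    using pr measurable_gpairs_fst_snd[OF assms(2), of d] measurable_gpairs_fst_snd[OF assms(3), of d] by auto
  have [measurable]: "pr \<in> gvec d \<Otimes>\<^sub>M gvec d \<rightarrow>\<^sub>M gvec d" using pr by auto
  \<comment> \<open>A convenient parameter with |c| <= 1/2. The resulting exponent -5/16 * d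
    \<delta>^2 is weakened to -d \<delta>^2 / 16, so that all deviation events of
    \<open>hebb_gap_tail\<close> share the rate of \<open>chernoff_norm\<close>.\<close>
  let ?c = "\<epsilon> * \<delta> / 2"
  have c: "\<bar>?c\<bar> \<le> 1 / 2" using assms by auto
  have "(\<integral>\<^sup>+z. ennreal (exp (?c * real d * dot d (pr (z i)) (pr (z j)))) \<partial>gpairs n d)
      = (\<integral>\<^sup>+p. \<integral>\<^sup>+q. ennreal (exp (?c * real d * dot d (pr p) (pr q))) \<partial>(gvec d \<Otimes>\<^sub>M gvec d) \<partial>(gvec d \<Otimes>\<^sub>M gvec d))"
    using assms(1-4) by (rule nn_integral_gpairs_pair) measurable
  also have "\<dots> = (\<integral>\<^sup>+p. \<integral>\<^sup>+y. ennreal (exp (?c * real d * dot d (pr p) y)) \<partial>gvec d \<partial>(gvec d \<Otimes>\<^sub>M gvec d))"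
    by (intro nn_integral_cong nn_integral_gvec_pair_proj assms(1) pr) measurable
  also have "\<dots> = (\<integral>\<^sup>+x. \<integral>\<^sup>+y. ennreal (exp (?c * real d * dot d x y)) \<partial>gvec d \<partial>gvec d)"
    using assms(1) pr by (rule nn_integral_gvec_pair_proj) measurable
  also have "\<dots> \<le> ennreal (exp (real d * (?c\<^sup>2 / 2 + ?c ^ 4)))"
    using assms(1) c by (rule gvec_exp_dot_le)
  finally have I: "(\<integral>\<^sup>+z. ennreal (exp (?c * real d * dot d (pr (z i)) (pr (z j)))) \<partial>gpairs n d) \<le> \<dots>" .
  have "prob {z \<in> space (gpairs n d). \<delta>\<^sup>2 / 2 * real d \<le> ?c * real d * dot d (pr (z i)) (pr (z j))}
      \<le> exp (- (\<delta>\<^sup>2 / 2 * real d)) * exp (real d * (?c\<^sup>2 / 2 + ?c ^ 4))"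
    using assms by (intro chernoff I) auto
  also have "?c\<^sup>2 = \<delta>\<^sup>2 / 4" using \<epsilon> by (auto simp: power2_eq_square)
  also have "?c ^ 4 \<le> \<delta>\<^sup>2 / 16"
  proof -
    have "?c ^ 4 = \<delta>\<^sup>2 * \<delta>\<^sup>2 / 16" using \<epsilon> by (auto simp: power_divide eval_nat_numeral)
    also have "\<delta>\<^sup>2 * \<delta>\<^sup>2 \<le> \<delta>\<^sup>2 * 1" using assms by (intro mult_left_mono power_le_one) auto
    finally show ?thesis by simp
  qed
  also have "exp (- (\<delta>\<^sup>2 / 2 * real d)) * exp (real d * (\<delta>\<^sup>2 / 4 / 2 + \<delta>\<^sup>2 / 16)) \<le> exp (- (real d * \<delta>\<^sup>2 / 16))"
    by (simp add: exp_add[symmetric] algebra_simps)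
  finally have "prob {z \<in> space (gpairs n d). \<delta>\<^sup>2 / 2 * real d \<le> ?c * real d * dot d (pr (z i)) (pr (z j))}
      \<le> exp (- (real d * \<delta>\<^sup>2 / 16))" by (simp add: mult_left_mono)
  moreover have "\<delta>\<^sup>2 / 2 * real d \<le> ?c * real d * y \<longleftrightarrow> \<delta> \<le> \<epsilon> * y" for y
  proof -
    have "\<delta>\<^sup>2 / 2 * real d \<le> ?c * real d * y \<longleftrightarrow> (\<delta> / 2 * real d) * \<delta> \<le> (\<delta> / 2 * real d) * (\<epsilon> * y)"
      by (simp add: power2_eq_square algebra_simps)
    also have "\<dots> \<longleftrightarrow> \<delta> \<le> \<epsilon> * y" using assms(1,5) by (subst mult_le_cancel_left_pos) auto
    finally show ?thesis .
  qed
  ultimately show ?thesis by simp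
qed

section \<open>Achievability by the Hebbian matrix\<close>

text \<open>Given the first vector of p, the exponent is linear in the second; integrating it out
  leaves a Gaussian square, whose integral is (1 - x)^(-1/2). Here x is the variance of the product
  in the exponent. A product of Gaussians has exponential tails, so the moment diverges at x =
  1.\<close>

lemma gvec_pair_mgf_le:
  assumes "0 < d" and x: "x = a\<^sup>2 * dot d w w * dot d v v / (real d)\<^sup>2" "x \<le> 1 / 2"
  shows "(\<integral>\<^sup>+p. ennreal (exp (a * dot d w (fst p) * dot d v (snd p))) \<partial>(gvec d \<Otimes>\<^sub>M gvec d))
    \<le> ennreal (exp (x / 2 + x\<^sup>2))"
proof -
  interpret V: prob_space "gvec d" using assms(1) by (rule prob_space_gvec)
  have x0: "0 \<le> x" unfolding x by simp
  let ?t = "a\<^sup>2 * dot d v v / (2 * real d)"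
  have xt: "2 * (?t * dot d w w / real d) = x"
    unfolding x by (simp add: power2_eq_square)
  have "(\<integral>\<^sup>+p. ennreal (exp (a * dot d w (fst p) * dot d v (snd p))) \<partial>(gvec d \<Otimes>\<^sub>M gvec d))
      = (\<integral>\<^sup>+u. \<integral>\<^sup>+y. ennreal (exp ((a * dot d w u) * dot d v y)) \<partial>gvec d \<partial>gvec d)"
    by (subst V.nn_integral_fst[symmetric]) auto
  also have "\<dots> = (\<integral>\<^sup>+u. ennreal (exp (?t * (dot d w u)\<^sup>2)) \<partial>gvec d)"
    unfolding nn_integral_gvec_exp_lin[OF assms(1)]
    by (intro nn_integral_cong) (simp add: power_mult_distrib mult_ac)
  also have "\<dots> = ennreal (1 / sqrt (1 - 2 * (?t * dot d w w / real d)))"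
    using xt x(2) by (intro nn_integral_gvec_exp_square assms(1)) linarith
  also have "\<dots> \<le> ennreal (exp (x / 2 + x\<^sup>2))"
    unfolding xt using x(2) x0 by (intro ennreal_leI inverse_sqrt_le_exp) auto
  finally show ?thesis .
qed

lemma dot_diff_left: "dot d (\<lambda>p. a p - b p) c = dot d a c - dot d b c"
  by (simp add: dot_def algebra_simps sum_subtractf)

lemma dot_diff_self:
  "dot d (\<lambda>p. a p - b p) (\<lambda>p. a p - b p) = dot d a a - 2 * dot d a b + dot d b b"
  by (simp add: dot_def algebra_simps sum_subtractf sum.distrib sum_distrib_left)

definition hebb :: "nat \<Rightarrow> (nat \<Rightarrow> (nat \<Rightarrow> real) \<times> (nat \<Rightarrow> real)) \<Rightarrow> nat \<Rightarrow> nat \<Rightarrow> real" where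
  "hebb n z p q = (\<Sum>k<n. fst (z k) p * snd (z k) q)"

lemma bilin_hebb:
  "bilin d a (hebb n z) b
    = (\<Sum>k<n. dot d a (fst (z k)) * dot d b (snd (z k)))"
proof -
  have "bilin d a (hebb n z) b
      = (\<Sum>p<d. \<Sum>q<d. \<Sum>k<n. (a p * fst (z k) p) * (b q * snd (z k) q))"
    unfolding bilin_def hebb_def by (intro sum.cong refl) (simp add: sum_distrib_left sum_distrib_right mult_ac)
  also have "\<dots> = (\<Sum>p<d. \<Sum>k<n. \<Sum>q<d. (a p * fst (z k) p) * (b q * snd (z k) q))"
    by (intro sum.cong refl sum.swap)
  also have "\<dots> = (\<Sum>k<n. \<Sum>p<d. \<Sum>q<d. (a p * fst (z k) p) * (b q * snd (z k) q))"
    by (rule sum.swap)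
  also have "\<dots> = (\<Sum>k<n. dot d a (fst (z k)) * dot d b (snd (z k)))"
    by (simp add: dot_def sum_product)
  finally show ?thesis .
qed

text \<open>The margin (u_i - u_j)^T W v_i for W = \<open>hebb n z\<close>, expanded as in
  \<open>bilin_hebb\<close>.\<close>

definition hebb_gap :: "nat \<Rightarrow> nat \<Rightarrow> (nat \<Rightarrow> (nat \<Rightarrow> real) \<times> (nat \<Rightarrow> real)) \<Rightarrow> nat \<Rightarrow> nat \<Rightarrow> real" where
  "hebb_gap n d z i j = (\<Sum>k<n. (dot d (fst (z i)) (fst (z k)) - dot d (fst (z j)) (fst (z k))) * dot d (snd (z i)) (snd (z k)))"

text \<open>The part of the margin whose summands are independent given the pairs i and j.\<close>

definition cross_noise :: "nat \<Rightarrow> nat \<Rightarrow> (nat \<Rightarrow> (nat \<Rightarrow> real) \<times> (nat \<Rightarrow> real)) \<Rightarrow> nat \<Rightarrow> nat \<Rightarrow> real" where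
  "cross_noise n d z i j = (\<Sum>k\<in>{..<n} - {i, j}.
     (dot d (fst (z i)) (fst (z k)) - dot d (fst (z j)) (fst (z k))) * dot d (snd (z i)) (snd (z k)))"

lemma retrieves_hebb:
  assumes "\<And>i j. i < n \<Longrightarrow> j < n \<Longrightarrow> i \<noteq> j \<Longrightarrow> 0 < hebb_gap n d z i j"
  shows "retrieves n d (hebb n z) z"
  unfolding retrieves_def bilin_hebb
proof (intro allI impI)
  fix i j assume "i < n" "j < n" "j \<noteq> i"
  then have "0 < hebb_gap n d z i j" using assms by simp
  then show "(\<Sum>k<n. dot d (fst (z j)) (fst (z k)) * dot d (snd (z i)) (snd (z k)))
      < (\<Sum>k<n. dot d (fst (z i)) (fst (z k)) * dot d (snd (z i)) (snd (z k)))"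
    by (simp add: hebb_gap_def algebra_simps sum_subtractf)
qed

lemma hebb_gap_eq:
  assumes "i < n" "j < n" "i \<noteq> j"
  shows "hebb_gap n d z i j =
    (dot d (fst (z i)) (fst (z i)) - dot d (fst (z i)) (fst (z j))) * dot d (snd (z i)) (snd (z i))
    + (dot d (fst (z i)) (fst (z j)) - dot d (fst (z j)) (fst (z j))) * dot d (snd (z i)) (snd (z j))
    + cross_noise n d z i j"
proof -
  have "{..<n} = insert i (insert j ({..<n} - {i, j}))" using assms by auto
  then have "hebb_gap n d z i j = (\<Sum>k\<in>insert i (insert j ({..<n} - {i, j})). (dot d (fst (z i)) (fst (z k)) - dot d (fst (z j)) (fst (z k))) * dot d (snd (z i)) (snd (z k)))"
    unfolding hebb_gap_def by simp
  also have "\<dots> = (dot d (fst (z i)) (fst (z i)) - dot d (fst (z j)) (fst (z i))) * dot d (snd (z i)) (snd (z i))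
    + ((dot d (fst (z i)) (fst (z j)) - dot d (fst (z j)) (fst (z j))) * dot d (snd (z i)) (snd (z j))
    + cross_noise n d z i j)"
    unfolding cross_noise_def using assms(3) by (subst sum.insert; simp)+
  finally show ?thesis by (simp add: dot_commute[of d "fst (z j)" "fst (z i)"])
qed

text \<open>Depends on the two pairs alone, hence can be conditioned on. The bound 2 + 4 \<delta>
  comes from |u_i|^2 + |u_j|^2 + 2 |<u_i, u_j>| with errors \<delta>, \<delta> and 2
  \<delta>.\<close>

definition near :: "nat \<Rightarrow> real \<Rightarrow> (nat \<Rightarrow> real) \<times> (nat \<Rightarrow> real) \<Rightarrow> (nat \<Rightarrow> real) \<times> (nat \<Rightarrow> real) \<Rightarrow> bool" where
  "near d \<delta> p q \<longleftrightarrow>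
     dot d (\<lambda>k. fst p k - fst q k) (\<lambda>k. fst p k - fst q k) \<le> 2 + 4 * \<delta> \<and> dot d (snd p) (snd p) \<le> 1 + \<delta>"

lemma measurable_hebb_gap [measurable]:
  assumes "i < n" "j < n"
  shows "(\<lambda>z. hebb_gap n d z i j) \<in> borel_measurable (gpairs n d)"
    "(\<lambda>z. cross_noise n d z i j) \<in> borel_measurable (gpairs n d)"
  unfolding hebb_gap_def cross_noise_def using assms
  by (auto intro!: borel_measurable_sum borel_measurable_times borel_measurable_diff
      measurable_dot measurable_gpairs_fst_snd)

lemma pred_near:
  assumes "i < n" "j < n"
  shows "Measurable.pred (gpairs n d) (\<lambda>z. near d \<delta> (z i) (z j))"
proof -
  note [measurable] = measurable_gpairs_fst_snd[OF assms(1), of d] measurable_gpairs_fst_snd[OF assms(2), of d]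
  show ?thesis unfolding near_def dot_diff_self by measurable
qed

text \<open>Given the pairs i and j, the noise is a sum of i.i.d. products of two independent
  Gaussians, with variance controlled by \<open>near\<close>, so Chernoff's method applies to the
  integral over the other pairs. The event \<open>near\<close> is built into the integrand
  \<open>F\<close> because for atypical i and j the conditional exponential moment can be
  infinite.\<close>

lemma cross_noise_tail:
  assumes d: "0 < d" and ij: "i < n" "j < n" "i \<noteq> j" and \<delta>: "0 < \<delta>"
    and x: "x = l\<^sup>2 * (2 + 4 * \<delta>) * (1 + \<delta>) / (real d)\<^sup>2" "x \<le> 1 / 2"
  shows "measure (gpairs n d) {z \<in> space (gpairs n d). near d \<delta> (z i) (z j) \<and> \<kappa> \<le> - l * cross_noise n d z i j}
     \<le> exp (- \<kappa> + real n * (x / 2 + x\<^sup>2))"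
proof -
  let ?P = "gvec d \<Otimes>\<^sub>M gvec d"
  let ?R = "{..<n} - {i, j}"
  let ?C = "exp (real n * (x / 2 + x\<^sup>2))"
  interpret prob_space "gpairs n d" using d by (rule prob_space_gpairs)
  interpret P: product_sigma_finite "\<lambda>_::nat. ?P" using d by (rule product_sigma_finite_pairs)
  note [measurable] = measurable_hebb_gap(2)[OF ij(1,2), of d] pred_near[OF ij(1,2), of d \<delta>]
  have x0: "0 \<le> x" unfolding x using \<delta> by simp
  define F where "F z = ennreal (exp (- l * cross_noise n d z i j)) * indicator {z. near d \<delta> (z i) (z j)} z" for z
  have F[measurable]: "F \<in> borel_measurable (gpairs n d)"
    unfolding F_def indicator_def mem_Collect_eq by measurable
  have n: "{i, j} \<union> ?R = {..<n}" using ij by auto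
  have inner: "(\<integral>\<^sup>+y. F (merge {i, j} ?R (c, y)) \<partial>PiM ?R (\<lambda>_. ?P)) \<le> ennreal ?C" for c
  proof (cases "near d \<delta> (c i) (c j)")
    case True
    let ?w = "\<lambda>k. fst (c i) k - fst (c j) k"
    let ?v = "snd (c i)"
    let ?x = "(-l)\<^sup>2 * dot d ?w ?w * dot d ?v ?v / (real d)\<^sup>2"
    have xx: "?x \<le> x" unfolding x using True \<delta>
      by (intro divide_right_mono mult_mono) (auto simp: near_def)
    have x0': "0 \<le> ?x" by simp
    have "F (merge {i, j} ?R (c, y)) = (\<Prod>k\<in>?R. ennreal (exp (- l * dot d ?w (fst (y k)) * dot d ?v (snd (y k)))))" for y
    proof -
      have "cross_noise n d (merge {i, j} ?R (c, y)) i j = (\<Sum>k\<in>?R. dot d ?w (fst (y k)) * dot d ?v (snd (y k)))"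
        unfolding cross_noise_def dot_diff_left using ij
        by (intro sum.cong refl) (auto simp: merge_def)
      then show ?thesis using True
        by (simp add: F_def merge_def sum_distrib_left exp_sum mult.assoc prod_ennreal sum_negf[symmetric])
    qed
    then have "(\<integral>\<^sup>+y. F (merge {i, j} ?R (c, y)) \<partial>PiM ?R (\<lambda>_. ?P))
       = (\<integral>\<^sup>+y. (\<Prod>k\<in>?R. ennreal (exp (- l * dot d ?w (fst (y k)) * dot d ?v (snd (y k))))) \<partial>PiM ?R (\<lambda>_. ?P))"
      by simp
    also have "\<dots> = (\<Prod>k\<in>?R. \<integral>\<^sup>+p. ennreal (exp (- l * dot d ?w (fst p) * dot d ?v (snd p))) \<partial>?P)"
      by (rule P.product_nn_integral_prod[where f="\<lambda>_ p. ennreal (exp (- l * dot d ?w (fst p) * dot d ?v (snd p)))"]) auto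
    also have "\<dots> \<le> (\<Prod>k\<in>?R. ennreal (exp (x / 2 + x\<^sup>2)))"
    proof (intro prod_mono_ennreal)
      have "(\<integral>\<^sup>+p. ennreal (exp (- l * dot d ?w (fst p) * dot d ?v (snd p))) \<partial>?P) \<le> ennreal (exp (?x / 2 + ?x\<^sup>2))"
        by (rule gvec_pair_mgf_le[OF d refl]) (use xx x(2) in linarith)
      also have "\<dots> \<le> ennreal (exp (x / 2 + x\<^sup>2))"
        using xx x0' by (intro ennreal_leI) (simp only: exp_le_cancel_iff, intro add_mono power_mono divide_right_mono, auto)
      finally show "(\<integral>\<^sup>+p. ennreal (exp (- l * dot d ?w (fst p) * dot d ?v (snd p))) \<partial>?P) \<le> ennreal (exp (x / 2 + x\<^sup>2))" .
    qed
    also have "\<dots> = ennreal (exp (real (card ?R) * (x / 2 + x\<^sup>2)))"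
      by (simp add: ennreal_power exp_of_nat_mult)
    also have "\<dots> \<le> ennreal ?C"
    proof -
      have "card ?R \<le> card {..<n}" by (intro card_mono) auto
      then have "real (card ?R) \<le> real n" by simp
      then show ?thesis using x0 by (intro ennreal_leI) (simp only: exp_le_cancel_iff, intro mult_right_mono, auto)
    qed
    finally show ?thesis .
  next
    case False
    then have "F (merge {i, j} ?R (c, y)) = 0" for y by (simp add: F_def merge_def)
    then show ?thesis by simp
  qed
  have "(\<integral>\<^sup>+z. F z \<partial>gpairs n d) = (\<integral>\<^sup>+c. \<integral>\<^sup>+y. F (merge {i, j} ?R (c, y)) \<partial>PiM ?R (\<lambda>_. ?P) \<partial>PiM {i, j} (\<lambda>_. ?P))"
    unfolding gpairs_def
    by (rule P.product_nn_integral_fold[of "{i, j}" ?R F, unfolded n]) (use F in \<open>auto simp: gpairs_def\<close>)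
  also have "\<dots> \<le> (\<integral>\<^sup>+c. ennreal ?C \<partial>PiM {i, j} (\<lambda>_. ?P))"
    by (intro nn_integral_mono inner)
  also have "\<dots> = ennreal ?C"
  proof -
    interpret Q: prob_space "PiM {i, j} (\<lambda>_. ?P)" by (intro prob_space_PiM prob_space_gvec_pair d)
    show ?thesis by (simp add: Q.emeasure_space_1)
  qed
  finally have FC: "(\<integral>\<^sup>+z. F z \<partial>gpairs n d) \<le> ennreal ?C" .
  let ?A = "{z \<in> space (gpairs n d). near d \<delta> (z i) (z j) \<and> \<kappa> \<le> - l * cross_noise n d z i j}"
  have "emeasure (gpairs n d) ?A = (\<integral>\<^sup>+z. indicator ?A z \<partial>gpairs n d)"
    by (subst nn_integral_indicator) measurable
  also have "\<dots> \<le> (\<integral>\<^sup>+z. ennreal (exp (- \<kappa>)) * F z \<partial>gpairs n d)"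
    by (intro nn_integral_mono)
      (auto split: split_indicator simp: F_def ennreal_mult'[symmetric] exp_add[symmetric] simp flip: ennreal_1 intro!: ennreal_leI)
  also have "\<dots> = ennreal (exp (- \<kappa>)) * (\<integral>\<^sup>+z. F z \<partial>gpairs n d)"
    by (rule nn_integral_cmult) simp
  also have "\<dots> \<le> ennreal (exp (- \<kappa>)) * ennreal ?C"
    using FC by (intro mult_left_mono) auto
  also have "\<dots> = ennreal (exp (- \<kappa> + real n * (x / 2 + x\<^sup>2)))"
    by (simp add: ennreal_mult'[symmetric] exp_add[symmetric])
  finally show ?thesis by (simp add: emeasure_eq_measure)
qed

text \<open>The summand k = i is at least (1 - 2 \<delta>) (1 - \<delta>), the summand k = j at most
  (1 + 2 \<delta>) \<delta> in absolute value, and the difference of these bounds is exactly 1 - 4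
  \<delta>.\<close>

lemma hebb_gap_pos:
  assumes ij: "i < n" "j < n" "i \<noteq> j" and \<delta>: "0 < \<delta>" "\<delta> < 1 / 4"
    and a: "1 - \<delta> < dot d (fst (z i)) (fst (z i))" "dot d (fst (z i)) (fst (z i)) < 1 + \<delta>" "dot d (fst (z j)) (fst (z j)) < 1 + \<delta>"
    and b: "1 - \<delta> < dot d (snd (z i)) (snd (z i))" "dot d (snd (z i)) (snd (z i)) < 1 + \<delta>"
    and c: "\<bar>dot d (fst (z i)) (fst (z j))\<bar> < \<delta>" "\<bar>dot d (snd (z i)) (snd (z j))\<bar> < \<delta>"
  shows "near d \<delta> (z i) (z j)" "- (1 - 4 * \<delta>) < cross_noise n d z i j \<Longrightarrow> 0 < hebb_gap n d z i j"
proof -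
  show "near d \<delta> (z i) (z j)"
    unfolding near_def dot_diff_self using a b c by auto
  assume N: "- (1 - 4 * \<delta>) < cross_noise n d z i j"
  let ?s = "dot d (fst (z i)) (fst (z j))" and ?t = "dot d (snd (z i)) (snd (z j))"
  have 1: "(1 - 2 * \<delta>) * (1 - \<delta>) \<le> (dot d (fst (z i)) (fst (z i)) - ?s) * dot d (snd (z i)) (snd (z i))"
    using a b c \<delta> by (intro mult_mono) auto
  have "\<bar>(?s - dot d (fst (z j)) (fst (z j))) * ?t\<bar> \<le> (1 + 2 * \<delta>) * \<delta>"
    unfolding abs_mult using a c \<delta> dot_self_nonneg[of d "fst (z j)"] by (intro mult_mono) linarith+
  then show "0 < hebb_gap n d z i j"
    unfolding hebb_gap_eq[OF ij] using 1 N by (simp add: algebra_simps abs_le_iff)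
qed

text \<open>Nine deviations of norms and inner products cost exp (- c d) each, negligible against
  n^2 comparisons once d >= sqrt n; the noise term is the one that decides the threshold.\<close>

lemma hebb_gap_tail:
  assumes d: "0 < d" and ij: "i < n" "j < n" "i \<noteq> j" and \<delta>: "0 < \<delta>" "\<delta> < 1 / 4" and l: "0 < l"
    and x: "x = l\<^sup>2 * (2 + 4 * \<delta>) * (1 + \<delta>) / (real d)\<^sup>2" "x \<le> 1 / 2"
  shows "measure (gpairs n d) {z \<in> space (gpairs n d). \<not> 0 < hebb_gap n d z i j}
     \<le> 9 * exp (- (real d * \<delta>\<^sup>2 / 16)) + exp (- (l * (1 - 4 * \<delta>)) + real n * (x / 2 + x\<^sup>2))"
proof -
  interpret prob_space "gpairs n d" using d by (rule prob_space_gpairs)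
  note [measurable] = measurable_hebb_gap[OF ij(1,2), of d] pred_near[OF ij(1,2), of d \<delta>]
    measurable_gpairs_fst_snd[OF ij(1), of d] measurable_gpairs_fst_snd[OF ij(2), of d]
  let ?S = "space (gpairs n d)"
  let ?e = "exp (- (real d * \<delta>\<^sup>2 / 16))"
  define B where "B = [{z \<in> ?S. 1 + \<delta> \<le> dot d (fst (z i)) (fst (z i))},
     {z \<in> ?S. dot d (fst (z i)) (fst (z i)) \<le> 1 - \<delta>},
     {z \<in> ?S. 1 + \<delta> \<le> dot d (fst (z j)) (fst (z j))},
     {z \<in> ?S. 1 + \<delta> \<le> dot d (snd (z i)) (snd (z i))},
     {z \<in> ?S. dot d (snd (z i)) (snd (z i)) \<le> 1 - \<delta>},
     {z \<in> ?S. \<delta> \<le> 1 * dot d (fst (z i)) (fst (z j))},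
     {z \<in> ?S. \<delta> \<le> (-1) * dot d (fst (z i)) (fst (z j))},
     {z \<in> ?S. \<delta> \<le> 1 * dot d (snd (z i)) (snd (z j))},
     {z \<in> ?S. \<delta> \<le> (-1) * dot d (snd (z i)) (snd (z j))}]"
  let ?N = "{z \<in> ?S. near d \<delta> (z i) (z j) \<and> l * (1 - 4 * \<delta>) \<le> - l * cross_noise n d z i j}"
  have B_sets: "set B \<subseteq> events" unfolding B_def by simp
  have B_prob: "prob b \<le> ?e" if "b \<in> set B" for b
    using that \<delta> d ij chernoff_dot[OF d ij \<delta>(1), of fst 1] chernoff_dot[OF d ij \<delta>(1), of fst "-1"]
      chernoff_dot[OF d ij \<delta>(1), of snd 1] chernoff_dot[OF d ij \<delta>(1), of snd "-1"]
    unfolding B_def by (auto intro!: chernoff_norm)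
  have sub: "{z \<in> ?S. \<not> 0 < hebb_gap n d z i j} \<subseteq> (\<Union>m<9. B ! m) \<union> ?N"
  proof
    fix z assume z: "z \<in> {z \<in> ?S. \<not> 0 < hebb_gap n d z i j}"
    show "z \<in> (\<Union>m<9. B ! m) \<union> ?N"
    proof (rule ccontr)
      assume "\<not> ?thesis"
      then have nb: "\<And>m. m < 9 \<Longrightarrow> z \<notin> B ! m" and nn: "z \<notin> ?N" by auto
      have h: "1 - \<delta> < dot d (fst (z i)) (fst (z i))" "dot d (fst (z i)) (fst (z i)) < 1 + \<delta>" "dot d (fst (z j)) (fst (z j)) < 1 + \<delta>"
        "1 - \<delta> < dot d (snd (z i)) (snd (z i))" "dot d (snd (z i)) (snd (z i)) < 1 + \<delta>"
        "\<bar>dot d (fst (z i)) (fst (z j))\<bar> < \<delta>" "\<bar>dot d (snd (z i)) (snd (z j))\<bar> < \<delta>"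
        using nb[of 0] nb[of 1] nb[of 2] nb[of 3] nb[of 4] nb[of 5] nb[of 6] nb[of 7] nb[of 8] z
        by (simp_all add: B_def not_le abs_less_iff)
      note g = hebb_gap_pos[where z=z, OF ij \<delta> h]
      have "\<not> l * (1 - 4 * \<delta>) \<le> - l * cross_noise n d z i j" using nn g(1) z by auto
      then have "l * (- (1 - 4 * \<delta>)) < l * cross_noise n d z i j" by (simp add: algebra_simps)
      then have "- (1 - 4 * \<delta>) < cross_noise n d z i j" using l by (simp only: mult_less_cancel_left_pos)
      then show False using g(2) z by auto
    qed
  qed
  have len: "length B = 9" by (simp add: B_def)
  have BS: "B ! m \<in> events" if "m < 9" for m using B_sets that len by (metis nth_mem subsetD)
  have NS: "?N \<in> events" by measurable
  have "prob {z \<in> ?S. \<not> 0 < hebb_gap n d z i j} \<le> prob ((\<Union>m<9. B ! m) \<union> ?N)"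
    using BS NS by (intro finite_measure_mono sub) auto
  also have "\<dots> \<le> prob (\<Union>m<9. B ! m) + prob ?N"
    using BS NS by (intro measure_Un_le) auto
  also have "prob (\<Union>m<9. B ! m) \<le> (\<Sum>m<9. prob (B ! m))"
    using BS by (intro measure_UNION_le) auto
  also have "\<dots> \<le> (\<Sum>m<(9::nat). ?e)"
    using len by (intro sum_mono B_prob) auto
  also have "prob ?N \<le> exp (- (l * (1 - 4 * \<delta>)) + real n * (x / 2 + x\<^sup>2))"
    using d ij \<delta>(1) x by (rule cross_noise_tail)
  finally show ?thesis by simp
qed

text \<open>Union bound over ordered pairs (i, j). The Chernoff parameter l stays free, to be tuned
  to n later.\<close>

lemma PR_prob_lower:
  assumes d: "0 < d" and \<delta>: "0 < \<delta>" "\<delta> < 1 / 4" and l: "0 < l"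
    and x: "x = l\<^sup>2 * (2 + 4 * \<delta>) * (1 + \<delta>) / (real d)\<^sup>2" "x \<le> 1 / 2"
  shows "1 - (real n)\<^sup>2 * (9 * exp (- (real d * \<delta>\<^sup>2 / 16)) + exp (- (l * (1 - 4 * \<delta>)) + real n * (x / 2 + x\<^sup>2)))
    \<le> PR_prob n d"
proof -
  interpret prob_space "gpairs n d" using d by (rule prob_space_gpairs)
  let ?S = "space (gpairs n d)"
  let ?c = "9 * exp (- (real d * \<delta>\<^sup>2 / 16)) + exp (- (l * (1 - 4 * \<delta>)) + real n * (x / 2 + x\<^sup>2))"
  let ?E = "{z \<in> ?S. \<exists>W. retrieves n d W z}"
  let ?I = "{(i, j). i < n \<and> j < n \<and> i \<noteq> j}"
  let ?D = "\<lambda>(i, j). {z \<in> ?S. \<not> 0 < hebb_gap n d z i j}"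
  have I: "?I \<subseteq> {..<n} \<times> {..<n}" by auto
  then have fin: "finite ?I" by (rule finite_subset) simp
  have D: "?D ij \<in> events" if "ij \<in> ?I" for ij
    using that measurable_hebb_gap(1)[of "fst ij" n "snd ij" d] by (auto simp: split_def)
  have "?S - ?E \<subseteq> (\<Union>ij\<in>?I. ?D ij)"
    using retrieves_hebb[of n d] by fastforce
  then have "prob (?S - ?E) \<le> prob (\<Union>ij\<in>?I. ?D ij)"
    using D fin by (intro finite_measure_mono) auto
  also have "\<dots> \<le> (\<Sum>ij\<in>?I. prob (?D ij))"
    using D fin by (intro measure_UNION_le) auto
  also have "\<dots> \<le> (\<Sum>ij\<in>?I. ?c)"
    using hebb_gap_tail[OF d _ _ _ \<delta> l x] by (intro sum_mono) auto
  also have "\<dots> = real (card ?I) * ?c" by simp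
  also have "\<dots> \<le> (real n)\<^sup>2 * ?c"
  proof (intro mult_right_mono)
    have "card ?I \<le> card ({..<n} \<times> {..<n})" using I by (intro card_mono) auto
    then show "real (card ?I) \<le> (real n)\<^sup>2" by (simp add: power2_eq_square flip: of_nat_mult)
  qed (auto intro!: add_nonneg_nonneg)
  finally show ?thesis
    using prob_compl[OF sets_retrieves[of n d]] PR_prob_eq[OF d, of n] by simp
qed

lemma PR_prob_le_1: "0 < d \<Longrightarrow> PR_prob n d \<le> 1"
  by (simp add: PR_prob_eq prob_space.prob_le_1 prob_space_gpairs)

section \<open>Asymptotics above the threshold\<close>

lemma PR_prob_tendsto_1:
  fixes nn dd :: "nat \<Rightarrow> nat"
  assumes \<rho>: "\<rho> > 8" and nn: "filterlim nn at_top sequentially" and dd: "filterlim dd at_top sequentially"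
    and le: "\<forall>k. real (dd k) ^ 2 \<ge> \<rho> * real (nn k) * ln (real (nn k))"
  shows "(\<lambda>k. PR_prob (nn k) (dd k)) \<longlonglongrightarrow> 1"
proof -
  \<comment> \<open>Below, l = \<rho>/2 * ln n minimises 2 ln n - l + l^2 / (\<rho> ln n), the exponent for \<delta> = 0.\<close>
  define \<delta> where "\<delta> = (\<rho> - 8) / (16 * \<rho>)"
  have \<delta>: "0 < \<delta>" "\<delta> < 1 / 16" using \<rho> by (auto simp: \<delta>_def field_simps)
  \<comment> \<open>For l = \<rho>/2 * ln n, the hypothesis d^2 >= \<rho> n ln n gives x <= c ln n /
    n.\<close>
  define c where "c = \<rho> / 4 * ((2 + 4 * \<delta>) * (1 + \<delta>))"
  have c: "0 < c" using \<rho> \<delta> by (simp add: c_def)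
  \<comment> \<open>n^(-\<kappa>) is what the noise leaves after the union bound: 2 ln n - l (1 - 4
    \<delta>) + c/2 * ln n = - \<kappa> ln n. Since \<rho> \<delta> = (\<rho> - 8) / 16, the losses
    due to \<delta> take at most 23/32 of the main term (\<rho> - 8) / 4.\<close>
  define \<kappa> where "\<kappa> = \<rho> / 2 * (1 - 4 * \<delta>) - 2 - c / 2"
  have \<kappa>: "0 < \<kappa>"
  proof -
    have "\<delta>\<^sup>2 \<le> 1 / 16 * \<delta>" unfolding power2_eq_square using \<delta> by (intro mult_right_mono) auto
    then have "(2 + 4 * \<delta>) * (1 + \<delta>) \<le> 2 + 7 * \<delta>" using \<delta> by (simp add: algebra_simps power2_eq_square)
    then have "c \<le> \<rho> / 4 * (2 + 7 * \<delta>)" unfolding c_def using \<rho> by (intro mult_left_mono) auto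
    moreover have "\<rho> * \<delta> = (\<rho> - 8) / 16" using \<rho> by (simp add: \<delta>_def)
    ultimately show ?thesis unfolding \<kappa>_def using \<rho> by (simp add: algebra_simps)
  qed
  \<comment> \<open>The first summand collects the nine deviation events, with d replaced by its
    lower bound sqrt n; in the second, c^2 (ln n)^2 / n comes from the term n x^2.\<close>
  define err where "err n = 9 * (n\<^sup>2 * exp (- (\<delta>\<^sup>2 / 16 * sqrt n))) + exp (- \<kappa> * ln n + c\<^sup>2 * (ln n)\<^sup>2 / n)" for n :: real
  have "(err \<longlongrightarrow> 0) at_top"
  proof -
    have \<delta>2: "\<delta>\<^sup>2 / 16 > 0" using \<delta> by simp
    have 1: "((\<lambda>n. n\<^sup>2 * exp (- (a * sqrt n))) \<longlongrightarrow> 0) at_top" if "a > 0" for a :: real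
      using that by real_asymp
    have 2: "((\<lambda>n. exp (- \<kappa> * ln n + a * (ln n)\<^sup>2 / n)) \<longlongrightarrow> 0) at_top" if "a > 0" for a :: real
      using \<kappa> that by real_asymp
    have "(err \<longlongrightarrow> 9 * 0 + 0) at_top" unfolding err_def
      using c by (intro tendsto_intros 1[OF \<delta>2] 2) auto
    then show ?thesis by simp
  qed
  then have err0: "(\<lambda>k. err (real (nn k))) \<longlonglongrightarrow> 0"
    using filterlim_compose[OF filterlim_real_sequentially nn] by (rule filterlim_compose)
  have small: "\<forall>\<^sub>F n in at_top. c * ln n / n \<le> 1 / 2" for c :: real
  proof -
    have "((\<lambda>n. c * ln n / n) \<longlongrightarrow> 0) at_top" by real_asymp
    then have "\<forall>\<^sub>F n in at_top. c * ln n / n < 1 / 2" by (rule order_tendstoD(2)) simp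
    then show ?thesis by eventually_elim simp
  qed
  have ev: "\<forall>\<^sub>F k in sequentially. 1 - err (real (nn k)) \<le> PR_prob (nn k) (dd k)"
  proof -
    have "\<forall>\<^sub>F k in sequentially. c * ln (real (nn k)) / real (nn k) \<le> 1 / 2"
      using filterlim_compose[OF filterlim_real_sequentially nn] small[of c]
      by (auto simp: filterlim_iff)
    moreover have "\<forall>\<^sub>F k in sequentially. 3 \<le> nn k" "\<forall>\<^sub>F k in sequentially. 1 \<le> dd k"
      using nn dd by (auto simp: filterlim_at_top)
    ultimately show ?thesis
    proof eventually_elim
      case (elim k)
      define n d L where "n = nn k" and "d = dd k" and "L = ln (real (nn k))"
      have n3: "real n \<ge> 3" and d: "0 < d" using elim by (auto simp: n_def d_def)
      have L1: "1 \<le> L"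
      proof -
        have "exp 1 \<le> real n" using exp_le n3 by linarith
        then show ?thesis using n3 by (simp add: L_def n_def[symmetric] ln_ge_iff)
      qed
      have d2: "(real d)\<^sup>2 \<ge> \<rho> * real n * L" using le by (simp add: n_def d_def L_def)
      define l where "l = \<rho> / 2 * L"
      have l: "0 < l" using \<rho> L1 by (simp add: l_def)
      define x where "x = l\<^sup>2 * (2 + 4 * \<delta>) * (1 + \<delta>) / (real d)\<^sup>2"
      have pos: "0 < \<rho> * real n * L" using \<rho> n3 L1 by simp
      have x0: "0 \<le> x" unfolding x_def using \<delta> by simp
      have "x \<le> l\<^sup>2 * (2 + 4 * \<delta>) * (1 + \<delta>) / (\<rho> * real n * L)"
        unfolding x_def using d2 pos \<delta> d \<rho> n3 L1 by (intro divide_left_mono mult_nonneg_nonneg mult_pos_pos) auto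
      also have "\<dots> = c * L / real n"
        using \<rho> n3 L1 by (simp add: l_def c_def power2_eq_square field_simps)
      finally have xc: "x \<le> c * L / real n" .
      have x2: "x \<le> 1 / 2" using xc elim(1) unfolding L_def n_def by (rule order_trans)
      have \<delta>4: "\<delta> < 1 / 4" using \<delta> by simp
      have "real n * (x / 2 + x\<^sup>2) \<le> real n * (c * L / real n / 2 + (c * L / real n)\<^sup>2)"
        using xc x0 by (intro mult_left_mono add_mono power_mono divide_right_mono) auto
      also have "\<dots> = c * L / 2 + c\<^sup>2 * L\<^sup>2 / real n"
        using n3 by (simp add: power2_eq_square field_simps)
      finally have nx: "real n * (x / 2 + x\<^sup>2) \<le> c * L / 2 + c\<^sup>2 * L\<^sup>2 / real n" .
      have sq: "(real n)\<^sup>2 = exp (2 * L)"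
        using n3 by (simp add: L_def n_def exp_of_nat_mult[of 2, simplified] )
      have "(real n)\<^sup>2 * exp (- (l * (1 - 4 * \<delta>)) + real n * (x / 2 + x\<^sup>2))
          = exp (2 * L - l * (1 - 4 * \<delta>) + real n * (x / 2 + x\<^sup>2))"
        unfolding sq by (simp add: exp_add[symmetric])
      also have "\<dots> \<le> exp (- \<kappa> * L + c\<^sup>2 * L\<^sup>2 / real n)"
        using nx by (simp add: \<kappa>_def l_def algebra_simps)
      finally have B: "(real n)\<^sup>2 * exp (- (l * (1 - 4 * \<delta>)) + real n * (x / 2 + x\<^sup>2)) \<le> exp (- \<kappa> * L + c\<^sup>2 * L\<^sup>2 / real n)" .
      have "sqrt (real n) \<le> real d"
      proof (rule real_le_lsqrt)
        have "real n * 1 \<le> real n * (\<rho> * L)"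
          using \<rho> L1 mult_mono[of 1 \<rho> 1 L] by (intro mult_left_mono) auto
        also have "\<dots> = \<rho> * real n * L" by simp
        finally show "real n \<le> (real d)\<^sup>2" using d2 by linarith
      qed auto
      then have "exp (- (real d * \<delta>\<^sup>2 / 16)) \<le> exp (- (\<delta>\<^sup>2 / 16 * sqrt (real n)))"
        using \<delta> by (simp add: mult_left_mono mult.commute)
      then have A: "(real n)\<^sup>2 * (9 * exp (- (real d * \<delta>\<^sup>2 / 16))) \<le> 9 * ((real n)\<^sup>2 * exp (- (\<delta>\<^sup>2 / 16 * sqrt (real n))))"
        by (simp add: mult_left_mono)
      have "1 - err (real n) \<le> 1 - (real n)\<^sup>2 * (9 * exp (- (real d * \<delta>\<^sup>2 / 16)) + exp (- (l * (1 - 4 * \<delta>)) + real n * (x / 2 + x\<^sup>2)))"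
        using A B unfolding err_def by (simp add: distrib_left L_def n_def)
      also have "\<dots> \<le> PR_prob n d"
        by (rule PR_prob_lower[OF d \<delta>(1) \<delta>4 l x_def x2])
      finally show ?case by (simp add: n_def d_def)
    qed
  qed
  show ?thesis
  proof (rule tendsto_sandwich[OF ev])
    show "\<forall>\<^sub>F k in sequentially. PR_prob (nn k) (dd k) \<le> 1"
      using filterlim_at_top[THEN iffD1, OF dd, rule_format, of 1]
      by eventually_elim (simp add: PR_prob_le_1)
    show "(\<lambda>k. 1 - err (real (nn k))) \<longlonglongrightarrow> 1"
      using tendsto_diff[OF tendsto_const err0, of 1] by simp
  qed simp
qed

section \<open>The Frobenius norm of the Hebbian matrix\<close>

lemma gvec_coord_moments:
  assumes d: "0 < d" and k: "k < d"
  shows "integrable (gvec d) (\<lambda>x. x k ^ m)" "(\<integral>x. (x k)\<^sup>2 \<partial>gvec d) = 1 / real d"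
    "(\<integral>x. x k ^ 4 \<partial>gvec d) = 3 / (real d)\<^sup>2" "integrable (gvec d) (\<lambda>x. \<bar>x k\<bar>)" "(\<integral>x. \<bar>x k\<bar> \<partial>gvec d) \<le> 1"
proof -
  let ?e = "\<lambda>j. if j = k then 1 else (0::real)"
  have e: "dot d ?e x = x k" for x
    using k by (simp add: dot_def if_distrib[of "\<lambda>c. c * _"] cong: if_cong)
  note m = gvec_linear_moments[OF d, of ?e, unfolded e]
  show "integrable (gvec d) (\<lambda>x. x k ^ m)" "(\<integral>x. (x k)\<^sup>2 \<partial>gvec d) = 1 / real d"
    "(\<integral>x. x k ^ 4 \<partial>gvec d) = 3 / (real d)\<^sup>2" "integrable (gvec d) (\<lambda>x. \<bar>x k\<bar>)"
    using m by (simp_all add: power_divide)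
  have "sqrt (2 / pi) * sqrt (1 / real d) \<le> 1 * 1"
    using d pi_gt3 by (intro mult_mono) (auto simp: field_simps)
  then show "(\<integral>x. \<bar>x k\<bar> \<partial>gvec d) \<le> 1" using m by simp
qed

text \<open>The fourth moment of the norm is exactly 1 + 2/d; the crude 3, from Cauchy-Schwarz over
  the coordinates, is enough because it only enters the lower-order term 18 n of
  \<open>nn_integral_frob_hebb\<close>.\<close>

lemma gvec_norm_moments:
  assumes d: "0 < d"
  shows "integrable (gvec d) (\<lambda>x. dot d x x)" "(\<integral>x. dot d x x \<partial>gvec d) = 1"
    "integrable (gvec d) (\<lambda>x. (dot d x x)\<^sup>2)" "(\<integral>x. (dot d x x)\<^sup>2 \<partial>gvec d) \<le> 3"
proof -
  have eq: "dot d x x = (\<Sum>k<d. (x k)\<^sup>2)" for x by (simp add: dot_def power2_eq_square)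
  note [simp] = gvec_coord_moments[OF d]
  show "integrable (gvec d) (\<lambda>x. dot d x x)"
    unfolding eq by (intro Bochner_Integration.integrable_sum) simp
  show "(\<integral>x. dot d x x \<partial>gvec d) = 1"
    using d unfolding eq by (subst Bochner_Integration.integral_sum) simp_all
  have le: "(dot d x x)\<^sup>2 \<le> real d * (\<Sum>k<d. x k ^ 4)" for x
    using Cauchy_Schwarz_ineq_sum[of "\<lambda>_. 1" "\<lambda>k. (x k)\<^sup>2" "{..<d}"]
    unfolding eq by (simp flip: power_mult)
  have i: "integrable (gvec d) (\<lambda>x. real d * (\<Sum>k<d. x k ^ 4))"
    by (intro integrable_mult_right Bochner_Integration.integrable_sum) simp
  show i2: "integrable (gvec d) (\<lambda>x. (dot d x x)\<^sup>2)"
    by (rule Bochner_Integration.integrable_bound[OF i])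
      (auto intro!: AE_I2 order_trans[OF le])
  have "(\<integral>x. (dot d x x)\<^sup>2 \<partial>gvec d) \<le> (\<integral>x. real d * (\<Sum>k<d. x k ^ 4) \<partial>gvec d)"
    by (intro integral_mono i i2 le)
  also have "\<dots> = 3"
    using d by (simp add: Bochner_Integration.integral_sum power2_eq_square)
  finally show "(\<integral>x. (dot d x x)\<^sup>2 \<partial>gvec d) \<le> 3" .
qed

text \<open>The square of the Frobenius norm, a polynomial in the entries and so with explicit
  moments.\<close>

definition frob :: "nat \<Rightarrow> (nat \<Rightarrow> nat \<Rightarrow> real) \<Rightarrow> real" where
  "frob d s = (\<Sum>p<d. \<Sum>q<d. (s p q)\<^sup>2)"

lemma frob_nonneg [simp]: "0 \<le> frob d s"
  unfolding frob_def by (intro sum_nonneg) auto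

lemma frob_rank_one_update:
  "frob d (\<lambda>p q. s p q + u p * v q) = frob d s + 2 * dot d (\<lambda>q. \<Sum>p<d. s p q * u p) v + dot d u u * dot d v v"
proof -
  have 1: "dot d (\<lambda>q. \<Sum>p<d. s p q * u p) v = (\<Sum>p<d. \<Sum>q<d. s p q * u p * v q)"
    unfolding dot_def sum_distrib_right by (rule sum.swap)
  have 2: "dot d u u * dot d v v = (\<Sum>p<d. \<Sum>q<d. (u p * v q)\<^sup>2)"
    unfolding dot_def sum_product by (intro sum.cong refl) (simp add: power2_eq_square)
  show ?thesis
    unfolding 1 2 frob_def sum_distrib_left sum.distrib[symmetric]
    by (intro sum.cong refl) (simp add: power2_eq_square algebra_simps)
qed

lemma gvec_frob_linear:
  assumes d: "0 < d"
  shows "integrable (gvec d) (\<lambda>u. dot d (\<lambda>q. \<Sum>p<d. s p q * u p) (\<lambda>q. \<Sum>p<d. s p q * u p))"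
    "(\<integral>u. dot d (\<lambda>q. \<Sum>p<d. s p q * u p) (\<lambda>q. \<Sum>p<d. s p q * u p) \<partial>gvec d) = frob d s / real d"
proof -
  have eq: "dot d (\<lambda>q. \<Sum>p<d. s p q * u p) (\<lambda>q. \<Sum>p<d. s p q * u p) = (\<Sum>q<d. (dot d (\<lambda>p. s p q) u)\<^sup>2)" for u
    by (simp add: dot_def power2_eq_square)
  have i: "integrable (gvec d) (\<lambda>u. (dot d (\<lambda>p. s p q) u)\<^sup>2)" for q
    using gvec_linear_moments(1)[OF d] by simp
  show "integrable (gvec d) (\<lambda>u. dot d (\<lambda>q. \<Sum>p<d. s p q * u p) (\<lambda>q. \<Sum>p<d. s p q * u p))"
    unfolding eq by (intro Bochner_Integration.integrable_sum i)
  have "frob d s = (\<Sum>q<d. dot d (\<lambda>p. s p q) (\<lambda>p. s p q))"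
    unfolding frob_def dot_def by (subst sum.swap) (simp add: power2_eq_square)
  then show "(\<integral>u. dot d (\<lambda>q. \<Sum>p<d. s p q * u p) (\<lambda>q. \<Sum>p<d. s p q * u p) \<partial>gvec d) = frob d s / real d"
    unfolding eq
    by (subst Bochner_Integration.integral_sum) (simp_all add: i gvec_linear_moments(3)[OF d] sum_divide_distrib)
qed

text \<open>The cross term 2 u^T s v has mean zero and second moment 4 |s|^2 / d^2, so adding a pair
  raises the mean by exactly 1 and the fluctuations stay small. The constant 18 = 2 * 3 * 3 comes
  from the fourth moments of |u| and |v|.\<close>

lemma nn_integral_frob_update:
  assumes d: "0 < d"
  shows "(\<integral>\<^sup>+u. \<integral>\<^sup>+v. ennreal (frob d (\<lambda>p q. s p q + u p * v q)) \<partial>gvec d \<partial>gvec d) = ennreal (frob d s + 1)"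
    "(\<integral>\<^sup>+u. \<integral>\<^sup>+v. ennreal ((frob d (\<lambda>p q. s p q + u p * v q))\<^sup>2) \<partial>gvec d \<partial>gvec d)
      \<le> ennreal ((frob d s)\<^sup>2 + (2 + 8 / (real d)\<^sup>2) * frob d s + 18)"
proof -
  interpret V: prob_space "gvec d" using d by (rule prob_space_gvec)
  let ?q = "frob d s"
  let ?c = "\<lambda>u q. \<Sum>p<d. s p q * u p"
  note [simp] = gvec_norm_moments(1-3)[OF d] gvec_linear_moments(2,3)[OF d] V.prob_space
    gvec_frob_linear[OF d]
  have il[simp]: "integrable (gvec d) (dot d c)" for c
    using gvec_linear_moments(1)[OF d, of c 1] by simp
  have iq[simp]: "integrable (gvec d) (\<lambda>v. (dot d c v)\<^sup>2)" for c
    using gvec_linear_moments(1)[OF d, of c 2] by simp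
  have "(\<integral>\<^sup>+v. ennreal (frob d (\<lambda>p q. s p q + u p * v q)) \<partial>gvec d) = ennreal (?q + dot d u u)" for u
  proof -
    have "(\<integral>\<^sup>+v. ennreal (frob d (\<lambda>p q. s p q + u p * v q)) \<partial>gvec d)
        = ennreal (\<integral>v. ?q + 2 * dot d (?c u) v + dot d u u * dot d v v \<partial>gvec d)"
      unfolding frob_rank_one_update
      by (intro nn_integral_eq_integral AE_I2)
        (auto simp: frob_nonneg[of d "\<lambda>p q. s p q + u p * _ q", unfolded frob_rank_one_update])
    then show ?thesis by simp
  qed
  then have "(\<integral>\<^sup>+u. \<integral>\<^sup>+v. ennreal (frob d (\<lambda>p q. s p q + u p * v q)) \<partial>gvec d \<partial>gvec d)
      = (\<integral>\<^sup>+u. ennreal (?q + dot d u u) \<partial>gvec d)" by simp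
  also have "\<dots> = ennreal (\<integral>u. ?q + dot d u u \<partial>gvec d)"
    by (intro nn_integral_eq_integral) auto
  also have "\<dots> = ennreal (?q + 1)" by simp
  finally show "(\<integral>\<^sup>+u. \<integral>\<^sup>+v. ennreal (frob d (\<lambda>p q. s p q + u p * v q)) \<partial>gvec d \<partial>gvec d) = ennreal (frob d s + 1)" .

  let ?m = "\<integral>v. (dot d v v)\<^sup>2 \<partial>gvec d"
  have m: "0 \<le> ?m" "?m \<le> 3" using gvec_norm_moments(4)[OF d] by auto
  \<comment> \<open>Squaring the update produces a product of the cross term with |u|^2 |v|^2. The
    inequality 4 l y <= 4 l^2 + y^2 removes it and doubles two coefficients, to 8 and 2.\<close>
  let ?B = "\<lambda>u v. ?q\<^sup>2 + 8 * (dot d (?c u) v)\<^sup>2 + 2 * ((dot d u u)\<^sup>2 * (dot d v v)\<^sup>2) + 4 * (?q * dot d (?c u) v) + 2 * (?q * (dot d u u * dot d v v))"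
  let ?D = "\<lambda>u. ?q\<^sup>2 + 8 * (dot d (?c u) (?c u) / real d) + 2 * ((dot d u u)\<^sup>2 * ?m) + 2 * (?q * dot d u u)"
  have "(\<integral>\<^sup>+v. ennreal ((frob d (\<lambda>p q. s p q + u p * v q))\<^sup>2) \<partial>gvec d) \<le> ennreal (?D u)" for u
  proof -
    have le: "(frob d (\<lambda>p q. s p q + u p * v q))\<^sup>2 \<le> ?B u v" for v
    proof -
      have "4 * (l * y) \<le> 4 * l\<^sup>2 + y\<^sup>2" for l y :: real
        using zero_le_power2[of "2 * l - y"] by (simp add: power2_eq_square algebra_simps)
      from this[of "dot d (?c u) v" "dot d u u * dot d v v"] show ?thesis
        unfolding frob_rank_one_update by (simp add: power2_eq_square algebra_simps)
    qed
    have "(\<integral>\<^sup>+v. ennreal ((frob d (\<lambda>p q. s p q + u p * v q))\<^sup>2) \<partial>gvec d) \<le> (\<integral>\<^sup>+v. ennreal (?B u v) \<partial>gvec d)"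
      by (intro nn_integral_mono ennreal_leI le)
    also have "\<dots> = ennreal (\<integral>v. ?B u v \<partial>gvec d)"
      by (intro nn_integral_eq_integral AE_I2 order_trans[OF _ le]) auto
    also have "(\<integral>v. ?B u v \<partial>gvec d) = ?D u" by simp
    finally show ?thesis .
  qed
  then have "(\<integral>\<^sup>+u. \<integral>\<^sup>+v. ennreal ((frob d (\<lambda>p q. s p q + u p * v q))\<^sup>2) \<partial>gvec d \<partial>gvec d)
      \<le> (\<integral>\<^sup>+u. ennreal (?D u) \<partial>gvec d)" by (intro nn_integral_mono)
  also have "\<dots> = ennreal (\<integral>u. ?D u \<partial>gvec d)"
    using m by (intro nn_integral_eq_integral AE_I2 add_nonneg_nonneg) auto
  also have "(\<integral>u. ?D u \<partial>gvec d) = ?q\<^sup>2 + 8 * (?q / real d / real d) + 2 * (?m * ?m) + 2 * ?q" by simp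
  also have "\<dots> \<le> ?q\<^sup>2 + (2 + 8 / (real d)\<^sup>2) * ?q + 18"
    using mult_mono[OF m(2) m(2)] m(1) by (simp add: power2_eq_square algebra_simps)
  finally show "(\<integral>\<^sup>+u. \<integral>\<^sup>+v. ennreal ((frob d (\<lambda>p q. s p q + u p * v q))\<^sup>2) \<partial>gvec d \<partial>gvec d)
      \<le> ennreal (?q\<^sup>2 + (2 + 8 / (real d)\<^sup>2) * ?q + 18)" by (simp add: ennreal_leI)
qed

lemma measurable_frob_hebb [measurable]: "(\<lambda>z. frob d (hebb n z)) \<in> borel_measurable (gpairs n d)"
  unfolding frob_def hebb_def
  by (intro borel_measurable_sum borel_measurable_power borel_measurable_times
      measurable_compose[OF measurable_gpairs_fst_snd(1) measurable_gvec_coord]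
      measurable_compose[OF measurable_gpairs_fst_snd(2) measurable_gvec_coord]) auto

lemma nn_integral_gpairs_Suc:
  assumes d: "0 < d" and f: "f \<in> borel_measurable (gpairs (Suc n) d)"
  shows "(\<integral>\<^sup>+z. f z \<partial>gpairs (Suc n) d)
     = (\<integral>\<^sup>+z. \<integral>\<^sup>+u. \<integral>\<^sup>+v. f (z(n := (u, v))) \<partial>gvec d \<partial>gvec d \<partial>gpairs n d)"
proof -
  interpret V: prob_space "gvec d" using d by (rule prob_space_gvec)
  interpret P: product_sigma_finite "\<lambda>_::nat. gvec d \<Otimes>\<^sub>M gvec d" using d by (rule product_sigma_finite_pairs)
  have "(\<integral>\<^sup>+z. f z \<partial>gpairs (Suc n) d) = (\<integral>\<^sup>+z. \<integral>\<^sup>+y. f (z(n := y)) \<partial>(gvec d \<Otimes>\<^sub>M gvec d) \<partial>gpairs n d)"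
    using f unfolding gpairs_def lessThan_Suc by (intro P.product_nn_integral_insert) auto
  also have "\<dots> = (\<integral>\<^sup>+z. \<integral>\<^sup>+u. \<integral>\<^sup>+v. f (z(n := (u, v))) \<partial>gvec d \<partial>gvec d \<partial>gpairs n d)"
  proof (intro nn_integral_cong)
    fix z assume z: "z \<in> space (gpairs n d)"
    have "(\<lambda>y. z(n := y)) \<in> gvec d \<Otimes>\<^sub>M gvec d \<rightarrow>\<^sub>M gpairs (Suc n) d"
      using z unfolding gpairs_def lessThan_Suc by (intro measurable_component_update) auto
    then have "(\<lambda>y. f (z(n := y))) \<in> borel_measurable (gvec d \<Otimes>\<^sub>M gvec d)"
      using f by (rule measurable_compose)
    then show "(\<integral>\<^sup>+y. f (z(n := y)) \<partial>(gvec d \<Otimes>\<^sub>M gvec d)) = (\<integral>\<^sup>+u. \<integral>\<^sup>+v. f (z(n := (u, v))) \<partial>gvec d \<partial>gvec d)"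
      by (subst V.nn_integral_fst[symmetric]) auto
  qed
  finally show ?thesis .
qed

lemma hebb_Suc_update: "hebb (Suc n) (z(n := (u, v))) = (\<lambda>p q. hebb n z p q + u p * v q)"
  by (intro ext) (simp add: hebb_def)

text \<open>A new pair is a rank-one update independent of the sum so far, so both moments follow by
  induction on n, the second using the first. Summing (2 + 8 / d^2) k over k < n stays below n^2 (1
  + 4 / d^2), so the variance is at most 4 n^2 / d^2 + 18 n.\<close>

lemma nn_integral_frob_hebb:
  assumes d: "0 < d"
  shows "(\<integral>\<^sup>+z. ennreal (frob d (hebb n z)) \<partial>gpairs n d) = ennreal (real n)"
    "(\<integral>\<^sup>+z. ennreal ((frob d (hebb n z))\<^sup>2) \<partial>gpairs n d)
       \<le> ennreal ((real n)\<^sup>2 * (1 + 4 / (real d)\<^sup>2) + 18 * real n)"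
proof (induction n)
  case 0
  { case 1 show ?case by (simp add: frob_def hebb_def) }
  { case 2 show ?case by (simp add: frob_def hebb_def) }
next
  case (Suc n)
  interpret prob_space "gpairs n d" using d by (rule prob_space_gpairs)
  { case 1
    have "(\<integral>\<^sup>+z. ennreal (frob d (hebb (Suc n) z)) \<partial>gpairs (Suc n) d) = (\<integral>\<^sup>+z. ennreal (frob d (hebb n z)) + 1 \<partial>gpairs n d)"
      by (subst nn_integral_gpairs_Suc[OF d])
        (simp_all add: hebb_Suc_update nn_integral_frob_update(1)[OF d])
    also have "\<dots> = ennreal (real n) + 1"
      by (subst nn_integral_add) (simp_all add: Suc.IH(1) emeasure_space_1)
    finally show ?case by (simp flip: ennreal_1 ennreal_plus add: add.commute)
  }
  { case 2
    let ?a = "2 + 8 / (real d)\<^sup>2"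
    have "(\<integral>\<^sup>+z. ennreal ((frob d (hebb (Suc n) z))\<^sup>2) \<partial>gpairs (Suc n) d)
        = (\<integral>\<^sup>+z. \<integral>\<^sup>+u. \<integral>\<^sup>+v. ennreal ((frob d (\<lambda>p q. hebb n z p q + u p * v q))\<^sup>2) \<partial>gvec d \<partial>gvec d \<partial>gpairs n d)"
      by (subst nn_integral_gpairs_Suc[OF d]) (simp_all add: hebb_Suc_update)
    also have "\<dots> \<le> (\<integral>\<^sup>+z. ennreal ((frob d (hebb n z))\<^sup>2) + (ennreal ?a * ennreal (frob d (hebb n z)) + 18) \<partial>gpairs n d)"
    proof (intro nn_integral_mono order_trans[OF nn_integral_frob_update(2)[OF d]])
      fix z
      show "ennreal ((frob d (hebb n z))\<^sup>2 + ?a * frob d (hebb n z) + 18)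
          \<le> ennreal ((frob d (hebb n z))\<^sup>2) + (ennreal ?a * ennreal (frob d (hebb n z)) + 18)"
        by (simp add: ennreal_mult'[symmetric] ennreal_numeral[symmetric] ennreal_plus[symmetric] add.assoc del: ennreal_numeral ennreal_plus)
    qed
    also have "\<dots> = (\<integral>\<^sup>+z. ennreal ((frob d (hebb n z))\<^sup>2) \<partial>gpairs n d) + (ennreal ?a * ennreal (real n) + 18)"
      by (subst nn_integral_add, simp, simp, subst nn_integral_add, simp, simp, subst nn_integral_cmult)
        (simp_all add: Suc.IH(1) emeasure_space_1)
    also have "\<dots> \<le> ennreal ((real n)\<^sup>2 * (1 + 4 / (real d)\<^sup>2) + 18 * real n) + (ennreal ?a * ennreal (real n) + 18)"
      by (intro add_right_mono Suc.IH(2))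
    also have "\<dots> = ennreal ((real n)\<^sup>2 * (1 + 4 / (real d)\<^sup>2) + 18 * real n + (?a * real n + 18))"
      by (simp add: ennreal_mult'[symmetric] ennreal_numeral[symmetric] ennreal_plus[symmetric] del: ennreal_numeral ennreal_plus)
    also have "\<dots> \<le> ennreal ((real (Suc n))\<^sup>2 * (1 + 4 / (real d)\<^sup>2) + 18 * real (Suc n))"
      by (intro ennreal_leI) (simp add: power2_eq_square algebra_simps)
    finally show ?case .
  }
qed

text \<open>Chebyshev's inequality. A second moment is enough because this single event takes part
  in no union bound over the grid.\<close>

lemma frob_hebb_tail:
  assumes d: "0 < d" and n: "0 < n" and g: "1 < \<gamma>"
  shows "measure (gpairs n d) {z \<in> space (gpairs n d). \<gamma> * real n \<le> frob d (hebb n z)}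
     \<le> (4 / (real d)\<^sup>2 + 18 / real n) / (\<gamma> - 1)\<^sup>2"
proof -
  interpret prob_space "gpairs n d" using d by (rule prob_space_gpairs)
  let ?A = "{z \<in> space (gpairs n d). \<gamma> * real n \<le> frob d (hebb n z)}"
  let ?c = "((\<gamma> - 1) * real n)\<^sup>2"
  have A[measurable]: "?A \<in> events" by measurable
  \<comment> \<open>The pointwise Chebyshev bound on (Q - n)^2 with the negative term moved to the
    left, which avoids subtraction of extended nonnegative integrals.\<close>
  have pt: "ennreal ?c * indicator ?A z + ennreal (2 * real n) * ennreal (frob d (hebb n z))
     \<le> ennreal ((frob d (hebb n z))\<^sup>2) + ennreal ((real n)\<^sup>2)" for z
  proof -
    let ?Q = "frob d (hebb n z)"
    have "?c * indicator ?A z + 2 * real n * ?Q \<le> ?Q\<^sup>2 + (real n)\<^sup>2"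
    proof (cases "z \<in> ?A")
      case True
      moreover have "real n * 1 \<le> real n * \<gamma>" using g by (intro mult_left_mono) auto
      ultimately have "?c \<le> (?Q - real n)\<^sup>2" by (intro power_mono) (auto simp: algebra_simps)
      then show ?thesis using True by (simp add: power2_eq_square algebra_simps)
    next
      case False
      then show ?thesis using zero_le_power2[of "?Q - real n"] by (simp add: power2_eq_square algebra_simps)
    qed
    then have "ennreal (?c * indicator ?A z + 2 * real n * ?Q) \<le> ennreal (?Q\<^sup>2 + (real n)\<^sup>2)" by (rule ennreal_leI)
    then show ?thesis
      by (simp add: ennreal_plus ennreal_mult' ennreal_indicator[symmetric] del: ennreal_indicator)
  qed
  have "ennreal ?c * emeasure (gpairs n d) ?A + ennreal (2 * real n) * ennreal (real n)
      = (\<integral>\<^sup>+z. ennreal ?c * indicator ?A z + ennreal (2 * real n) * ennreal (frob d (hebb n z)) \<partial>gpairs n d)"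
    by (subst nn_integral_add, simp, simp, subst nn_integral_cmult_indicator, simp, subst nn_integral_cmult)
      (simp_all add: nn_integral_frob_hebb(1)[OF d])
  also have "\<dots> \<le> (\<integral>\<^sup>+z. ennreal ((frob d (hebb n z))\<^sup>2) + ennreal ((real n)\<^sup>2) \<partial>gpairs n d)"
    by (intro nn_integral_mono pt)
  also have "\<dots> = (\<integral>\<^sup>+z. ennreal ((frob d (hebb n z))\<^sup>2) \<partial>gpairs n d) + ennreal ((real n)\<^sup>2)"
    by (subst nn_integral_add) (simp_all add: emeasure_space_1)
  also have "\<dots> \<le> ennreal ((real n)\<^sup>2 * (1 + 4 / (real d)\<^sup>2) + 18 * real n) + ennreal ((real n)\<^sup>2)"
    by (intro add_right_mono nn_integral_frob_hebb(2) d)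
  finally have "ennreal (?c * prob ?A + 2 * real n * real n) \<le> ennreal ((real n)\<^sup>2 * (1 + 4 / (real d)\<^sup>2) + 18 * real n + (real n)\<^sup>2)"
    by (simp add: emeasure_eq_measure ennreal_plus ennreal_mult')
  then have "?c * prob ?A + 2 * real n * real n \<le> (real n)\<^sup>2 * (1 + 4 / (real d)\<^sup>2) + 18 * real n + (real n)\<^sup>2"
    by (subst (asm) ennreal_le_iff) (auto intro!: add_nonneg_nonneg)
  then have "(real n)\<^sup>2 * ((\<gamma> - 1)\<^sup>2 * prob ?A) \<le> (real n)\<^sup>2 * (4 / (real d)\<^sup>2 + 18 / real n)"
    using n by (simp add: power_mult_distrib power2_eq_square algebra_simps)
  then have "(\<gamma> - 1)\<^sup>2 * prob ?A \<le> 4 / (real d)\<^sup>2 + 18 / real n"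
    using n by (simp add: mult_le_cancel_left)
  then show ?thesis using g by (simp add: pos_le_divide_eq mult.commute)
qed

section \<open>Uniform bounds over directions\<close>

text \<open>A lattice of mesh 1/K in the cube [-1, 1]^d in place of a minimal net of the sphere: it
  is easy to count, and K polynomial in n costs only a factor ln n in the exponent.
  \<open>PiE\<close> makes it finite; values outside {..<d} are never read by
  \<open>dot\<close>.\<close>

definition grid :: "nat \<Rightarrow> nat \<Rightarrow> (nat \<Rightarrow> real) set" where
  "grid d K = (\<lambda>k p. real_of_int (k p) / real K) ` (\<Pi>\<^sub>E p\<in>{..<d}. {- int K..int K})"

lemma finite_grid: "finite (grid d K)"
  unfolding grid_def by (intro finite_imageI finite_PiE) auto

lemma card_grid: "card (grid d K) \<le> (2 * K + 1) ^ d"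
proof -
  have "card (grid d K) \<le> card (\<Pi>\<^sub>E p\<in>{..<d}. {- int K..int K})"
    unfolding grid_def by (intro card_image_le finite_PiE) auto
  also have "\<dots> = (2 * K + 1) ^ d"
    by (simp add: card_PiE nat_add_distrib nat_mult_distrib)
  finally show ?thesis .
qed

lemma dot_Cauchy_Schwarz: "dot d a b \<le> sqrt (dot d a a) * sqrt (dot d b b)"
proof -
  have "(dot d a b)\<^sup>2 \<le> dot d a a * dot d b b"
    using Cauchy_Schwarz_ineq_sum[of a b "{..<d}"] by (simp add: dot_def power2_eq_square)
  then have "\<bar>dot d a b\<bar> \<le> sqrt (dot d a a * dot d b b)"
    by (simp add: real_le_rsqrt)
  then show ?thesis by (simp add: real_sqrt_mult)
qed

text \<open>Every coordinate is rounded down, so y need not be a unit vector. Its length is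
  controlled by applying the approximation to w = x and then Cauchy-Schwarz.\<close>

lemma grid_approx:
  assumes K: "0 < K" and x: "dot d x x = 1"
  obtains y where "y \<in> grid d K" "1 - real d / real K \<le> sqrt (dot d y y)"
    "\<And>w. \<bar>dot d x w - dot d y w\<bar> \<le> (\<Sum>p<d. \<bar>w p\<bar>) / real K"
proof -
  define k where "k = (\<lambda>p\<in>{..<d}. \<lfloor>real K * x p\<rfloor>)"
  define y where "y p = real_of_int (k p) / real K" for p
  have x1: "\<bar>x p\<bar> \<le> 1" if "p < d" for p
  proof -
    have "(x p)\<^sup>2 \<le> dot d x x"
      unfolding dot_def using that by (auto simp: power2_eq_square intro!: member_le_sum)
    then show ?thesis using x by (simp add: abs_square_le_1)
  qed
  have xy: "\<bar>x p - y p\<bar> \<le> 1 / real K" if "p < d" for p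
  proof -
    have "x p - y p = (real K * x p - real_of_int \<lfloor>real K * x p\<rfloor>) / real K"
      using that K by (simp add: y_def k_def field_simps)
    moreover have "\<bar>real K * x p - real_of_int \<lfloor>real K * x p\<rfloor>\<bar> \<le> 1" by linarith
    ultimately show ?thesis using K by (simp add: abs_divide divide_right_mono)
  qed
  have diff: "\<bar>dot d x w - dot d y w\<bar> \<le> (\<Sum>p<d. \<bar>w p\<bar>) / real K" for w
  proof -
    have "dot d x w - dot d y w = (\<Sum>p<d. (x p - y p) * w p)"
      by (simp add: dot_def algebra_simps sum_subtractf)
    also have "\<bar>\<dots>\<bar> \<le> (\<Sum>p<d. \<bar>(x p - y p) * w p\<bar>)" by (rule sum_abs)
    also have "\<dots> \<le> (\<Sum>p<d. 1 / real K * \<bar>w p\<bar>)"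
      unfolding abs_mult by (intro sum_mono mult_right_mono xy) auto
    finally show ?thesis by (simp add: sum_divide_distrib)
  qed
  have "k \<in> (\<Pi>\<^sub>E p\<in>{..<d}. {- int K..int K})"
  proof (rule PiE_I)
    fix p assume p: "p \<in> {..<d}"
    then have "\<bar>real K * x p\<bar> \<le> real K * 1"
      unfolding abs_mult using x1 by (intro mult_mono) auto
    then have "- real K \<le> real K * x p" "real K * x p \<le> real K" by (auto simp: abs_le_iff)
    then have "- int K \<le> \<lfloor>real K * x p\<rfloor>" "\<lfloor>real K * x p\<rfloor> \<le> int K" by (auto simp: le_floor_iff floor_le_iff)
    then show "k p \<in> {- int K..int K}" using p by (simp add: k_def)
  qed (simp add: k_def)
  then have "y \<in> grid d K" unfolding grid_def y_def by (rule image_eqI[rotated]) (simp add: y_def fun_eq_iff)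
  moreover have "1 - real d / real K \<le> sqrt (dot d y y)"
  proof -
    have "(\<Sum>p<d. \<bar>x p\<bar>) \<le> (\<Sum>p<d. 1)" using x1 by (intro sum_mono) auto
    then have "(\<Sum>p<d. \<bar>x p\<bar>) / real K \<le> real d / real K" by (simp add: divide_right_mono)
    then have "1 - real d / real K \<le> dot d y x" using diff[of x] x by linarith
    also have "\<dots> \<le> sqrt (dot d y y)" using dot_Cauchy_Schwarz[of d y x] x by simp
    finally show ?thesis .
  qed
  ultimately show ?thesis using that diff by blast
qed

text \<open>The l1-norm of the whole sample: one Lipschitz constant for both uniform bounds,
  controlled by a first moment alone.\<close>

definition coord_mass :: "nat \<Rightarrow> nat \<Rightarrow> (nat \<Rightarrow> (nat \<Rightarrow> real) \<times> (nat \<Rightarrow> real)) \<Rightarrow> real" where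
  "coord_mass n d z = (\<Sum>j<n. \<Sum>p<d. \<bar>fst (z j) p\<bar> + \<bar>snd (z j) p\<bar>)"

lemma normalize_dot:
  assumes "dot d x x \<noteq> 0"
  shows "dot d (\<lambda>p. x p / sqrt (dot d x x)) (\<lambda>p. x p / sqrt (dot d x x)) = 1"
    "dot d (\<lambda>p. x p / sqrt (dot d x x)) w = dot d x w / sqrt (dot d x x)"
proof -
  show 1: "dot d (\<lambda>p. x p / sqrt (dot d x x)) w = dot d x w / sqrt (dot d x x)" for w
    by (simp add: dot_def sum_divide_distrib)
  have "dot d (\<lambda>p. x p / sqrt (dot d x x)) (\<lambda>p. x p / sqrt (dot d x x)) = dot d x x / sqrt (dot d x x) / sqrt (dot d x x)"
    unfolding 1 by (subst dot_commute) (simp add: 1)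
  also have "\<dots> = 1" using assms dot_self_nonneg[of d x] by (simp add: divide_divide_eq_left)
  finally show "dot d (\<lambda>p. x p / sqrt (dot d x x)) (\<lambda>p. x p / sqrt (dot d x x)) = 1" .
qed

lemma dot_self_0: "dot d x x = 0 \<Longrightarrow> dot d x w = 0"
proof -
  assume "dot d x x = 0"
  then have "\<forall>p\<in>{..<d}. x p * x p = 0" unfolding dot_def by (subst (asm) sum_nonneg_eq_0_iff) auto
  then show ?thesis by (simp add: dot_def)
qed

text \<open>Both sides scale with x, so it suffices to round a unit vector to the grid. The factor 1
  - d/K pays for the shorter length of y, and B/K for the change of the inner product.\<close>

lemma support_lower_bound:
  assumes K: "0 < K" "d < K" and n: "0 < n" and t: "0 \<le> t" and B: "coord_mass n d z \<le> B"
    and net: "\<And>y. y \<in> grid d K \<Longrightarrow> 0 < dot d y y \<Longrightarrow> \<exists>j<n. t * sqrt (dot d y y) \<le> dot d y (fst (z j))"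
  shows "\<exists>j<n. (t * (1 - real d / real K) - B / real K) * sqrt (dot d x x) \<le> dot d x (fst (z j))"
proof (cases "dot d x x = 0")
  case True
  then show ?thesis using n dot_self_0[OF True] by auto
next
  case False
  let ?x = "\<lambda>p. x p / sqrt (dot d x x)"
  have pos: "0 < sqrt (dot d x x)" using False dot_self_nonneg[of d x] by (simp del: dot_self_nonneg)
  obtain y where y: "y \<in> grid d K" "1 - real d / real K \<le> sqrt (dot d y y)"
    "\<And>w. \<bar>dot d ?x w - dot d y w\<bar> \<le> (\<Sum>p<d. \<bar>w p\<bar>) / real K"
    using grid_approx[OF K(1) normalize_dot(1)[OF False]] by blast
  have "0 < 1 - real d / real K" using K by simp
  then have "0 < sqrt (dot d y y)" using y(2) by linarith
  then obtain j where j: "j < n" "t * sqrt (dot d y y) \<le> dot d y (fst (z j))" using net y(1) by auto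
  have "(\<Sum>p<d. \<bar>fst (z j) p\<bar>) \<le> (\<Sum>p<d. \<bar>fst (z j) p\<bar> + \<bar>snd (z j) p\<bar>)" by (intro sum_mono) auto
  also have "\<dots> \<le> coord_mass n d z" unfolding coord_mass_def
    using j(1) by (intro member_le_sum sum_nonneg) auto
  finally have "(\<Sum>p<d. \<bar>fst (z j) p\<bar>) / real K \<le> B / real K" using B K by (intro divide_right_mono) auto
  then have "dot d y (fst (z j)) - B / real K \<le> dot d ?x (fst (z j))" using y(3)[of "fst (z j)"] by linarith
  moreover have "t * (1 - real d / real K) \<le> t * sqrt (dot d y y)" using y(2) t by (rule mult_left_mono)
  ultimately have "t * (1 - real d / real K) - B / real K \<le> dot d x (fst (z j)) / sqrt (dot d x x)"
    using j(2) unfolding normalize_dot(2)[OF False] by linarith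
  then show ?thesis using j(1) pos by (auto simp: pos_le_divide_eq)
qed

text \<open>The same rounding, except that all n inner products change at once; this is why
  \<open>coord_mass\<close> sums over the whole sample.\<close>

lemma abs_sum_lower_bound:
  assumes K: "0 < K" "d < K" and t: "0 \<le> t" and B: "coord_mass n d z \<le> B"
    and net: "\<And>y. y \<in> grid d K \<Longrightarrow> 0 < dot d y y \<Longrightarrow> t * sqrt (dot d y y) \<le> (\<Sum>i<n. \<bar>dot d y (snd (z i))\<bar>)"
  shows "(t * (1 - real d / real K) - B / real K) * sqrt (dot d x x) \<le> (\<Sum>i<n. \<bar>dot d x (snd (z i))\<bar>)"
proof (cases "dot d x x = 0")
  case True
  then show ?thesis by (simp add: sum_nonneg)
next
  case False
  let ?x = "\<lambda>p. x p / sqrt (dot d x x)"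
  have pos: "0 < sqrt (dot d x x)" using False dot_self_nonneg[of d x] by (simp del: dot_self_nonneg)
  obtain y where y: "y \<in> grid d K" "1 - real d / real K \<le> sqrt (dot d y y)"
    "\<And>w. \<bar>dot d ?x w - dot d y w\<bar> \<le> (\<Sum>p<d. \<bar>w p\<bar>) / real K"
    using grid_approx[OF K(1) normalize_dot(1)[OF False]] by blast
  have "0 < 1 - real d / real K" using K by simp
  then have "0 < sqrt (dot d y y)" using y(2) by linarith
  then have N: "t * sqrt (dot d y y) \<le> (\<Sum>i<n. \<bar>dot d y (snd (z i))\<bar>)" using net y(1) by auto
  have "(\<Sum>i<n. \<bar>dot d y (snd (z i))\<bar>) \<le> (\<Sum>i<n. \<bar>dot d ?x (snd (z i))\<bar> + (\<Sum>p<d. \<bar>snd (z i) p\<bar>) / real K)"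
  proof (rule sum_mono)
    fix i show "\<bar>dot d y (snd (z i))\<bar> \<le> \<bar>dot d ?x (snd (z i))\<bar> + (\<Sum>p<d. \<bar>snd (z i) p\<bar>) / real K"
      using y(3)[of "snd (z i)"] by linarith
  qed
  also have "\<dots> = (\<Sum>i<n. \<bar>dot d ?x (snd (z i))\<bar>) + (\<Sum>i<n. \<Sum>p<d. \<bar>snd (z i) p\<bar>) / real K"
    by (simp add: sum.distrib sum_divide_distrib)
  also have "(\<Sum>i<n. \<Sum>p<d. \<bar>snd (z i) p\<bar>) / real K \<le> B / real K"
  proof (intro divide_right_mono)
    have "(\<Sum>i<n. \<Sum>p<d. \<bar>snd (z i) p\<bar>) \<le> coord_mass n d z"
      unfolding coord_mass_def by (intro sum_mono) auto
    then show "(\<Sum>i<n. \<Sum>p<d. \<bar>snd (z i) p\<bar>) \<le> B" using B by simp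
  qed simp
  finally have "(\<Sum>i<n. \<bar>dot d y (snd (z i))\<bar>) \<le> (\<Sum>i<n. \<bar>dot d ?x (snd (z i))\<bar>) + B / real K" by simp
  moreover have "t * (1 - real d / real K) \<le> t * sqrt (dot d y y)" using y(2) t by (rule mult_left_mono)
  moreover have "(\<Sum>i<n. \<bar>dot d ?x (snd (z i))\<bar>) = (\<Sum>i<n. \<bar>dot d x (snd (z i))\<bar>) / sqrt (dot d x x)"
    unfolding normalize_dot(2)[OF False] abs_divide sum_divide_distrib using pos by simp
  ultimately have "t * (1 - real d / real K) - B / real K \<le> (\<Sum>i<n. \<bar>dot d x (snd (z i))\<bar>) / sqrt (dot d x x)"
    using N by linarith
  then show ?thesis using pos by (simp add: pos_le_divide_eq)
qed

section \<open>Tail bounds for a single direction\<close>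

lemma nn_integral_gpairs_prod:
  assumes d: "0 < d" and f: "f \<in> borel_measurable (gvec d)" and pr: "pr = fst \<or> pr = snd"
  shows "(\<integral>\<^sup>+z. (\<Prod>j<n. f (pr (z j))) \<partial>gpairs n d) = (\<integral>\<^sup>+x. f x \<partial>gvec d) ^ n"
proof -
  interpret P: product_sigma_finite "\<lambda>_::nat. gvec d \<Otimes>\<^sub>M gvec d" using d by (rule product_sigma_finite_pairs)
  have "pr \<in> gvec d \<Otimes>\<^sub>M gvec d \<rightarrow>\<^sub>M gvec d" using pr by auto
  then have m: "(\<lambda>p. f (pr p)) \<in> borel_measurable (gvec d \<Otimes>\<^sub>M gvec d)" using f by (rule measurable_compose)
  have "(\<integral>\<^sup>+z. (\<Prod>j<n. f (pr (z j))) \<partial>gpairs n d) = (\<Prod>j<n. \<integral>\<^sup>+p. f (pr p) \<partial>(gvec d \<Otimes>\<^sub>M gvec d))"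
    unfolding gpairs_def by (rule P.product_nn_integral_prod[where f="\<lambda>_ p. f (pr p)"]) (use m in auto)
  then show ?thesis using nn_integral_gvec_pair_proj[OF d pr f] by simp
qed

text \<open>Independence of the u_j gives (1 - p)^n <= exp (- n p), with p the lower bound on the
  Gaussian tail. For t = q sqrt (ln n) one has n p = n^(1 - q^2/2 - o(1)).\<close>

lemma cap_tail:
  assumes d: "0 < d" and t: "0 \<le> t"
  shows "measure (gpairs n d) {z \<in> space (gpairs n d). \<forall>j<n. dot d y (fst (z j)) < t * sqrt (dot d y y / real d)}
    \<le> exp (- (real n * (exp (- (t + 1)\<^sup>2 / 2) / sqrt (2 * pi))))"
proof -
  interpret prob_space "gpairs n d" using d by (rule prob_space_gpairs)
  interpret S: prob_space stdN by (rule prob_space_stdN)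
  let ?s = "sqrt (dot d y y / real d)"
  let ?p = "exp (- (t + 1)\<^sup>2 / 2) / sqrt (2 * pi)"
  let ?A = "{z \<in> space (gpairs n d). \<forall>j<n. dot d y (fst (z j)) < t * ?s}"
  define g :: "real \<Rightarrow> ennreal" where "g = indicator {..<t * ?s}"
  have [measurable]: "g \<in> borel_measurable borel" unfolding g_def by measurable
  have A: "?A \<in> events"
  proof -
    have "{z \<in> space (gpairs n d). dot d y (fst (z j)) < t * ?s} \<in> events" if "j < n" for j
      by (rule borel_measurable_less[OF measurable_dot_left[OF measurable_gpairs_fst_snd(1)[OF that]] borel_measurable_const])
    then have "{z \<in> space (gpairs n d). \<forall>j\<in>{..<n}. dot d y (fst (z j)) < t * ?s} \<in> events"
      by (rule sets.sets_Collect_finite_All[OF _ finite_lessThan]) (simp only: lessThan_iff)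
    then show ?thesis by (simp only: Ball_def lessThan_iff)
  qed
  have "emeasure (gpairs n d) ?A = (\<integral>\<^sup>+z. indicator ?A z \<partial>gpairs n d)"
    by (rule nn_integral_indicator[OF A, symmetric])
  also have "\<dots> = (\<integral>\<^sup>+z. (\<Prod>j<n. g (dot d y (fst (z j)))) \<partial>gpairs n d)"
    by (intro nn_integral_cong) (auto simp: g_def indicator_def)
  also have "\<dots> = (\<integral>\<^sup>+x. g (dot d y x) \<partial>gvec d) ^ n"
    by (rule nn_integral_gpairs_prod[OF d, where f="\<lambda>x. g (dot d y x)" and pr=fst]) auto
  also have "(\<integral>\<^sup>+x. g (dot d y x) \<partial>gvec d) = (\<integral>\<^sup>+x. g (?s * x) \<partial>stdN)"
    by (rule nn_integral_dot_gvec[OF d]) simp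
  \<comment> \<open>An inequality covers the case of y of length zero too, where the left integrand
    vanishes.\<close>
  also have "\<dots> \<le> (\<integral>\<^sup>+x. indicator {..<t} x \<partial>stdN)"
  proof (intro nn_integral_mono)
    fix x
    have "x < t" if "?s * x < t * ?s"
    proof (rule ccontr)
      assume "\<not> x < t"
      then have "?s * t \<le> ?s * x" by (intro mult_left_mono) auto
      then show False using that by (simp add: mult.commute)
    qed
    then show "g (?s * x) \<le> indicator {..<t} x" unfolding g_def by (auto split: split_indicator)
  qed
  also have "\<dots> = emeasure stdN {..<t}" by simp
  also have "\<dots> \<le> ennreal (exp (- ?p))"
  proof -
    have "ennreal ?p \<le> ennreal (S.prob {t..})"
      using emeasure_stdN_tail[OF t] by (simp add: S.emeasure_eq_measure)
    then have "?p \<le> S.prob {t..}" by (subst (asm) ennreal_le_iff) auto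
    moreover have "S.prob {..<t} = 1 - S.prob {t..}"
    proof -
      have "{..<t} = space stdN - {t..}" by auto
      then show ?thesis by (simp add: S.prob_compl del: space_density)
    qed
    moreover have "1 - ?p \<le> exp (- ?p)" using exp_ge_add_one_self[of "- ?p"] by linarith
    ultimately show ?thesis unfolding S.emeasure_eq_measure by (intro ennreal_leI) linarith
  qed
  finally have "emeasure (gpairs n d) ?A \<le> ennreal (exp (- ?p)) ^ n" by (simp add: power_mono_ennreal)
  also have "\<dots> = ennreal (exp (- (real n * ?p)))"
    by (simp add: ennreal_power exp_of_nat_mult[symmetric])
  finally show ?thesis by (simp add: emeasure_eq_measure)
qed

text \<open>For fixed \<beta> below the mean sqrt (2/pi) the rate is linear in n, far above the
  order d ln n of the logarithm of the grid size.\<close>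

lemma abs_sum_tail:
  assumes d: "0 < d" and y: "0 < dot d y y" and \<beta>: "\<beta> \<le> sqrt (2 / pi)"
  shows "measure (gpairs n d) {z \<in> space (gpairs n d). (\<Sum>i<n. \<bar>dot d y (snd (z i))\<bar>) \<le> \<beta> * real n * sqrt (dot d y y / real d)}
    \<le> exp (- (real n * ((sqrt (2 / pi) - \<beta>)\<^sup>2 / 2)))"
proof -
  interpret prob_space "gpairs n d" using d by (rule prob_space_gpairs)
  let ?s = "sqrt (dot d y y / real d)"
  \<comment> \<open>The Chernoff parameter that minimises l \<beta> + l^2/2 - l sqrt (2/pi); the
    minimum is -l^2/2.\<close>
  define l where "l = sqrt (2 / pi) - \<beta>"
  have l: "0 \<le> l" using \<beta> by (simp add: l_def)
  have s: "0 < ?s" using y d by simp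
  let ?X = "\<lambda>z. - (l / ?s) * (\<Sum>i<n. \<bar>dot d y (snd (z i))\<bar>)"
  have m: "?X \<in> borel_measurable (gpairs n d)"
    by (intro borel_measurable_times borel_measurable_const borel_measurable_sum borel_measurable_abs measurable_dot_left measurable_gpairs_fst_snd) auto
  have "(\<integral>\<^sup>+z. ennreal (exp (?X z)) \<partial>gpairs n d)
      = (\<integral>\<^sup>+z. (\<Prod>i<n. ennreal (exp (- (l / ?s) * \<bar>dot d y (snd (z i))\<bar>))) \<partial>gpairs n d)"
    by (simp add: sum_distrib_left exp_sum prod_ennreal)
  also have "\<dots> = (\<integral>\<^sup>+x. ennreal (exp (- (l / ?s) * \<bar>dot d y x\<bar>)) \<partial>gvec d) ^ n"
    by (rule nn_integral_gpairs_prod[OF d, where f="\<lambda>x. ennreal (exp (- (l / ?s) * \<bar>dot d y x\<bar>))" and pr=snd]) auto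
  also have "(\<integral>\<^sup>+x. ennreal (exp (- (l / ?s) * \<bar>dot d y x\<bar>)) \<partial>gvec d) = (\<integral>\<^sup>+x. ennreal (exp (- l * \<bar>x\<bar>)) \<partial>stdN)"
    using y d by (subst nn_integral_dot_gvec[OF d, where f="\<lambda>x. ennreal (exp (- (l / ?s) * \<bar>x\<bar>))"]) (auto simp: abs_mult)
  also have "\<dots> \<le> ennreal (exp (l\<^sup>2 / 2 - l * sqrt (2 / pi)))"
    by (rule nn_integral_stdN_exp_abs[OF l])
  finally have "(\<integral>\<^sup>+z. ennreal (exp (?X z)) \<partial>gpairs n d) \<le> ennreal (exp (l\<^sup>2 / 2 - l * sqrt (2 / pi))) ^ n"
    by (simp add: power_mono_ennreal)
  also have "\<dots> = ennreal (exp (real n * (l\<^sup>2 / 2 - l * sqrt (2 / pi))))"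
    by (simp add: ennreal_power exp_of_nat_mult[symmetric])
  finally have "prob {z \<in> space (gpairs n d). - (l * \<beta> * real n) \<le> ?X z}
      \<le> exp (- (- (l * \<beta> * real n))) * exp (real n * (l\<^sup>2 / 2 - l * sqrt (2 / pi)))"
    by (intro chernoff m) auto
  also have "\<dots> = exp (- (real n * (l\<^sup>2 / 2)))"
    by (simp add: exp_add[symmetric] l_def power2_eq_square algebra_simps)
  finally have le: "prob {z \<in> space (gpairs n d). - (l * \<beta> * real n) \<le> ?X z} \<le> exp (- (real n * (l\<^sup>2 / 2)))" .
  have "prob {z \<in> space (gpairs n d). (\<Sum>i<n. \<bar>dot d y (snd (z i))\<bar>) \<le> \<beta> * real n * ?s}
      \<le> prob {z \<in> space (gpairs n d). - (l * \<beta> * real n) \<le> ?X z}"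
  proof (intro finite_measure_mono subsetI)
    fix z assume z: "z \<in> {z \<in> space (gpairs n d). (\<Sum>i<n. \<bar>dot d y (snd (z i))\<bar>) \<le> \<beta> * real n * ?s}"
    then have "l / ?s * (\<Sum>i<n. \<bar>dot d y (snd (z i))\<bar>) \<le> l / ?s * (\<beta> * real n * ?s)"
      using l s by (intro mult_left_mono) auto
    also have "\<dots> = l * \<beta> * real n" using y d by (simp add: field_simps)
    finally show "z \<in> {z \<in> space (gpairs n d). - (l * \<beta> * real n) \<le> ?X z}" using z by simp
  next
    show "{z \<in> space (gpairs n d). - (l * \<beta> * real n) \<le> ?X z} \<in> events" using m by measurable
  qed
  then show ?thesis using le by (simp add: l_def)
qed

lemma measurable_coord_mass: "coord_mass n d \<in> borel_measurable (gpairs n d)"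
  unfolding coord_mass_def[abs_def]
  by (intro borel_measurable_sum borel_measurable_add borel_measurable_abs
      measurable_compose[OF measurable_gpairs_fst_snd(1) measurable_gvec_coord]
      measurable_compose[OF measurable_gpairs_fst_snd(2) measurable_gvec_coord]) auto

text \<open>Markov's inequality, each coordinate having absolute mean at most 1. Such a weak bound
  suffices because a large B is compensated by a finer grid.\<close>

lemma coord_mass_tail:
  assumes d: "0 < d" and B: "0 < B"
  shows "measure (gpairs n d) {z \<in> space (gpairs n d). B \<le> coord_mass n d z} \<le> 2 * real n * real d / B"
proof -
  interpret prob_space "gpairs n d" using d by (rule prob_space_gpairs)
  let ?A = "{z \<in> space (gpairs n d). B \<le> coord_mass n d z}"
  note [measurable] = measurable_coord_mass
  have A: "?A \<in> events" by measurable
  have E: "(\<integral>\<^sup>+z. ennreal \<bar>pr (z j) p\<bar> \<partial>gpairs n d) \<le> 1" if "j < n" "p < d" "pr = fst \<or> pr = snd" for j p pr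
  proof -
    note [measurable] = measurable_gvec_coord[OF that(2)]
    have "pr \<in> gvec d \<Otimes>\<^sub>M gvec d \<rightarrow>\<^sub>M gvec d" using that(3) by auto
    then have m: "(\<lambda>w. ennreal \<bar>pr w p\<bar>) \<in> borel_measurable (gvec d \<Otimes>\<^sub>M gvec d)"
      by (rule measurable_compose[where g="\<lambda>x. ennreal \<bar>x p\<bar>"]) measurable
    have "(\<integral>\<^sup>+z. ennreal \<bar>pr (z j) p\<bar> \<partial>gpairs n d) = (\<integral>\<^sup>+x. ennreal \<bar>x p\<bar> \<partial>gvec d)"
      using nn_integral_gpairs_component[OF d that(1) m]
        nn_integral_gvec_pair_proj[OF d that(3), of "\<lambda>x. ennreal \<bar>x p\<bar>"] by simp
    also have "\<dots> = ennreal (\<integral>x. \<bar>x p\<bar> \<partial>gvec d)"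
      using gvec_coord_moments(4)[OF d that(2)] by (intro nn_integral_eq_integral) auto
    also have "\<dots> \<le> 1" using gvec_coord_moments(5)[OF d that(2)] by simp
    finally show ?thesis .
  qed
  have mc: "(\<lambda>z. ennreal \<bar>fst (z j) p\<bar>) \<in> borel_measurable (gpairs n d)"
    "(\<lambda>z. ennreal \<bar>snd (z j) p\<bar>) \<in> borel_measurable (gpairs n d)" if "j < n" "p < d" for j p
    using measurable_compose[OF measurable_gpairs_fst_snd(1)[OF that(1)] measurable_gvec_coord[OF that(2)]]
      measurable_compose[OF measurable_gpairs_fst_snd(2)[OF that(1)] measurable_gvec_coord[OF that(2)]] by auto
  have "ennreal B * emeasure (gpairs n d) ?A = (\<integral>\<^sup>+z. ennreal B * indicator ?A z \<partial>gpairs n d)"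
    using A by (simp add: nn_integral_cmult_indicator)
  also have "\<dots> \<le> (\<integral>\<^sup>+z. ennreal (coord_mass n d z) \<partial>gpairs n d)"
    by (intro nn_integral_mono) (auto split: split_indicator intro!: ennreal_leI)
  also have "\<dots> = (\<integral>\<^sup>+z. (\<Sum>j<n. \<Sum>p<d. ennreal \<bar>fst (z j) p\<bar> + ennreal \<bar>snd (z j) p\<bar>) \<partial>gpairs n d)"
    unfolding coord_mass_def by (simp add: sum_ennreal[symmetric] sum_nonneg ennreal_plus)
  also have "\<dots> = (\<Sum>j<n. \<Sum>p<d. (\<integral>\<^sup>+z. ennreal \<bar>fst (z j) p\<bar> \<partial>gpairs n d) + (\<integral>\<^sup>+z. ennreal \<bar>snd (z j) p\<bar> \<partial>gpairs n d))"
    by (subst nn_integral_sum, use mc in simp, intro sum.cong refl, subst nn_integral_sum, use mc in simp,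
        intro sum.cong refl nn_integral_add) (use mc in auto)
  also have "\<dots> \<le> (\<Sum>j<n. \<Sum>p<d. 1 + 1)"
    by (intro sum_mono add_mono E) auto
  also have "\<dots> = ennreal (2 * real n * real d)"
    by (simp add: ennreal_mult' ennreal_of_nat_eq_real_of_nat mult_ac)
  finally have "ennreal (B * prob ?A) \<le> ennreal (2 * real n * real d)"
    using B by (simp add: emeasure_eq_measure ennreal_mult')
  then have "B * prob ?A \<le> 2 * real n * real d" by (subst (asm) ennreal_le_iff) auto
  then show ?thesis using B by (simp add: field_simps)
qed

section \<open>The converse\<close>

lemma bilin_eq_dot: "bilin d a W b = dot d (\<lambda>p. dot d (W p) b) a"
  by (simp add: bilin_def dot_def sum_distrib_left mult_ac)

text \<open>Purely deterministic: \<open>A\<close> is applied to the vectors W v_i, \<open>B\<close>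
  to the rows of W, and the norm of W cancels in the end, so the conclusion concerns the sample
  alone.\<close>

lemma retrieves_obstruction:
  assumes W: "retrieves n d W z" and n: "2 \<le> n" and a: "0 < a" and b: "0 < b"
    and A: "\<And>x. \<exists>j<n. a * sqrt (dot d x x) \<le> dot d x (fst (z j))"
    and B: "\<And>x. b * sqrt (dot d x x) \<le> (\<Sum>i<n. \<bar>dot d x (snd (z i))\<bar>)"
  shows "(a * b)\<^sup>2 \<le> frob d (hebb n z)"
proof -
  define y where "y i = (\<lambda>p. dot d (W p) (snd (z i)))" for i
  define w where "w = sqrt (frob d W)"
  define r where "r p = sqrt (dot d (W p) (W p))" for p
  have bil: "bilin d (fst (z j)) W (snd (z i)) = dot d (y i) (fst (z j))" for i j
    by (simp add: bilin_eq_dot y_def)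
  have w2: "w\<^sup>2 = (\<Sum>p<d. (r p)\<^sup>2)"
    unfolding w_def r_def by (simp add: real_sqrt_pow2) (simp add: frob_def dot_def power2_eq_square)
  have w0: "0 \<le> w" by (simp add: w_def)
  \<comment> \<open>Strict retrieval between the pairs 0 and 1 excludes W = 0; this is where n >= 2
    enters. The factor w is cancelled below.\<close>
  have wpos: "0 < w"
  proof (rule ccontr)
    assume "\<not> 0 < w"
    then have "frob d W = 0" using frob_nonneg[of d W] by (simp add: w_def not_less)
    then have "\<forall>p\<in>{..<d}. \<forall>q\<in>{..<d}. W p q = 0"
      unfolding frob_def by (simp add: sum_nonneg_eq_0_iff sum_nonneg)
    then have "bilin d u W v = 0" for u v by (simp add: bilin_def)
    moreover have "bilin d (fst (z 1)) W (snd (z 0)) < bilin d (fst (z 0)) W (snd (z 0))"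
      using W n by (auto simp: retrieves_def)
    ultimately show False by simp
  qed
  have step1: "a * sqrt (dot d (y i) (y i)) \<le> bilin d (fst (z i)) W (snd (z i))" if i: "i < n" for i
  proof -
    obtain j where j: "j < n" "a * sqrt (dot d (y i) (y i)) \<le> dot d (y i) (fst (z j))" using A by blast
    have "dot d (y i) (fst (z j)) \<le> dot d (y i) (fst (z i))"
      using W i j(1) by (cases "j = i") (auto simp: retrieves_def bil intro: less_imp_le)
    then show ?thesis using j(2) by (simp add: bil)
  qed
  \<comment> \<open>Rows are weighted by their lengths \<open>r p\<close>, so that applying
    \<open>B\<close> row by row restores the full squared norm of W.\<close>
  have step2: "(\<Sum>p<d. r p * \<bar>dot d (W p) (snd (z i))\<bar>) \<le> w * sqrt (dot d (y i) (y i))" for i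
  proof -
    have "(\<Sum>p<d. r p * \<bar>dot d (W p) (snd (z i))\<bar>) \<le> sqrt (dot d r r) * sqrt (dot d (\<lambda>p. \<bar>y i p\<bar>) (\<lambda>p. \<bar>y i p\<bar>))"
      using dot_Cauchy_Schwarz[of d r "\<lambda>p. \<bar>y i p\<bar>"] by (simp add: dot_def y_def)
    also have "dot d r r = w\<^sup>2" unfolding w2 by (simp add: dot_def power2_eq_square)
    also have "dot d (\<lambda>p. \<bar>y i p\<bar>) (\<lambda>p. \<bar>y i p\<bar>) = dot d (y i) (y i)" by (simp add: dot_def)
    finally show ?thesis using w0 by simp
  qed
  have "b * w\<^sup>2 = (\<Sum>p<d. r p * (b * r p))"
    unfolding w2 by (simp add: sum_distrib_left power2_eq_square mult_ac)
  also have "\<dots> \<le> (\<Sum>p<d. r p * (\<Sum>i<n. \<bar>dot d (W p) (snd (z i))\<bar>))"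
    unfolding r_def by (intro sum_mono mult_left_mono B) auto
  also have "\<dots> = (\<Sum>i<n. \<Sum>p<d. r p * \<bar>dot d (W p) (snd (z i))\<bar>)"
    unfolding sum_distrib_left by (rule sum.swap)
  also have "\<dots> \<le> (\<Sum>i<n. w * sqrt (dot d (y i) (y i)))"
    by (intro sum_mono step2)
  finally have "w * (b * w) \<le> w * (\<Sum>i<n. sqrt (dot d (y i) (y i)))"
    by (simp add: sum_distrib_left power2_eq_square mult_ac)
  then have "b * w \<le> (\<Sum>i<n. sqrt (dot d (y i) (y i)))" using wpos by simp
  then have "a * (b * w) \<le> a * (\<Sum>i<n. sqrt (dot d (y i) (y i)))" using a by simp
  also have "\<dots> = (\<Sum>i<n. a * sqrt (dot d (y i) (y i)))" by (simp add: sum_distrib_left)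
  also have "\<dots> \<le> (\<Sum>i<n. bilin d (fst (z i)) W (snd (z i)))" by (intro sum_mono step1) auto
  also have "\<dots> = (\<Sum>p<d. \<Sum>q<d. W p q * hebb n z p q)"
  proof -
    have "(\<Sum>i<n. bilin d (fst (z i)) W (snd (z i))) = (\<Sum>p<d. \<Sum>i<n. \<Sum>q<d. W p q * (fst (z i) p * snd (z i) q))"
      unfolding bilin_def by (subst sum.swap) (simp add: mult_ac)
    also have "\<dots> = (\<Sum>p<d. \<Sum>q<d. W p q * hebb n z p q)"
      unfolding hebb_def sum_distrib_left by (intro sum.cong refl sum.swap)
    finally show ?thesis .
  qed
  also have "\<dots> \<le> (\<Sum>p<d. r p * sqrt (dot d (hebb n z p) (hebb n z p)))"
    unfolding r_def by (intro sum_mono order_trans[OF _ dot_Cauchy_Schwarz]) (simp add: dot_def)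
  also have "\<dots> \<le> sqrt (dot d r r) * sqrt (\<Sum>p<d. dot d (hebb n z p) (hebb n z p))"
  proof -
    define h where "h p = sqrt (dot d (hebb n z p) (hebb n z p))" for p
    have "(\<Sum>p<d. r p * h p) = dot d r h" by (simp add: dot_def)
    moreover have "(\<Sum>p<d. dot d (hebb n z p) (hebb n z p)) = dot d h h"
      unfolding dot_def[of d h h] by (simp add: h_def)
    ultimately show ?thesis using dot_Cauchy_Schwarz[of d r h] by (simp add: h_def)
  qed
  also have "\<dots> = w * sqrt (frob d (hebb n z))"
  proof -
    have "dot d r r = w\<^sup>2" unfolding w2 by (simp add: dot_def power2_eq_square)
    moreover have "(\<Sum>p<d. dot d (hebb n z p) (hebb n z p)) = frob d (hebb n z)"
      by (simp add: frob_def dot_def power2_eq_square)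
    ultimately show ?thesis using w0 by simp
  qed
  finally have "w * (a * b) \<le> w * sqrt (frob d (hebb n z))" by (simp add: mult_ac)
  then have "a * b \<le> sqrt (frob d (hebb n z))" using wpos by simp
  then have "(a * b)\<^sup>2 \<le> (sqrt (frob d (hebb n z)))\<^sup>2" using a b by (intro power_mono) auto
  then show ?thesis by simp
qed

text \<open>The terms subtracted in a and b are rounding errors for \<open>coord_mass\<close> at
  most n^2 d, a level exceeded with probability at most 2/n. If no exceptional event occurs,
  \<open>retrieves_obstruction\<close> forces \<open>frob\<close> up to \<gamma> n, which is itself
  improbable.\<close>

lemma PR_prob_upper:
  assumes d: "0 < d" and n: "2 \<le> n" and K: "d < K" and t: "0 \<le> t" and \<beta>: "0 \<le> \<beta>" "\<beta> \<le> sqrt (2 / pi)"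
    and \<gamma>: "1 < \<gamma>"
    and a: "a = t / sqrt (real d) * (1 - real d / real K) - (real n)\<^sup>2 * real d / real K" "0 < a"
    and b: "b = \<beta> * real n / sqrt (real d) * (1 - real d / real K) - (real n)\<^sup>2 * real d / real K" "0 < b"
    and ab: "\<gamma> * real n < (a * b)\<^sup>2"
  shows "PR_prob n d \<le> 2 / real n + real ((2 * K + 1) ^ d) *
      (exp (- (real n * (exp (- (t + 1)\<^sup>2 / 2) / sqrt (2 * pi)))) + exp (- (real n * ((sqrt (2 / pi) - \<beta>)\<^sup>2 / 2))))
      + (4 / (real d)\<^sup>2 + 18 / real n) / (\<gamma> - 1)\<^sup>2"
proof -
  interpret prob_space "gpairs n d" using d by (rule prob_space_gpairs)
  let ?S = "space (gpairs n d)"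
  let ?B = "(real n)\<^sup>2 * real d"
  \<comment> \<open>Grid points of length zero are left out: for them \<open>?A2\<close> would be
    the whole space.\<close>
  let ?G = "{y \<in> grid d K. 0 < dot d y y}"
  let ?s = "\<lambda>y. sqrt (dot d y y / real d)"
  let ?E = "{z \<in> ?S. \<exists>W. retrieves n d W z}"
  let ?D = "{z \<in> ?S. ?B \<le> coord_mass n d z}"
  let ?C = "{z \<in> ?S. \<gamma> * real n \<le> frob d (hebb n z)}"
  let ?A1 = "\<lambda>y. {z \<in> ?S. \<forall>j<n. dot d y (fst (z j)) < t * ?s y}"
  let ?A2 = "\<lambda>y. {z \<in> ?S. (\<Sum>i<n. \<bar>dot d y (snd (z i))\<bar>) \<le> \<beta> * real n * ?s y}"
  let ?p1 = "exp (- (real n * (exp (- (t + 1)\<^sup>2 / 2) / sqrt (2 * pi))))"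
  let ?p2 = "exp (- (real n * ((sqrt (2 / pi) - \<beta>)\<^sup>2 / 2)))"
  have fin: "finite ?G" using finite_grid by (rule finite_subset[rotated]) auto
  have D: "?D \<in> events" by (rule borel_measurable_le[OF borel_measurable_const measurable_coord_mass])
  have C: "?C \<in> events" by (rule borel_measurable_le[OF borel_measurable_const measurable_frob_hebb])
  have A1: "?A1 y \<in> events" for y
  proof -
    have "{z \<in> ?S. dot d y (fst (z j)) < t * ?s y} \<in> events" if "j < n" for j
      by (rule borel_measurable_less[OF measurable_dot_left[OF measurable_gpairs_fst_snd(1)[OF that]] borel_measurable_const])
    then have "{z \<in> ?S. \<forall>j\<in>{..<n}. dot d y (fst (z j)) < t * ?s y} \<in> events"
      by (rule sets.sets_Collect_finite_All[OF _ finite_lessThan]) (simp only: lessThan_iff)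
    then show ?thesis by (simp only: Ball_def lessThan_iff)
  qed
  have A2: "?A2 y \<in> events" for y
    by (rule borel_measurable_le[OF borel_measurable_sum borel_measurable_const])
      (auto intro!: borel_measurable_abs measurable_dot_left measurable_gpairs_fst_snd)
  have sub: "?E \<subseteq> ?D \<union> (\<Union>y\<in>?G. ?A1 y \<union> ?A2 y) \<union> ?C"
  proof
    fix z assume z: "z \<in> ?E"
    then obtain W where W: "retrieves n d W z" by auto
    show "z \<in> ?D \<union> (\<Union>y\<in>?G. ?A1 y \<union> ?A2 y) \<union> ?C"
    proof (rule ccontr)
      assume not: "z \<notin> ?D \<union> (\<Union>y\<in>?G. ?A1 y \<union> ?A2 y) \<union> ?C"
      have zS: "z \<in> ?S" using z by simp
      have mass: "coord_mass n d z \<le> ?B" using not zS by auto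
      have c1: "\<exists>j<n. t / sqrt (real d) * sqrt (dot d y y) \<le> dot d y (fst (z j))" if "y \<in> grid d K" "0 < dot d y y" for y
      proof -
        have "z \<notin> ?A1 y" using not that by auto
        then obtain j where "j < n" "\<not> dot d y (fst (z j)) < t * ?s y" using zS by auto
        then show ?thesis by (auto simp: real_sqrt_divide not_less)
      qed
      have c2: "\<beta> * real n / sqrt (real d) * sqrt (dot d y y) \<le> (\<Sum>i<n. \<bar>dot d y (snd (z i))\<bar>)" if "y \<in> grid d K" "0 < dot d y y" for y
      proof -
        have "z \<notin> ?A2 y" using not that by auto
        then have "\<not> (\<Sum>i<n. \<bar>dot d y (snd (z i))\<bar>) \<le> \<beta> * real n * ?s y" using zS by auto
        then show ?thesis by (simp add: real_sqrt_divide)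
      qed
      have K0: "0 < K" and n0: "0 < n" using K n by auto
      have u1: "\<exists>j<n. a * sqrt (dot d x x) \<le> dot d x (fst (z j))" for x
        unfolding a(1) by (rule support_lower_bound[OF K0 K n0 _ mass c1]) (use t in auto)
      have u2: "b * sqrt (dot d x x) \<le> (\<Sum>i<n. \<bar>dot d x (snd (z i))\<bar>)" for x
        unfolding b(1) by (rule abs_sum_lower_bound[OF K0 K _ mass c2]) (use \<beta> in auto)
      have "(a * b)\<^sup>2 \<le> frob d (hebb n z)"
        by (rule retrieves_obstruction[OF W n a(2) b(2) u1 u2])
      then have "\<gamma> * real n \<le> frob d (hebb n z)" using ab by linarith
      then show False using not zS by auto
    qed
  qed
  have "PR_prob n d = prob ?E" by (rule PR_prob_eq[OF d])
  also have "\<dots> \<le> prob (?D \<union> (\<Union>y\<in>?G. ?A1 y \<union> ?A2 y) \<union> ?C)"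
    by (intro finite_measure_mono sub sets.Un sets.finite_UN fin D C A1 A2)
  also have "\<dots> \<le> prob (?D \<union> (\<Union>y\<in>?G. ?A1 y \<union> ?A2 y)) + prob ?C"
    by (intro measure_Un_le sets.Un sets.finite_UN fin D C A1 A2)
  also have "prob (?D \<union> (\<Union>y\<in>?G. ?A1 y \<union> ?A2 y)) \<le> prob ?D + prob (\<Union>y\<in>?G. ?A1 y \<union> ?A2 y)"
    by (intro measure_Un_le sets.Un sets.finite_UN fin D C A1 A2)
  also have "prob (\<Union>y\<in>?G. ?A1 y \<union> ?A2 y) \<le> (\<Sum>y\<in>?G. prob (?A1 y \<union> ?A2 y))"
    by (intro measure_UNION_le sets.Un fin A1 A2)
  also have "\<dots> \<le> (\<Sum>y\<in>?G. ?p1 + ?p2)"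
  proof (rule sum_mono)
    fix y assume "y \<in> ?G"
    then have "prob (?A1 y) \<le> ?p1" "prob (?A2 y) \<le> ?p2"
      using cap_tail[OF d t] abs_sum_tail[OF d _ \<beta>(2)] by auto
    then show "prob (?A1 y \<union> ?A2 y) \<le> ?p1 + ?p2"
      using measure_Un_le[OF A1[of y] A2[of y]] by linarith
  qed
  also have "\<dots> \<le> real ((2 * K + 1) ^ d) * (?p1 + ?p2)"
  proof -
    have "card ?G \<le> card (grid d K)" by (intro card_mono finite_grid) auto
    also have "\<dots> \<le> (2 * K + 1) ^ d" by (rule card_grid)
    finally have "real (card ?G) \<le> real ((2 * K + 1) ^ d)" by (rule of_nat_mono)
    then show ?thesis by (simp only: sum_constant) (intro mult_right_mono add_nonneg_nonneg, auto)
  qed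
  also have "prob ?D \<le> 2 / real n"
    using coord_mass_tail[OF d, of ?B n] d n by (simp add: power2_eq_square field_simps)
  also have "prob ?C \<le> (4 / (real d)\<^sup>2 + 18 / real n) / (\<gamma> - 1)\<^sup>2"
    using n by (intro frob_hebb_tail d \<gamma>) auto
  finally show ?thesis by simp
qed

section \<open>Asymptotics below the threshold\<close>

lemma PR_prob_tendsto_0:
  fixes nn dd :: "nat \<Rightarrow> nat"
  assumes \<rho>: "0 < \<rho>" "\<rho> < 2 / pi" and nn: "filterlim nn at_top sequentially" and dd: "filterlim dd at_top sequentially"
    and le: "\<forall>k. real (dd k) ^ 2 \<le> \<rho> * real (nn k) * ln (real (nn k))"
  shows "(\<lambda>k. PR_prob (nn k) (dd k)) \<longlonglongrightarrow> 0"
proof -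
  define m where "m = sqrt (2 / pi)"
  have m: "0 < m" "m\<^sup>2 = 2 / pi" by (simp_all add: m_def)
  \<comment> \<open>The constants 1, sqrt (2/\<pi>) and 1 of the three estimates are relaxed to q^2, q^2 sqrt (2/\<pi>) and 1/q;
    the contradiction then needs q^9 > \<rho> \<pi> / 2.\<close>
  define q where "q = root 10 (\<rho> * pi / 2)"
  have q: "0 < q" "q < 1" and q10: "q ^ 10 = \<rho> * pi / 2"
    using \<rho> by (simp_all add: q_def field_simps)
  have q9: "\<rho> < q ^ 9 * (2 / pi)"
  proof -
    have "q ^ 9 * q < q ^ 9 * 1" using q by (intro mult_strict_left_mono) auto
    moreover have "q ^ 9 * q = \<rho> * pi / 2" using q10 by (simp add: eval_nat_numeral mult_ac)
    ultimately show ?thesis by (simp add: field_simps)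
  qed
  define \<gamma> where "\<gamma> = 1 / q"
  have \<gamma>: "1 < \<gamma>" using q by (simp add: \<gamma>_def)
  \<comment> \<open>The part of the bound that depends on n alone, with d replaced by sqrt (n ln n)
    in the grid size. The term with 4 / d^2 is kept apart, since here d has no lower bound in terms
    of n.\<close>
  define err where "err n = 2 / n + (exp (sqrt (n * ln n) * ln (2 * n ^ 4 + 1) - n * (exp (- (q * sqrt (ln n) + 1)\<^sup>2 / 2) / sqrt (2 * pi)))
     + exp (sqrt (n * ln n) * ln (2 * n ^ 4 + 1) - n * ((m - q * m)\<^sup>2 / 2))) + 18 / n / (\<gamma> - 1)\<^sup>2" for n :: real
  have "(err \<longlongrightarrow> 0) at_top"
  proof -
    have "((\<lambda>n. exp (sqrt (n * ln n) * ln (2 * n ^ 4 + 1) - n * (exp (- (q * sqrt (ln n) + 1)\<^sup>2 / 2) / c))) \<longlongrightarrow> 0) at_top"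
      if "0 < c" for c :: real
    proof -
      \<comment> \<open>The decisive comparison: the cap exponent n^(1 - q^2/2 - o(1)) outgrows the
        order sqrt (n ln n) * ln n of the grid because q < 1.\<close>
      have "q\<^sup>2 < 1" using q by (simp add: abs_square_less_1)
      then show ?thesis using q that by real_asymp
    qed
    then have 1: "((\<lambda>n. exp (sqrt (n * ln n) * ln (2 * n ^ 4 + 1) - n * (exp (- (q * sqrt (ln n) + 1)\<^sup>2 / 2) / sqrt (2 * pi)))) \<longlongrightarrow> 0) at_top"
      by simp
    have "((\<lambda>n. exp (sqrt (n * ln n) * ln (2 * n ^ 4 + 1) - n * c)) \<longlongrightarrow> 0) at_top" if "0 < c" for c :: real
      using that by real_asymp
    moreover have "0 < (m - q * m)\<^sup>2 / 2" using q m(1) by simp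
    ultimately have 2: "((\<lambda>n. exp (sqrt (n * ln n) * ln (2 * n ^ 4 + 1) - n * ((m - q * m)\<^sup>2 / 2))) \<longlongrightarrow> 0) at_top"
      by blast
    have 3: "((\<lambda>n::real. 2 / n) \<longlongrightarrow> 0) at_top" "((\<lambda>n::real. 18 / n / (\<gamma> - 1)\<^sup>2) \<longlongrightarrow> 0 / (\<gamma> - 1)\<^sup>2) at_top"
      using \<gamma> by (real_asymp, intro tendsto_divide tendsto_const, real_asymp, simp)
    have "(err \<longlongrightarrow> 0 + (0 + 0) + 0 / (\<gamma> - 1)\<^sup>2) at_top" unfolding err_def
      by (intro tendsto_add 1 2 3)
    then show ?thesis by simp
  qed
  note nr = filterlim_compose[OF filterlim_real_sequentially nn]
  note dr = filterlim_compose[OF filterlim_real_sequentially dd]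
  have err0: "(\<lambda>k. err (real (nn k))) \<longlonglongrightarrow> 0"
    using \<open>(err \<longlongrightarrow> 0) at_top\<close> nr by (rule filterlim_compose)
  have "((\<lambda>x::real. 4 / x\<^sup>2) \<longlongrightarrow> 0) at_top" by real_asymp
  then have "(\<lambda>k. 4 / (real (dd k))\<^sup>2) \<longlonglongrightarrow> 0" using dr by (rule filterlim_compose)
  then have "(\<lambda>k. 4 / (real (dd k))\<^sup>2 / (\<gamma> - 1)\<^sup>2) \<longlonglongrightarrow> 0 / (\<gamma> - 1)\<^sup>2"
    using \<gamma> by (intro tendsto_divide tendsto_const) auto
  then have bound0: "(\<lambda>k. err (real (nn k)) + 4 / (real (dd k))\<^sup>2 / (\<gamma> - 1)\<^sup>2) \<longlonglongrightarrow> 0"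
    using tendsto_add[OF err0] by fastforce
  \<comment> \<open>Passing from q to q^2 leaves room for the rounding losses, d/K <= n^(-3) in the
    factor and n^(-1/2) in the subtracted term after multiplication by sqrt d.\<close>
  have e1: "\<forall>\<^sub>F n in at_top. q\<^sup>2 * sqrt (ln n) \<le> q * sqrt (ln n) * (1 - 1 / n ^ 3) - 1 / sqrt n"
  proof -
    have "q\<^sup>2 < q" using q by (simp add: power2_eq_square)
    then show ?thesis using q by real_asymp
  qed
  have e2: "\<forall>\<^sub>F n in at_top. q\<^sup>2 * m * n \<le> q * m * n * (1 - 1 / n ^ 3) - 1 / sqrt n"
  proof -
    have "q\<^sup>2 * m < q * m" using q m(1) by (simp add: power2_eq_square)
    moreover have "0 < q * m" "0 < q\<^sup>2 * m" using q m(1) by auto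
    moreover have "\<forall>\<^sub>F n in at_top. u * n \<le> v * n * (1 - 1 / n ^ 3) - 1 / sqrt n" if "u < v" "0 < u" "0 < v" for u v :: real
      using that by real_asymp
    ultimately show ?thesis by blast
  qed
  have ev: "\<forall>\<^sub>F k in sequentially. PR_prob (nn k) (dd k) \<le> err (real (nn k)) + 4 / (real (dd k))\<^sup>2 / (\<gamma> - 1)\<^sup>2"
  proof -
    have "\<forall>\<^sub>F k in sequentially. q\<^sup>2 * sqrt (ln (real (nn k))) \<le> q * sqrt (ln (real (nn k))) * (1 - 1 / real (nn k) ^ 3) - 1 / sqrt (real (nn k))"
      "\<forall>\<^sub>F k in sequentially. q\<^sup>2 * m * real (nn k) \<le> q * m * real (nn k) * (1 - 1 / real (nn k) ^ 3) - 1 / sqrt (real (nn k))"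
      using nr e1 e2 by (auto simp: filterlim_iff)
    moreover have "\<forall>\<^sub>F k in sequentially. 3 \<le> nn k" "\<forall>\<^sub>F k in sequentially. 1 \<le> dd k"
      using nn dd by (auto simp: filterlim_at_top)
    ultimately show ?thesis
    proof eventually_elim
      case (elim k)
      define n d L where "n = nn k" and "d = dd k" and "L = ln (real (nn k))"
      have n3: "real n \<ge> 3" and d: "0 < d" and n2: "2 \<le> n" using elim by (auto simp: n_def d_def)
      have L1: "1 \<le> L"
      proof -
        have "exp 1 \<le> real n" using exp_le n3 by linarith
        then show ?thesis using n3 by (simp add: L_def n_def[symmetric] ln_ge_iff)
      qed
      have Ln: "L \<le> real n" using n3 ln_le_minus_one[of "real n"] by (simp add: L_def n_def)
      have d2: "(real d)\<^sup>2 \<le> \<rho> * real n * L" using le by (simp add: n_def d_def L_def)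
      have nL: "0 < real n * L" using n3 L1 by simp
      \<comment> \<open>Leads to d <= n, so that all rounding errors can be bounded in terms of
        n.\<close>
      have "2 / pi < 1" using pi_gt3 by simp
      then have "\<rho> < 1" using \<rho>(2) by linarith
      then have "\<rho> * (real n * L) \<le> 1 * (real n * L)" using nL by (intro mult_right_mono) auto
      then have dnL: "(real d)\<^sup>2 \<le> real n * L" using d2 by (simp add: mult.assoc)
      also have "\<dots> \<le> (real n)\<^sup>2" unfolding power2_eq_square using Ln by (intro mult_left_mono) auto
      finally have dn: "real d \<le> real n" by (rule power2_le_imp_le) simp
      \<comment> \<open>With d <= n the fourth power makes sqrt d * n^2 d / K at most n^(-1/2),
        while ln (2 K + 1) stays of order ln n.\<close>
      define K where "K = n ^ 4"
      have K: "real K = real n ^ 4" by (simp add: K_def)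
      have dK: "d < K"
      proof -
        have "n ^ 1 < n ^ 4" using n2 by (intro power_strict_increasing) auto
        then show ?thesis using dn by (simp add: K_def)
      qed
      define t where "t = q * sqrt L"
      define \<beta> where "\<beta> = q * m"
      define a where "a = t / sqrt (real d) * (1 - real d / real K) - (real n)\<^sup>2 * real d / real K"
      define b where "b = \<beta> * real n / sqrt (real d) * (1 - real d / real K) - (real n)\<^sup>2 * real d / real K"
      have t0: "0 \<le> t" using q L1 by (simp add: t_def)
      have b0: "0 \<le> \<beta>" and b1: "\<beta> \<le> sqrt (2 / pi)" using q m by (simp_all add: \<beta>_def m_def mult_le_cancel_right1)
      have sd: "0 < sqrt (real d)" using d by simp
      have r1: "1 - 1 / real n ^ 3 \<le> 1 - real d / real K"
      proof -
        have "real d / real K \<le> real n / real n ^ 4" unfolding K using dn by (intro divide_right_mono) auto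
        also have "\<dots> = 1 / real n ^ 3" using n3 by (simp add: eval_nat_numeral)
        finally show ?thesis by simp
      qed
      have r2: "sqrt (real d) * ((real n)\<^sup>2 * real d / real K) \<le> 1 / sqrt (real n)"
      proof -
        have "sqrt (real d) * ((real n)\<^sup>2 * real d / real K) \<le> sqrt (real n) * ((real n)\<^sup>2 * real n / real K)"
          using dn by (intro mult_mono divide_right_mono mult_left_mono) auto
        also have "\<dots> = sqrt (real n) / real n" unfolding K using n3 by (simp add: eval_nat_numeral)
        also have "\<dots> = 1 / sqrt (real n)" using n3 by (simp add: field_simps)
        finally show ?thesis .
      qed
      have lower: "c / sqrt (real d) \<le> s / sqrt (real d) * (1 - real d / real K) - (real n)\<^sup>2 * real d / real K"
        if "0 \<le> s" "c \<le> s * (1 - 1 / real n ^ 3) - 1 / sqrt (real n)" for c s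
      proof -
        have "s * (1 - 1 / real n ^ 3) \<le> s * (1 - real d / real K)" using r1 that(1) by (intro mult_left_mono) auto
        then have "c \<le> s * (1 - real d / real K) - sqrt (real d) * ((real n)\<^sup>2 * real d / real K)"
          using that(2) r2 by linarith
        then have "c / sqrt (real d) \<le> (s * (1 - real d / real K) - sqrt (real d) * ((real n)\<^sup>2 * real d / real K)) / sqrt (real d)"
          using sd by (intro divide_right_mono) auto
        also have "\<dots> = s / sqrt (real d) * (1 - real d / real K) - (real n)\<^sup>2 * real d / real K"
          using sd by (simp add: diff_divide_distrib)
        finally show ?thesis .
      qed
      have a1: "q\<^sup>2 * sqrt L / sqrt (real d) \<le> a"
        unfolding a_def by (rule lower[OF t0]) (use elim(1) in \<open>simp add: t_def L_def n_def\<close>)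
      have b2: "q\<^sup>2 * m * real n / sqrt (real d) \<le> b"
        unfolding b_def by (rule lower) (use elim(2) b0 in \<open>simp_all add: \<beta>_def n_def\<close>)
      have pa: "0 < q\<^sup>2 * sqrt L / sqrt (real d)" and pb: "0 < q\<^sup>2 * m * real n / sqrt (real d)"
        using q m L1 n3 sd by simp_all
      have a0: "0 < a" and b00: "0 < b" using pa pb a1 b2 by linarith+
      \<comment> \<open>The square of a b is at least q^8 (2/pi) n^2 ln n / d^2; below the threshold
        this exceeds n, the mean of \<open>frob d (hebb n z)\<close>, by more than the factor
        \<gamma> = 1/q.\<close>
      have "\<gamma> * real n < (a * b)\<^sup>2"
      proof -
        have "(q\<^sup>2 * sqrt L / sqrt (real d) * (q\<^sup>2 * m * real n / sqrt (real d)))\<^sup>2 \<le> (a * b)\<^sup>2"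
          using mult_pos_pos[OF pa pb] a0 pb by (intro power_mono mult_mono a1 b2) linarith+
        moreover have "(q\<^sup>2 * sqrt L / sqrt (real d) * (q\<^sup>2 * m * real n / sqrt (real d)))\<^sup>2 = q ^ 8 * (2 / pi) * (real n)\<^sup>2 * L / (real d)\<^sup>2"
        proof -
          have "q\<^sup>2 * sqrt L / sqrt (real d) * (q\<^sup>2 * m * real n / sqrt (real d)) = q ^ 4 * m * real n * sqrt L / real d"
            using d by (simp add: eval_nat_numeral)
          then show ?thesis using L1 m(2) by (simp add: power_mult_distrib power_divide flip: power_mult)
        qed
        moreover have "\<gamma> * real n < q ^ 8 * (2 / pi) * (real n)\<^sup>2 * L / (real d)\<^sup>2"
        proof -
          have "(real d)\<^sup>2 < q ^ 9 * (2 / pi) * (real n * L)"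
            using d2 mult_strict_right_mono[OF q9 nL] by (simp add: mult.assoc)
          then have "real n * (real d)\<^sup>2 < real n * (q ^ 9 * (2 / pi) * (real n * L))"
            using n3 by (intro mult_strict_left_mono) auto
          also have "\<dots> = q * (q ^ 8 * (2 / pi) * (real n)\<^sup>2 * L)" by (simp add: eval_nat_numeral mult_ac)
          finally have "real n * (real d)\<^sup>2 / q < q ^ 8 * (2 / pi) * (real n)\<^sup>2 * L"
            using q by (simp add: pos_divide_less_eq mult.commute)
          then show ?thesis using d by (simp add: \<gamma>_def pos_less_divide_eq mult_ac)
        qed
        ultimately show ?thesis by linarith
      qed
      note U = PR_prob_upper[OF d n2 dK t0 b0 b1 \<gamma> a_def a0 b_def b00 this]
      have card: "real ((2 * K + 1) ^ d) \<le> exp (sqrt (real n * L) * ln (2 * real n ^ 4 + 1))"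
      proof -
        have "real d \<le> sqrt (real n * L)" using dnL by (rule real_le_rsqrt)
        then have "real d * ln (2 * real n ^ 4 + 1) \<le> sqrt (real n * L) * ln (2 * real n ^ 4 + 1)"
          using n3 by (intro mult_right_mono) (auto intro!: ln_ge_zero)
        moreover have "real ((2 * K + 1) ^ d) = exp (real d * ln (2 * real n ^ 4 + 1))"
        proof -
          have "exp (real d * ln (2 * real n ^ 4 + 1)) = exp (ln (2 * real n ^ 4 + 1)) ^ d"
            by (rule exp_of_nat_mult)
          also have "exp (ln (2 * real n ^ 4 + 1)) = 2 * real n ^ 4 + 1"
            by (intro exp_ln) (auto intro!: add_nonneg_pos)
          finally show ?thesis by (simp add: K_def add.commute)
        qed
        ultimately show ?thesis by simp
      qed
      have "real ((2 * K + 1) ^ d) * (exp (- (real n * (exp (- (t + 1)\<^sup>2 / 2) / sqrt (2 * pi)))) + exp (- (real n * ((sqrt (2 / pi) - \<beta>)\<^sup>2 / 2))))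
         \<le> exp (sqrt (real n * L) * ln (2 * real n ^ 4 + 1)) * (exp (- (real n * (exp (- (t + 1)\<^sup>2 / 2) / sqrt (2 * pi)))) + exp (- (real n * ((sqrt (2 / pi) - \<beta>)\<^sup>2 / 2))))"
        using card by (intro mult_right_mono add_nonneg_nonneg) auto
      also have "\<dots> = exp (sqrt (real n * L) * ln (2 * real n ^ 4 + 1) - real n * (exp (- (t + 1)\<^sup>2 / 2) / sqrt (2 * pi)))
         + exp (sqrt (real n * L) * ln (2 * real n ^ 4 + 1) - real n * ((m - q * m)\<^sup>2 / 2))"
        unfolding distrib_left exp_add[symmetric] m_def[symmetric] \<beta>_def by simp
      finally have "PR_prob n d \<le> 2 / real n + (exp (sqrt (real n * L) * ln (2 * real n ^ 4 + 1) - real n * (exp (- (t + 1)\<^sup>2 / 2) / sqrt (2 * pi)))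
         + exp (sqrt (real n * L) * ln (2 * real n ^ 4 + 1) - real n * ((m - q * m)\<^sup>2 / 2))) + (4 / (real d)\<^sup>2 + 18 / real n) / (\<gamma> - 1)\<^sup>2"
        using U by linarith
      then show ?case
        unfolding err_def t_def L_def n_def d_def by (simp only: add_divide_distrib)
    qed
  qed
  show ?thesis
    by (rule tendsto_sandwich[OF _ ev tendsto_const bound0]) (simp add: PR_prob_def)
qed

theorem theorem2p1:
  shows "(\<forall>\<rho>1::real. \<rho>1 > 8 \<longrightarrow>
            (\<forall>nn dd :: nat \<Rightarrow> nat.
               filterlim nn at_top sequentially \<longrightarrow> filterlim dd at_top sequentially \<longrightarrow>
               (\<forall>k. real (dd k) ^ 2 \<ge> \<rho>1 * real (nn k) * ln (real (nn k))) \<longrightarrow>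
               ((\<lambda>k. PR_prob (nn k) (dd k)) \<longlonglongrightarrow> 1)))
       \<and> (\<forall>\<rho>2::real. 0 < \<rho>2 \<and> \<rho>2 < 2 / pi \<longrightarrow>
            (\<forall>nn dd :: nat \<Rightarrow> nat.
               filterlim nn at_top sequentially \<longrightarrow> filterlim dd at_top sequentially \<longrightarrow>
               (\<forall>k. real (dd k) ^ 2 \<le> \<rho>2 * real (nn k) * ln (real (nn k))) \<longrightarrow>
               ((\<lambda>k. PR_prob (nn k) (dd k)) \<longlonglongrightarrow> 0)))"
  using PR_prob_tendsto_1 PR_prob_tendsto_0 by blast

end
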